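(* Let $\mu$ be a positive, $\sigma$-finite, locally finite Borel measure on the unit disk $\mathbb{D}$ with $\mu(\mathbb{D})=+\infty$, let $\Lambda_\mu$ be the Poisson point process on $\mathbb{D}$ with intensity $\mu$, and let $\mu_{n,k}=\mu(T_{n,k})$ for $n\ge 0$, $0\le k\le 2^n-1$. (a) If $1/2<\alpha<1$, then \[ \mathbb{P}\bigl(\Lambda_\mu\text{ is interpolating for }\mathcal{D}_\alpha\bigr)= \begin{cases} 1 & \text{if } \sum_{n,k}\mu_{n,k}^{2}<+\infty,\\ 0 & \text{if } \sum_{n,k}\mu_{n,k}^{2}=+\infty. \end{cases} \] (b) If $0\le\alpha<1/2$ and there exists $\gamma$ with $1<\gamma<\frac{1}{1-\alpha}$ such that $\sum_{n,k}\mu_{n,k}^{\gamma}<+\infty$, then \[ \mathbb{P}\bigl(\Lambda_\mu\text{ is interpolating for }\mathcal{D}_\alpha\bigr)=1. \]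
   Context: $\mathbb{D}=\{z\in\mathbb{C}:|z|<1\}$; $H(\mathbb{D})$ is the space of holomorphic functions in $\mathbb{D}$; $dm$ is normalized Lebesgue measure on $\mathbb{D}$. The Poisson point process $\Lambda_\mu$ with intensity $\mu$ is the random sequence of points of $\mathbb{D}$ (unique in law) such that, writing $N_A=\#(A\cap\Lambda_\mu)$: (i) for each Borel set $A\subset\mathbb{D}$, $N_A$ is a Poisson random variable of parameter $\mu(A)$; (ii) $N_A$ and $N_B$ are independent for disjoint Borel sets $A,B\subset\mathbb{D}$. Locally finite means finite on compact subsets of $\mathbb{D}$. Dyadic boxes: for $n\ge 0$ and $k=0,1,\dots,2^n-1$, \[ T_{n,k}=\Bigl\{z=re^{it}\in\mathbb{D}: 2^{-(n+1)}<1-r\le 2^{-n},\ \tfrac{k}{2^n}\le\tfrac{t}{2\pi}<\tfrac{k+1}{2^n}\Bigr\}. \] Sums $\sum_{n,k}$ run over all $n\ge 0$ and $0\le k\le 2^n-1$. The weighted Dirichlet space is the Hilbert space $\mathcal{D}_\alpha=\{f\in H(\mathbb{D}):\|f\|_{\mathcal{D}_\alpha}^2=|f(0)|^2+\int_{\mathbb{D}}|f'(z)|^2(1-|z|^2)^\alpha\,dm(z)<\infty\}$. Let $k_\lambda\in\mathcal{D}_\alpha$ denote the reproducing kernel at $\lambda\in\mathbb{D}$, i.e. $f(\lambda)=\langle f,k_\lambda\rangle$ for all $f\in\mathcal{D}_\alpha$. A sequence $\{\lambda_n\}_n\subset\mathbb{D}$ is interpolating for $\mathcal{D}_\alpha$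 if the map $f\mapsto\bigl(f(\lambda_n)/\|k_{\lambda_n}\|\bigr)_n$ sends $\mathcal{D}_\alpha$ into and onto $\ell^2$.
   Formalization: The points of the Poisson process are taken to be almost surely distinct, which forces μ to have no atoms; if μ has an atom, a point is repeated with positive probability, so the probability-one claims fail. *)

theory Defs
  imports "HOL-Analysis.Analysis" "HOL-Probability.Probability"
begin

abbreviation unit_disk :: "complex set" where
  "unit_disk \<equiv> ball 0 1"

definition disk_area :: "complex measure" where
  "disk_area = uniform_measure (restrict_space lborel unit_disk) unit_disk"


section \<open>Weighted Dirichlet spaces\<close>

text \<open>
  Elements of the space are total functions of which only the restriction to the disk matters:
  two functions that agree on the disk represent the same element.
\<close>

definition dirichlet_space :: "real \<Rightarrow> (complex \<Rightarrow> complex) set" where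
  "dirichlet_space \<alpha> =
     {f. f holomorphic_on unit_disk \<and>
         (\<integral>\<^sup>+z. ennreal ((cmod (deriv f z))\<^sup>2 * (1 - (cmod z)\<^sup>2) powr \<alpha>) \<partial>disk_area) < \<infinity>}"

definition dirichlet_inner ::
    "real \<Rightarrow> (complex \<Rightarrow> complex) \<Rightarrow> (complex \<Rightarrow> complex) \<Rightarrow> complex" where
  "dirichlet_inner \<alpha> f g =
     f 0 * cnj (g 0) +
     (LINT z|disk_area. deriv f z * cnj (deriv g z) * of_real ((1 - (cmod z)\<^sup>2) powr \<alpha>))"

definition dirichlet_norm :: "real \<Rightarrow> (complex \<Rightarrow> complex) \<Rightarrow> real" where
  "dirichlet_norm \<alpha> f =
     sqrt ((cmod (f 0))\<^sup>2 +
           (LINT z|disk_area. (cmod (deriv f z))\<^sup>2 * (1 - (cmod z)\<^sup>2) powr \<alpha>))"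

definition is_reproducing_kernel :: "real \<Rightarrow> complex \<Rightarrow> (complex \<Rightarrow> complex) \<Rightarrow> bool" where
  "is_reproducing_kernel \<alpha> w k \<longleftrightarrow>
     k \<in> dirichlet_space \<alpha> \<and> (\<forall>f \<in> dirichlet_space \<alpha>. f w = dirichlet_inner \<alpha> f k)"

text \<open>
  The kernel at \<open>w\<close> is determined on the disk, so neither its norm nor its inner products
  depend on the choice made here.
\<close>

definition dirichlet_kernel :: "real \<Rightarrow> complex \<Rightarrow> complex \<Rightarrow> complex" where
  "dirichlet_kernel \<alpha> w = (SOME k. is_reproducing_kernel \<alpha> w k)"

definition ell2 :: "(nat \<Rightarrow> complex) set" where
  "ell2 = {a. summable (\<lambda>n. (cmod (a n))\<^sup>2)}"

definition interpolating :: "real \<Rightarrow> (nat \<Rightarrow> complex) \<Rightarrow> bool" where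
  "interpolating \<alpha> l \<longleftrightarrow>
     range l \<subseteq> unit_disk \<and>
     (\<lambda>f n. f (l n) / of_real (dirichlet_norm \<alpha> (dirichlet_kernel \<alpha> (l n)))) `
       dirichlet_space \<alpha> = ell2"


section \<open>Dyadic boxes\<close>

definition dyadic_box :: "nat \<Rightarrow> nat \<Rightarrow> complex set" where
  "dyadic_box n k =
     {z. \<exists>r t. z = of_real r * cis t \<and>
            1 / 2 ^ (n + 1) < 1 - r \<and> 1 - r \<le> 1 / 2 ^ n \<and>
            real k / 2 ^ n \<le> t / (2 * pi) \<and> t / (2 * pi) < real (k + 1) / 2 ^ n}"


section \<open>Poisson point processes on the disk\<close>

definition locally_finite_on_disk :: "complex measure \<Rightarrow> bool" where
  "locally_finite_on_disk \<mu> \<longleftrightarrow>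
     (\<forall>K. compact K \<and> K \<subseteq> unit_disk \<longrightarrow> emeasure \<mu> K < \<infinity>)"

text \<open>The Poisson law with parameter \<open>0\<close> is concentrated at 0, the one with parameter \<open>\<infinity>\<close> at \<open>\<infinity>\<close>.\<close>

definition poisson_distributed :: "'w measure \<Rightarrow> ('w \<Rightarrow> ennreal) \<Rightarrow> ennreal \<Rightarrow> bool" where
  "poisson_distributed M N m \<longleftrightarrow>
     N \<in> borel_measurable M \<and>
     (if m = \<infinity> then AE \<omega> in M. N \<omega> = \<infinity>
      else \<forall>j::nat. measure M {\<omega> \<in> space M. N \<omega> = of_nat j} =
                    enn2real m ^ j / fact j * exp (- enn2real m))"

definition point_count :: "(nat \<Rightarrow> 'w \<Rightarrow> complex) \<Rightarrow> complex set \<Rightarrow> 'w \<Rightarrow> ennreal" where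
  "point_count X A \<omega> = emeasure (count_space UNIV) (A \<inter> range (\<lambda>n. X n \<omega>))"

text \<open>
  A Poisson process whose intensity \<open>\<mu>\<close> has infinite total mass has almost surely infinitely many
  points, so it is an infinite random sequence; the definition covers only this case.
  The sequence enumerates the points of the process, each of them once (almost surely), so
  that \<^term>\<open>point_count X A\<close> is both the number of indices \<open>n\<close> with \<open>X n \<in> A\<close> and the cardinality
  of the intersection of \<open>A\<close> with the set of points. Since the number of points in a singleton is
  then at most 1, such a process exists only if \<open>\<mu>\<close> has no atoms.
\<close>

definition poisson_process ::
    "'w measure \<Rightarrow> complex measure \<Rightarrow> (nat \<Rightarrow> 'w \<Rightarrow> complex) \<Rightarrow> bool" where
  "poisson_process M \<mu> X \<longleftrightarrow>
     prob_space M \<and>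
     (\<forall>n. X n \<in> borel_measurable M) \<and>
     (\<forall>n. \<forall>\<omega> \<in> space M. X n \<omega> \<in> unit_disk) \<and>
     (AE \<omega> in M. inj (\<lambda>n. X n \<omega>)) \<and>
     (\<forall>A \<in> sets borel. A \<subseteq> unit_disk \<longrightarrow>
        poisson_distributed M (point_count X A) (emeasure \<mu> A)) \<and>
     (\<forall>A \<in> sets borel. \<forall>B \<in> sets borel. A \<subseteq> unit_disk \<and> B \<subseteq> unit_disk \<and> A \<inter> B = {} \<longrightarrow>
        prob_space.indep_var M borel (point_count X A) borel (point_count X B))"

end

theory Submission
  imports Defs "HOL-Complex_Analysis.Complex_Analysis"
begin

text \<open>
  The sequence \<open>l\<close> is interpolating iff evaluation at its points, normalized by the kernel norms, maps the
  space onto \<open>ell2\<close>. If the Gram matrix of the normalized kernels differs from the identity by a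
  Hilbert-Schmidt matrix, this holds: a tail of the sequence has Gram matrix close to the
  identity, which gives solutions by iteration, and the finitely many remaining points are corrected with functions
  obtained by multiplying a solution for a tail by a polynomial. The kernel is comparable to
  \<open>(1 - z cnj w) powr (- a)\<close>, so the Gram entries are controlled by the dyadic boxes of the two points. Since \<open>N_T N_T'\<close>
  has mean \<open>\<mu>(T) \<mu>(T')\<close> for distinct boxes and \<open>N_T (N_T - 1)\<close> has mean \<open>\<mu>(T)\<^sup>2\<close>, the expected
  Hilbert-Schmidt norm is a quadratic form in the masses \<open>\<mu>(T)\<close>, which Schur's test bounds by the given sums.

  If the sum of the squares diverges, cut each box into \<open>L\<^sup>2\<close> pieces and keep a heaviest one; by a
  second-moment Borel-Cantelli argument almost surely infinitely many of these pieces contain two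
  points, for every \<open>L\<close>. Such close pairs cannot carry values of very different size.
\<close>

section \<open>Coefficients of the reproducing kernel\<close>

text \<open>The thresholds come from counting boxes. Between generations \<open>n\<close> and
  \<open>m\<close> the box kernel to the power \<open>beta\<close> decays like
  \<open>2 powr (- beta * |n - m|)\<close>, while a coarser box has \<open>2 ^ |n - m|\<close>
  descendants in the finer generation; with a weight balancing the two directions this is summable
  for \<open>beta > 1 / 2\<close>. So square summable masses suffice for exponents above 1/2; below
  that the estimate is interpolated with the trivial bound of the kernel by 1, at the price of a
  summability exponent gamma with gamma (1 - alpha) < 1. Both positive statements are thus one
  estimate. Two points in one box do not by themselves contradict interpolation; pairs whose
  relative distance tends to 0 do, which is why boxes are cut arbitrarily finely. For a fixed
  \<open>L\<close> a heaviest piece keeps at least the fraction \<open>1 / L^2\<close> of the mass,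
  so the squares still diverge. The process offers independence of only two disjoint sets at a time,
  hence the argument by variances. The analysis is done on Taylor coefficients, where inner
  products, completeness and the reproducing kernel are explicit.\<close>

text \<open>\<open>kernel_coef a n\<close> is the inverse of the squared norm of \<open>z ^ n\<close> (see \<open>kernel_coef_Beta\<close>), written so as
  to exhibit the kernel as \<open>(1 - z) powr (- a) / a\<close> plus a bounded function.\<close>

definition binom_coef :: "real \<Rightarrow> nat \<Rightarrow> real" where
  "binom_coef a n = pochhammer a n / fact n"

definition kernel_coef :: "real \<Rightarrow> nat \<Rightarrow> real" where
  "kernel_coef a n = (if n = 0 then 1 else binom_coef a n * (1 / a + 1 / real n))"

lemma binom_coef_0 [simp]: "binom_coef a 0 = 1"
  by (simp add: binom_coef_def)

lemma binom_coef_Suc: "binom_coef a (Suc n) = binom_coef a n * (a + real n) / real (Suc n)"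
  by (simp add: binom_coef_def pochhammer_rec' field_simps)

lemma binom_coef_pos: "0 < a \<Longrightarrow> 0 < binom_coef a n"
  by (simp add: binom_coef_def pochhammer_pos)

lemma binom_coef_sums:
  assumes "cmod z < 1"
  shows "(\<lambda>n. of_real (binom_coef a n) * z ^ n) sums ((1 - z) powr (- of_real a))"
proof -
  have "(\<lambda>n. ((- of_real a) gchoose n) * (-z) ^ n) sums (1 + (-z)) powr (- of_real a)"
    by (rule gen_binomial_complex) (use assms in simp)
  moreover have "((- of_real a) gchoose n) * (-z) ^ n = of_real (binom_coef a n) * z ^ n" for n
  proof -
    have "(-z) ^ n = (-1) ^ n * z ^ n" by (metis power_minus)
    then show ?thesis
      by (simp add: gbinomial_pochhammer binom_coef_def pochhammer_of_real)
  qed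
  ultimately show ?thesis by simp
qed

lemma binom_coef_sums_real:
  assumes "0 \<le> x" "x < 1"
  shows "(\<lambda>n. binom_coef a n * x ^ n) sums ((1 - x) powr (- a))"
proof -
  have "(\<lambda>n. of_real (binom_coef a n) * of_real x ^ n) sums ((1 - of_real x) powr (- of_real a) :: complex)"
    by (rule binom_coef_sums) (use assms in simp)
  moreover have "((1 - of_real x) powr (- of_real a) :: complex) = of_real ((1 - x) powr (- a))"
    using assms powr_of_real[of "1 - x" "- a"] by simp
  ultimately have "(\<lambda>n. of_real (binom_coef a n * x ^ n)) sums (of_real ((1 - x) powr (- a)) :: complex)"
    by simp
  then show ?thesis by (simp only: sums_of_real_iff)
qed

text \<open>Each summand is \<open>1 / (1 - a)\<close> times the decrement
  \<open>binom_coef a n - binom_coef a (Suc n)\<close>, so the partial sums telescope. The sum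
  controls what is left of \<open>kernel_fun\<close> after its power term is removed.\<close>

lemma binom_coef_decr_sums:
  assumes "0 < a" "a < 1"
  shows "summable (\<lambda>n. binom_coef a n / real (Suc n))"
    and "(\<Sum>n. binom_coef a n / real (Suc n)) \<le> 1 / (1 - a)"
proof -
  have tel: "binom_coef a n / real (Suc n) = (binom_coef a n - binom_coef a (Suc n)) / (1 - a)" for n
    using assms by (simp add: binom_coef_Suc divide_simps) (simp add: algebra_simps)
  have part: "(\<Sum>k<n. binom_coef a k / real (Suc k)) \<le> 1 / (1 - a)" for n
  proof -
    have "(\<Sum>k<n. binom_coef a k / real (Suc k)) = (\<Sum>k<n. binom_coef a k - binom_coef a (Suc k)) / (1 - a)"
      by (simp only: tel sum_divide_distrib)
    also have "\<dots> = (1 - binom_coef a n) / (1 - a)"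
      by (simp only: sum_lessThan_telescope' binom_coef_0)
    also have "\<dots> \<le> 1 / (1 - a)"
      using assms binom_coef_pos[OF assms(1), of n] by (intro divide_right_mono) auto
    finally show ?thesis .
  qed
  have nn: "0 \<le> binom_coef a n / real (Suc n)" for n
    using binom_coef_pos[OF assms(1), of n] by simp
  show s: "summable (\<lambda>n. binom_coef a n / real (Suc n))"
    by (rule summableI_nonneg_bounded[OF nn part])
  show "(\<Sum>n. binom_coef a n / real (Suc n)) \<le> 1 / (1 - a)"
    by (rule suminf_le_const[OF s part])
qed

lemma kernel_coef_0 [simp]: "kernel_coef a 0 = 1"
  by (simp add: kernel_coef_def)

lemma kernel_coef_pos: "0 < a \<Longrightarrow> 0 < kernel_coef a n"
  by (auto simp: kernel_coef_def intro!: mult_pos_pos binom_coef_pos add_pos_pos)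

lemma binom_coef_le_kernel_coef:
  assumes "0 < a" "a < 1" shows "binom_coef a n \<le> kernel_coef a n"
proof (cases "n = 0")
  case False
  have "1 \<le> 1 / a + 1 / real n" using assms by (intro add_increasing2) auto
  then show ?thesis using False binom_coef_pos[OF assms(1), of n]
    by (simp add: kernel_coef_def)
qed auto

text \<open>Multiplication by \<open>z\<close> shifts Taylor coefficients; this ratio bound is what
  makes it a bounded operator in \<open>fun_of_mult_linear\<close>.\<close>

lemma kernel_coef_Suc_ge:
  assumes "0 < a" "a < 1" shows "kernel_coef a n \<le> 4 * kernel_coef a (Suc n)"
proof (cases "n = 0")
  case True
  then show ?thesis using assms by (simp add: kernel_coef_def binom_coef_Suc field_simps)
next
  case False
  then have n: "real n \<ge> 1" by simp
  have e: "(1 / a + 1 / real n) \<le> 4 * ((a + real n) / (1 + real n) * (1 / a + 1 / (1 + real n)))"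
  proof -
    have "(1 + real n)\<^sup>2 \<le> 4 * (real n)\<^sup>2"
      using n power_mono[of "1 + real n" "2 * real n" 2] by (simp add: power_mult_distrib)
    also have "\<dots> \<le> 4 * real n * (real n + a + 1)"
      using n assms by (simp add: power2_eq_square algebra_simps)
    finally have k: "(1 + real n)\<^sup>2 \<le> 4 * real n * (real n + a + 1)" .
    have "4 * ((a + real n) / (1 + real n) * (1 / a + 1 / (1 + real n))) - (1 / a + 1 / real n)
       = (a + real n) * (4 * real n * (real n + a + 1) - (1 + real n)\<^sup>2) / (a * real n * (1 + real n)\<^sup>2)"
      using n assms by (simp add: divide_simps power2_eq_square) (simp add: algebra_simps)
    also have "\<dots> \<ge> 0" using k n assms by auto
    finally show ?thesis by linarith
  qed
  show ?thesis
    using mult_left_mono[OF e, of "binom_coef a n"] binom_coef_pos[OF assms(1), of n] False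
    by (simp add: kernel_coef_def binom_coef_Suc mult_ac)
qed

text \<open>These are the coefficients of the kernel differentiated once in each variable, again a
  binomial series, now with exponent \<open>a + 2\<close>. They serve to identify the norm of
  \<open>z ^ n\<close> and to bound derivatives.\<close>

lemma kernel_coef_Suc_sq:
  assumes "0 < a"
  shows "(real (Suc n))\<^sup>2 * kernel_coef a (Suc n) = (a + 1) * binom_coef (a + 2) n"
proof -
  have "pochhammer a (Suc n) * (a + real (Suc n)) = a * (a + 1) * pochhammer (a + 2) n"
  proof -
    have "pochhammer a (Suc n) * (a + real (Suc n)) = pochhammer a (Suc (Suc n))"
      by (subst pochhammer_rec'[of a "Suc n"]) (simp add: mult_ac)
    also have "\<dots> = a * ((a + 1) * pochhammer (a + 1 + 1) n)"
      by (simp only: pochhammer_rec)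
    also have "a + 1 + 1 = a + 2" by simp
    finally show ?thesis by simp
  qed
  moreover have "a * (a + 1) \<noteq> 0" using assms by auto
  ultimately have eq: "pochhammer (a+2) n = pochhammer a (Suc n) * (a + real (Suc n)) / (a * (a + 1))"
    by (simp only: nonzero_mult_div_cancel_left simp_thms)
  have "(real (Suc n))\<^sup>2 * kernel_coef a (Suc n) =
     real (Suc n) * (pochhammer a (Suc n) * (a + real (Suc n))) / (fact (Suc n) * a)"
    unfolding kernel_coef_def binom_coef_def power2_eq_square using assms
    by (simp add: divide_simps del: fact_Suc pochhammer_Suc of_nat_Suc)
  also have "\<dots> = (pochhammer a (Suc n) * (a + real (Suc n))) / (fact n * a)"
    by (simp add: divide_simps del: pochhammer_Suc)
  also have "\<dots> = (a + 1) * binom_coef (a + 2) n"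
    unfolding binom_coef_def eq using assms by (simp add: divide_simps del: pochhammer_Suc)
  finally show ?thesis .
qed

text \<open>By \<open>nn_integral_moment\<close> the second factor is the weighted integral of the
  squared derivative of \<open>z ^ Suc n\<close>; this ties the coefficients to the norm of the
  space.\<close>

lemma kernel_coef_Beta:
  assumes "0 < a"
  shows "kernel_coef a (Suc n) * ((real (Suc n))\<^sup>2 * Beta (real (Suc n)) (a + 1)) = 1"
proof -
  have G: "Gamma (real (Suc n)) = fact n" by (simp add: Gamma_fact)
  have nz: "a + 2 \<notin> \<int>\<^sub>\<le>\<^sub>0" "a + 1 \<notin> \<int>\<^sub>\<le>\<^sub>0" using assms
    by (auto elim!: nonpos_Ints_cases)
  have "pochhammer (a + 2) n = Gamma (a + 2 + real n) / Gamma (a + 2)"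
    by (rule pochhammer_Gamma[OF nz(1)])
  moreover have "Gamma (a + 2) = (a + 1) * Gamma (a + 1)"
    using Gamma_plus1[OF nz(2)] by (simp add: add.assoc)
  ultimately have e: "pochhammer (a + 2) n * (a + 1) = Gamma (a + 2 + real n) / Gamma (a + 1)"
    using assms by simp
  have sum_eq: "real (Suc n) + (a + 1) = a + 2 + real n" by simp
  have B: "Beta (real (Suc n)) (a + 1) = fact n / (pochhammer (a + 2) n * (a + 1))"
    unfolding Beta_def G e sum_eq by simp
  have "kernel_coef a (Suc n) * ((real (Suc n))\<^sup>2 * Beta (real (Suc n)) (a + 1))
      = (a + 1) * binom_coef (a + 2) n * Beta (real (Suc n)) (a + 1)"
    by (simp only: kernel_coef_Suc_sq[OF assms, of n, symmetric] mult_ac)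
  also have "\<dots> = 1"
    unfolding B binom_coef_def using assms pochhammer_pos[of "a + 2" n]
    by simp
  finally show ?thesis .
qed

lemma kernel_coef_deriv_sums:
  assumes "0 < a" "0 \<le> x" "x < 1"
  shows "(\<lambda>n. (real (Suc n))\<^sup>2 * kernel_coef a (Suc n) * x ^ n) sums ((a + 1) * (1 - x) powr (- (a + 2)))"
  unfolding kernel_coef_Suc_sq[OF assms(1)]
  using sums_mult[OF binom_coef_sums_real[OF assms(2,3), of "a + 2"], of "a + 1"] by (simp add: mult.assoc)

lemma summable_kernel_coef:
  assumes "0 < a" "a < 1" "cmod z < 1"
  shows "summable (\<lambda>n. norm (of_real (kernel_coef a n) * z ^ n))"
proof (rule summable_comparison_test')
  have "summable (\<lambda>n. binom_coef a n * cmod z ^ n)"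
    using binom_coef_sums_real[of "cmod z" a] assms by (auto simp: sums_iff)
  then show "summable (\<lambda>n. (1 / a + 1) * (binom_coef a n * cmod z ^ n))"
    by (rule summable_mult)
  fix n :: nat
  have "kernel_coef a n \<le> (1 / a + 1) * binom_coef a n"
  proof (cases "n = 0")
    case True then show ?thesis using assms by simp
  next
    case False
    then have "1 / a + 1 / real n \<le> 1 / a + 1" by simp
    from mult_left_mono[OF this, of "binom_coef a n"] show ?thesis
      using False binom_coef_pos[OF assms(1), of n] by (simp add: kernel_coef_def mult_ac)
  qed
  from mult_right_mono[OF this, of "cmod z ^ n"]
  show "norm (norm (of_real (kernel_coef a n) * z ^ n)) \<le> (1 / a + 1) * (binom_coef a n * cmod z ^ n)"
    using kernel_coef_pos[OF assms(1), of n] by (simp add: norm_mult norm_power mult_ac)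
qed

section \<open>Upper and lower estimates of the reproducing kernel\<close>

definition kernel_fun :: "real \<Rightarrow> complex \<Rightarrow> complex" where
  "kernel_fun a z = (\<Sum>n. of_real (kernel_coef a n) * z ^ n)"

lemma kernel_fun_sums:
  assumes "0 < a" "a < 1" "cmod z < 1"
  shows "(\<lambda>n. of_real (kernel_coef a n) * z ^ n) sums kernel_fun a z"
  unfolding kernel_fun_def using summable_norm_cancel[OF summable_kernel_coef[OF assms]]
  by (rule summable_sums)

lemma norm_one_minus_powr:
  assumes "cmod z < 1"
  shows "cmod ((1 - z) powr (- of_real a)) = cmod (1 - z) powr (- a)"
proof -
  have "1 - z \<noteq> 0" using assms by auto
  then show ?thesis
    by (simp add: powr_def)
qed

text \<open>The singular part is \<open>(1 - z) powr (- a) / a\<close>; the remainder has absolutely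
  summable coefficients and is bounded on the disk by \<open>D\<close>.\<close>

lemma kernel_fun_upper:
  assumes "0 < a" "a < 1"
  shows "\<exists>C>0. \<forall>z. cmod z < 1 \<longrightarrow> cmod (kernel_fun a z) \<le> C * cmod (1 - z) powr (- a)"
proof (intro exI conjI allI impI)
  \<comment> \<open>\<open>1 + 1 / a\<close> bounds the constant term of the remainder; the 2 in the
    last term comes from \<open>1 / n <= 2 / (n + 1)\<close>.\<close>
  define D where "D = 1 + 1 / a + 2 / (1 - a)"
  have D: "D > 0" using assms by (auto simp: D_def intro!: add_pos_pos)
  show "1 / a + 2 * D > 0" using assms D by (auto intro!: add_pos_pos)
  fix z :: complex assume z: "cmod z < 1"
  define r where "r n = (if n = 0 then 1 - 1 / a else binom_coef a n / real n)" for n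
  have rb: "\<bar>r n\<bar> \<le> (if n = 0 then 1 + 1 / a else 0) + 2 * (binom_coef a n / real (Suc n))" for n
  proof (cases "n = 0")
    case False
    then have "1 / real n \<le> 2 / real (Suc n)" by (simp add: field_simps)
    from mult_left_mono[OF this, of "binom_coef a n"] show ?thesis
      using False binom_coef_pos[OF assms(1), of n] by (simp add: r_def mult.commute)
  next
    case True
    have "\<bar>1 - 1 / a\<bar> \<le> 1 + 1 / a" using assms by (simp add: abs_le_iff)
    then show ?thesis using True by (simp add: r_def)
  qed
  define b where "b n = (if n = 0 then 1 + 1 / a else 0) + 2 * (binom_coef a n / real (Suc n))" for n
  have bs: "summable b" "suminf b \<le> D"
  proof -
    have 1: "(\<lambda>n. if n = 0 then 1 + 1 / a else 0) sums (1 + 1 / a)"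
      using sums_If_finite_set[of "{0::nat}" "\<lambda>_. 1 + 1 / a"] by simp
    have 2: "(\<lambda>n. 2 * (binom_coef a n / real (Suc n))) sums (2 * (\<Sum>n. binom_coef a n / real (Suc n)))"
      by (intro sums_mult summable_sums binom_coef_decr_sums assms)
    have "b sums (1 + 1 / a + 2 * (\<Sum>n. binom_coef a n / real (Suc n)))"
      unfolding b_def using sums_add[OF 1 2] by simp
    then show "summable b" "suminf b \<le> D"
      using binom_coef_decr_sums(2)[OF assms] by (auto simp: sums_iff D_def)
  qed
  have le: "norm (of_real (r n) * z ^ n) \<le> b n" for n
  proof -
    have "cmod z ^ n \<le> 1" using z by (simp add: power_le_one)
    then have "norm (of_real (r n) * z ^ n) \<le> \<bar>r n\<bar>"
      by (simp add: norm_mult norm_power mult_left_le)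
    with rb[of n] show ?thesis by (simp add: b_def)
  qed
  have sn: "summable (\<lambda>n. norm (of_real (r n) * z ^ n))"
    using le by (intro summable_comparison_test'[OF bs(1)]) auto
  have R: "cmod (\<Sum>n. of_real (r n) * z ^ n) \<le> D"
    using summable_norm[OF sn] suminf_le[OF le sn bs(1)] bs(2) by linarith
  have split: "of_real (kernel_coef a n) * z ^ n =
      of_real (1 / a) * (of_real (binom_coef a n) * z ^ n) + of_real (r n) * z ^ n" for n
    using assms by (auto simp: kernel_coef_def r_def algebra_simps)
  have "kernel_fun a z = of_real (1 / a) * ((1 - z) powr (- of_real a)) + (\<Sum>n. of_real (r n) * z ^ n)"
  proof -
    have "(\<lambda>n. of_real (kernel_coef a n) * z ^ n) sums
        (of_real (1 / a) * ((1 - z) powr (- of_real a)) + (\<Sum>n. of_real (r n) * z ^ n))"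
      unfolding split
      by (intro sums_add sums_mult binom_coef_sums z summable_sums summable_norm_cancel[OF sn])
    then show ?thesis unfolding kernel_fun_def by (rule sums_unique[symmetric])
  qed
  then have "cmod (kernel_fun a z) \<le> (1 / a) * cmod (1 - z) powr (- a) + D"
    using R norm_triangle_ineq[of "of_real (1 / a) * ((1 - z) powr (- of_real a))" "(\<Sum>n. of_real (r n) * z ^ n)"]
      norm_one_minus_powr[OF z, of a] assms by (simp add: norm_divide)
  \<comment> \<open>Since \<open>cmod (1 - z) <= 2\<close> and \<open>a < 1\<close>, the power is at
    least \<open>1 / 2\<close>, so the bounded remainder can be absorbed into it.\<close>
  moreover have "D \<le> 2 * D * cmod (1 - z) powr (- a)"
  proof -
    have "cmod (1 - z) \<le> 2" using norm_triangle_ineq4[of 1 z] z by simp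
    moreover have "cmod (1 - z) > 0" using z by auto
    ultimately have "2 powr (- a) \<le> cmod (1 - z) powr (- a)"
      using assms by (intro powr_mono2') auto
    moreover have "(2::real) powr (-1) \<le> 2 powr (- a)" using assms by (intro powr_mono) auto
    ultimately have "1 \<le> 2 * cmod (1 - z) powr (- a)" by (simp add: powr_minus)
    from mult_left_mono[OF this, of D] D show ?thesis by simp
  qed
  ultimately show "cmod (kernel_fun a z) \<le> (1 / a + 2 * D) * cmod (1 - z) powr (- a)"
    by (simp add: algebra_simps)
qed

text \<open>For real arguments nothing cancels: all coefficients are positive and dominate those of
  the binomial series. At the square of \<open>cmod z\<close> this bounds the kernel norm from
  below.\<close>

lemma kernel_fun_lower:
  assumes "0 < a" "a < 1" "0 \<le> x" "x < 1"
  shows "(\<lambda>n. kernel_coef a n * x ^ n) sums Re (kernel_fun a (of_real x))"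
    and "kernel_fun a (of_real x) = of_real (Re (kernel_fun a (of_real x)))"
    and "(1 - x) powr (- a) \<le> Re (kernel_fun a (of_real x))"
proof -
  have "(\<lambda>n. of_real (kernel_coef a n) * of_real x ^ n) sums kernel_fun a (of_real x)"
    by (rule kernel_fun_sums) (use assms in auto)
  then have s: "(\<lambda>n. complex_of_real (kernel_coef a n * x ^ n)) sums kernel_fun a (of_real x)"
    by simp
  show s': "(\<lambda>n. kernel_coef a n * x ^ n) sums Re (kernel_fun a (of_real x))"
    using sums_Re[OF s] by simp
  show "kernel_fun a (of_real x) = of_real (Re (kernel_fun a (of_real x)))"
    using sums_of_real[OF s', where ?'a = complex] s sums_unique2 by blast
  show "(1 - x) powr (- a) \<le> Re (kernel_fun a (of_real x))"
    by (rule sums_le[OF _ binom_coef_sums_real[OF assms(3,4)] s'])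
       (auto intro!: mult_right_mono binom_coef_le_kernel_coef simp: assms)
qed

section \<open>Area measure on the disk\<close>

lemma Complex_measurable [measurable]:
  "(\<lambda>p::real \<times> real. Complex (fst p) (snd p)) \<in> borel_measurable borel"
  by (intro borel_measurable_continuous_onI continuous_intros)

text \<open>Both measures agree on open boxes, which determine \<open>lborel\<close>. Iterated
  integration over real and imaginary parts rests on this.\<close>

lemma lborel_complex:
  "(lborel :: complex measure) = distr (lborel \<Otimes>\<^sub>M lborel) borel (\<lambda>p. Complex (fst p) (snd p))"
proof (rule lborel_eqI)
  have mb: "(\<lambda>p::real \<times> real. Complex (fst p) (snd p)) \<in> measurable (lborel \<Otimes>\<^sub>M lborel) borel"
    using Complex_measurable by (simp add: lborel_prod)
  fix l u :: complex assume le: "\<And>b. b \<in> Basis \<Longrightarrow> l \<bullet> b \<le> u \<bullet> b"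
  have le': "Re l \<le> Re u" "Im l \<le> Im u" using le[of 1] le[of \<i>] by (auto simp: Basis_complex_def)
  have "(\<lambda>p::real \<times> real. Complex (fst p) (snd p)) -` box l u \<inter> space (lborel \<Otimes>\<^sub>M lborel)
      = {Re l<..<Re u} \<times> {Im l<..<Im u}"
    by (auto simp: in_box_complex_iff space_pair_measure)
  then have "emeasure (distr (lborel \<Otimes>\<^sub>M lborel) borel (\<lambda>p. Complex (fst p) (snd p))) (box l u)
     = emeasure (lborel \<Otimes>\<^sub>M lborel) ({Re l<..<Re u} \<times> {Im l<..<Im u})"
    by (subst emeasure_distr[OF mb]) auto
  also have "\<dots> = ennreal ((Re u - Re l) * (Im u - Im l))"
    using le' by (subst lborel.emeasure_pair_measure_Times) (auto simp: ennreal_mult)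
  also have "\<dots> = ennreal (\<Prod>b\<in>Basis. (u - l) \<bullet> b)"
    by (simp add: Basis_complex_def)
  finally show "emeasure (distr (lborel \<Otimes>\<^sub>M lborel) borel (\<lambda>p. Complex (fst p) (snd p))) (box l u)
      = ennreal (\<Prod>b\<in>Basis. (u - l) \<bullet> b)" .
qed simp

lemma nn_integral_complex:
  fixes f :: "complex \<Rightarrow> ennreal"
  assumes f [measurable]: "f \<in> borel_measurable borel"
  shows "(\<integral>\<^sup>+z. f z \<partial>lborel) = (\<integral>\<^sup>+y. \<integral>\<^sup>+x. f (Complex x y) \<partial>lborel \<partial>lborel)"
    and "(\<integral>\<^sup>+z. f z \<partial>lborel) = (\<integral>\<^sup>+x. \<integral>\<^sup>+y. f (Complex x y) \<partial>lborel \<partial>lborel)"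
proof -
  have mb: "(\<lambda>p::real \<times> real. Complex (fst p) (snd p)) \<in> measurable (lborel \<Otimes>\<^sub>M lborel) borel"
    using Complex_measurable by (simp add: lborel_prod)
  have fm: "(\<lambda>p::real \<times> real. f (Complex (fst p) (snd p))) \<in> borel_measurable (lborel \<Otimes>\<^sub>M lborel)"
    using measurable_compose[OF mb f] .
  have "(\<integral>\<^sup>+z. f z \<partial>lborel) = (\<integral>\<^sup>+p. f (Complex (fst p) (snd p)) \<partial>(lborel \<Otimes>\<^sub>M lborel))"
    unfolding lborel_complex using f by (intro nn_integral_distr[OF mb]) simp
  then show "(\<integral>\<^sup>+z. f z \<partial>lborel) = (\<integral>\<^sup>+y. \<integral>\<^sup>+x. f (Complex x y) \<partial>lborel \<partial>lborel)"
    and "(\<integral>\<^sup>+z. f z \<partial>lborel) = (\<integral>\<^sup>+x. \<integral>\<^sup>+y. f (Complex x y) \<partial>lborel \<partial>lborel)"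
    using lborel_pair.nn_integral_snd[OF fm[unfolded split_beta']] lborel.nn_integral_fst[OF fm] by simp_all
qed

text \<open>Along each horizontal line the shear is a translation, so translation invariance in one
  variable suffices.\<close>

lemma nn_integral_shear_Re:
  fixes f :: "complex \<Rightarrow> ennreal"
  assumes f [measurable]: "f \<in> borel_measurable borel"
  shows "(\<integral>\<^sup>+z. f (Complex (Re z + t * Im z) (Im z)) \<partial>lborel) = (\<integral>\<^sup>+z. f z \<partial>lborel)"
proof -
  have c: "(\<lambda>z. Complex (Re z + t * Im z) (Im z)) \<in> borel_measurable borel"
    by (intro borel_measurable_continuous_onI continuous_intros)
  have m: "(\<lambda>z. f (Complex (Re z + t * Im z) (Im z))) \<in> borel_measurable borel"
    using measurable_compose[OF c f] .
  have "(\<integral>\<^sup>+x. f (Complex (x + t * y) y) \<partial>lborel) = (\<integral>\<^sup>+x. f (Complex x y) \<partial>lborel)" for y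
  proof -
    have "(\<lambda>x. Complex x y) \<in> borel_measurable borel"
      by (intro borel_measurable_continuous_onI continuous_intros)
    from measurable_compose[OF this f]
    have "(\<integral>\<^sup>+x. f (Complex x y) \<partial>lborel) = \<bar>1::real\<bar> * (\<integral>\<^sup>+x. f (Complex (t * y + 1 * x) y) \<partial>lborel)"
      by (intro nn_integral_real_affine) auto
    then show ?thesis by (simp add: add.commute)
  qed
  then show ?thesis
    by (subst nn_integral_complex(1)[OF m], subst nn_integral_complex(1)[OF f]) simp
qed

lemma nn_integral_shear_Im:
  fixes f :: "complex \<Rightarrow> ennreal"
  assumes f [measurable]: "f \<in> borel_measurable borel"
  shows "(\<integral>\<^sup>+z. f (Complex (Re z) (Im z + t * Re z)) \<partial>lborel) = (\<integral>\<^sup>+z. f z \<partial>lborel)"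
proof -
  have c: "(\<lambda>z. Complex (Re z) (Im z + t * Re z)) \<in> borel_measurable borel"
    by (intro borel_measurable_continuous_onI continuous_intros)
  have m: "(\<lambda>z. f (Complex (Re z) (Im z + t * Re z))) \<in> borel_measurable borel"
    using measurable_compose[OF c f] .
  have "(\<integral>\<^sup>+y. f (Complex x (y + t * x)) \<partial>lborel) = (\<integral>\<^sup>+y. f (Complex x y) \<partial>lborel)" for x
  proof -
    have "(\<lambda>y. Complex x y) \<in> borel_measurable borel"
      by (intro borel_measurable_continuous_onI continuous_intros)
    from measurable_compose[OF this f]
    have "(\<integral>\<^sup>+y. f (Complex x y) \<partial>lborel) = \<bar>1::real\<bar> * (\<integral>\<^sup>+y. f (Complex x (t * x + 1 * y)) \<partial>lborel)"
      by (intro nn_integral_real_affine) auto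
    then show ?thesis by (simp add: add.commute)
  qed
  then show ?thesis
    by (subst nn_integral_complex(2)[OF m], subst nn_integral_complex(2)[OF f]) simp
qed

text \<open>A rotation is a product of three shears.\<close>

lemma nn_integral_rotation:
  fixes f :: "complex \<Rightarrow> ennreal"
  assumes f [measurable]: "f \<in> borel_measurable borel" and c: "cmod c = 1" "c \<noteq> -1"
  shows "(\<integral>\<^sup>+z. f (c * z) \<partial>lborel) = (\<integral>\<^sup>+z. f z \<partial>lborel)"
proof -
  define a b where "a = Re c" and "b = Im c"
  have ab: "a * a + b * b = 1" using c(1) by (simp add: a_def b_def cmod_def power2_eq_square)
  have na: "1 + a \<noteq> 0"
  proof
    assume "1 + a = 0"
    then have "a = -1" by simp
    with ab have "a = -1" "b = 0" by auto
    then show False using c(2) by (simp add: a_def b_def complex_eq_iff)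
  qed
  \<comment> \<open>For \<open>c = cis theta\<close> this is minus the tangent of
    \<open>theta / 2\<close>, finite because \<open>c\<close> is not \<open>-1\<close>; the outer
    shears have parameter \<open>t\<close>, the middle one has \<open>b\<close>.\<close>
  define t where "t = - b / (1 + a)"
  have t1: "1 + t * b = a"
  proof -
    have "1 + t * b = (1 + a - b * b) / (1 + a)" using na by (simp add: t_def field_simps)
    also have "1 + a - b * b = a * (1 + a)" using ab by (simp add: algebra_simps)
    finally show ?thesis using na by simp
  qed
  have t2: "t * (1 + a) = - b" using na by (simp add: t_def)
  define S where "S = (\<lambda>z. Complex (Re z + t * Im z) (Im z))"
  define R where "R = (\<lambda>z. Complex (Re z) (Im z + b * Re z))"
  have rot: "c * z = S (R (S z))" for z
  proof (rule complex_eqI)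
    have "Re (S (R (S z))) = (1 + t * b) * Re z + t * (1 + (1 + t * b)) * Im z"
      by (simp add: S_def R_def algebra_simps)
    also have "\<dots> = a * Re z - b * Im z" by (simp only: t1 t2)
    finally show "Re (c * z) = Re (S (R (S z)))" by (simp add: a_def b_def)
    have "Im (S (R (S z))) = (1 + t * b) * Im z + b * Re z"
      by (simp add: S_def R_def algebra_simps)
    also have "\<dots> = a * Im z + b * Re z" by (simp only: t1)
    finally show "Im (c * z) = Im (S (R (S z)))" by (simp add: a_def b_def)
  qed
  have [measurable]: "S \<in> borel_measurable borel" "R \<in> borel_measurable borel" unfolding S_def R_def
    by (intro borel_measurable_continuous_onI continuous_intros)+
  have m1: "(\<lambda>z. f (S (R z))) \<in> borel_measurable borel"
    and m2: "(\<lambda>z. f (S z)) \<in> borel_measurable borel" by measurable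
  have "(\<integral>\<^sup>+z. f (c * z) \<partial>lborel) = (\<integral>\<^sup>+z. f (S (R (S z))) \<partial>lborel)" by (simp only: rot)
  also have "\<dots> = (\<integral>\<^sup>+z. f (S (R z)) \<partial>lborel)"
    using nn_integral_shear_Re[OF m1, of t] by (simp add: S_def)
  also have "\<dots> = (\<integral>\<^sup>+z. f (S z) \<partial>lborel)"
    using nn_integral_shear_Im[OF m2, of b] by (simp add: R_def)
  also have "\<dots> = (\<integral>\<^sup>+z. f z \<partial>lborel)"
    using nn_integral_shear_Re[OF f, of t] by (simp add: S_def)
  finally show ?thesis .
qed

section \<open>Normalized area: rotation invariance and radial integrals\<close>

lemma space_disk_area [simp]: "space disk_area = unit_disk"
  by (simp add: disk_area_def space_restrict_space)

lemma sets_disk_area [measurable_cong]: "sets disk_area = sets (restrict_space borel unit_disk)"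
  by (simp add: disk_area_def sets_restrict_space)

lemma in_sets_disk_area: "A \<in> sets disk_area \<longleftrightarrow> A \<in> sets borel \<and> A \<subseteq> unit_disk"
  by (auto simp: sets_disk_area sets_restrict_space_iff)

lemma emeasure_disk_area:
  assumes "A \<in> sets borel" "A \<subseteq> unit_disk"
  shows "emeasure disk_area A = emeasure lborel A / ennreal pi"
proof -
  have pi: "emeasure (restrict_space lborel unit_disk) (unit_disk :: complex set) = ennreal pi"
    by (subst emeasure_restrict_space) (auto simp: emeasure_ball unit_ball_vol_2)
  have "A \<in> sets (restrict_space lborel unit_disk)"
    using assms by (auto simp: sets_restrict_space_iff)
  then show ?thesis
    using assms unfolding disk_area_def
    by (subst emeasure_uniform_measure)
       (auto simp: pi emeasure_restrict_space Int_absorb1 sets_restrict_space_iff)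
qed

lemma prob_space_disk_area: "prob_space disk_area"
proof
  show "emeasure disk_area (space disk_area) = 1"
    by (simp add: emeasure_disk_area emeasure_ball unit_ball_vol_2 ennreal_divide_self)
qed

lemma measurable_disk_rotation:
  assumes c: "cmod c = 1"
  shows "(\<lambda>z. c * z) \<in> measurable disk_area disk_area"
proof (rule measurableI)
  show "c * z \<in> space disk_area" if "z \<in> space disk_area" for z
    using that c by (simp add: norm_mult)
  fix A assume A: "A \<in> sets disk_area"
  then have "A \<in> sets borel" by (simp add: in_sets_disk_area)
  then have "(\<lambda>z. c * z) -` A \<inter> space borel \<in> sets borel"
    by (intro measurable_sets[of "\<lambda>z. c * z" borel borel A]) auto
  then show "(\<lambda>z. c * z) -` A \<inter> space disk_area \<in> sets disk_area"
    by (auto simp: in_sets_disk_area)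
qed

lemma disk_area_rotation:
  assumes c: "cmod c = 1" "c \<noteq> -1"
  shows "distr disk_area disk_area (\<lambda>z. c * z) = disk_area"
proof (rule measure_eqI)
  fix A assume "A \<in> sets (distr disk_area disk_area (\<lambda>z. c * z))"
  then have A: "A \<in> sets borel" "A \<subseteq> unit_disk" "A \<in> sets disk_area" by (auto simp: in_sets_disk_area)
  have pre: "(\<lambda>z. c * z) -` A \<inter> space borel \<in> sets borel"
    by (intro measurable_sets[of "\<lambda>z. c * z" borel borel A]) (use A in auto)
  have sub: "(\<lambda>z. c * z) -` A \<subseteq> unit_disk" using A c
    by (force simp: norm_mult)
  have "emeasure (distr disk_area disk_area (\<lambda>z. c * z)) A = emeasure disk_area ((\<lambda>z. c * z) -` A)"
    using sub by (subst emeasure_distr[OF measurable_disk_rotation[OF c(1)] A(3)]) (simp add: Int_absorb2)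
  also have "\<dots> = emeasure lborel ((\<lambda>z. c * z) -` A) / ennreal pi"
    using pre sub by (intro emeasure_disk_area) auto
  also have "emeasure lborel ((\<lambda>z. c * z) -` A) = (\<integral>\<^sup>+z. indicator ((\<lambda>z. c * z) -` A) z \<partial>lborel)"
    using pre by simp
  also have "\<dots> = (\<integral>\<^sup>+z. indicator A (c * z) \<partial>lborel)"
    by (intro nn_integral_cong) (simp add: indicator_def)
  also have "\<dots> = (\<integral>\<^sup>+z. indicator A z \<partial>lborel)"
    by (rule nn_integral_rotation[OF _ c]) (use A in simp)
  also have "\<dots> = emeasure lborel A" using A by simp
  finally show "emeasure (distr disk_area disk_area (\<lambda>z. c * z)) A = emeasure disk_area A"
    using A by (simp add: emeasure_disk_area)
qed simp

text \<open>A substitute for polar coordinates: the disk of radius \<open>sqrt x\<close> has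
  normalized area \<open>x\<close>, so the squared modulus is uniformly distributed. The two laws
  are compared through their distribution functions.\<close>

lemma disk_area_norm_sq:
  "distr disk_area borel (\<lambda>z. (cmod z)\<^sup>2) = uniform_measure lborel {0..1::real}"
proof (rule cdf_unique')
  interpret prob_space disk_area by (rule prob_space_disk_area)
  have m: "(\<lambda>z. (cmod z)\<^sup>2) \<in> borel_measurable disk_area"
    by (subst measurable_cong_sets[OF sets_disk_area refl]) (intro measurable_restrict_space1, simp)
  interpret D: prob_space "distr disk_area borel (\<lambda>z. (cmod z)\<^sup>2)"
    by (rule prob_space_distr[OF m])
  interpret U: prob_space "uniform_measure lborel {0..1::real}"
    by (rule prob_space_uniform_measure) auto
  show "finite_borel_measure (distr disk_area borel (\<lambda>z. (cmod z)\<^sup>2))"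
    by unfold_locales auto
  show "finite_borel_measure (uniform_measure lborel {0..1::real})"
    by unfold_locales auto
  show "cdf (distr disk_area borel (\<lambda>z. (cmod z)\<^sup>2)) = cdf (uniform_measure lborel {0..1::real})"
  proof
    fix x :: real
    have L: "cdf (distr disk_area borel (\<lambda>z. (cmod z)\<^sup>2)) x = measure disk_area {z\<in>unit_disk. (cmod z)\<^sup>2 \<le> x}"
      unfolding cdf_def using m by (subst measure_distr) (auto intro!: arg_cong[where f = "measure disk_area"])
    have R: "cdf (uniform_measure lborel {0..1::real}) x = measure lborel ({0..1} \<inter> {..x})"
      unfolding cdf_def by (subst measure_uniform_measure) auto
    consider "x < 0" | "0 \<le> x" "x < 1" | "1 \<le> x" by linarith
    then show "cdf (distr disk_area borel (\<lambda>z. (cmod z)\<^sup>2)) x = cdf (uniform_measure lborel {0..1::real}) x"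
    proof cases
      case 1
      have e: "{z\<in>unit_disk. (cmod z)\<^sup>2 \<le> x} = {}"
      proof -
        have "\<not> (cmod z)\<^sup>2 \<le> x" for z using 1 by (smt (verit) zero_le_power2)
        then show ?thesis by auto
      qed
      have "{0..1} \<inter> {..x} = {}" using 1 by auto
      then show ?thesis unfolding L R e by simp
    next
      case 2
      have e: "{z\<in>unit_disk. (cmod z)\<^sup>2 \<le> x} = cball 0 (sqrt x)"
      proof -
        have sq: "(cmod z)\<^sup>2 \<le> x \<longleftrightarrow> cmod z \<le> sqrt x" for z
          using real_sqrt_le_iff[of "(cmod z)\<^sup>2" x] by simp
        have lt: "sqrt x < 1" using 2 by simp
        have "cmod z < 1" if "cmod z \<le> sqrt x" for z using that lt by linarith
        then show ?thesis unfolding sq by auto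
      qed
      have s: "cball 0 (sqrt x) \<subseteq> (unit_disk :: complex set)" unfolding e[symmetric] by auto
      have "emeasure disk_area (cball 0 (sqrt x)) = ennreal (pi * x) / ennreal pi"
        using s 2 by (subst emeasure_disk_area) (auto simp: emeasure_cball unit_ball_vol_2)
      also have "\<dots> = ennreal x" using 2 by (simp add: divide_ennreal)
      finally have "measure disk_area (cball 0 (sqrt x)) = x" using 2 by (simp add: measure_def)
      moreover have "{0..1} \<inter> {..x} = {0..x}" using 2 by auto
      ultimately show ?thesis unfolding L R e using 2 by simp
    next
      case 3
      have e: "{z\<in>unit_disk. (cmod z)\<^sup>2 \<le> x} = space disk_area"
      proof -
        have "(cmod z)\<^sup>2 \<le> x" if "cmod z < 1" for z
          using that 3 power_le_one[of "cmod z" 2] by auto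
        then show ?thesis by auto
      qed
      have "{0..1} \<inter> {..x} = {0..1}" using 3 by auto
      then show ?thesis unfolding L R e using prob_space by simp
    qed
  qed
qed

lemma measurable_disk_area: "f \<in> borel_measurable borel \<Longrightarrow> f \<in> borel_measurable disk_area"
  by (subst measurable_cong_sets[OF sets_disk_area refl]) (rule measurable_restrict_space1)

lemma continuous_on_measurable_disk_area:
  "continuous_on unit_disk f \<Longrightarrow> f \<in> borel_measurable disk_area"
  by (subst measurable_cong_sets[OF sets_disk_area refl]) (rule borel_measurable_continuous_on_restrict)

lemma nn_integral_disk_area_radial:
  assumes [measurable]: "g \<in> borel_measurable borel"
  shows "(\<integral>\<^sup>+z. g ((cmod z)\<^sup>2) \<partial>disk_area) = (\<integral>\<^sup>+x. g x * indicator {0..1} x \<partial>lborel)"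
proof -
  have "(\<integral>\<^sup>+z. g ((cmod z)\<^sup>2) \<partial>disk_area) = (\<integral>\<^sup>+x. g x \<partial>distr disk_area borel (\<lambda>z. (cmod z)\<^sup>2))"
    by (intro nn_integral_distr[symmetric] measurable_disk_area) auto
  also have "\<dots> = (\<integral>\<^sup>+x. g x \<partial>uniform_measure lborel {0..1})"
    by (simp only: disk_area_norm_sq)
  also have "\<dots> = (\<integral>\<^sup>+x. g x * indicator {0..1} x \<partial>lborel)"
    by (subst nn_integral_uniform_measure) (simp_all add: divide_ennreal_def)
  finally show ?thesis .
qed

lemma nn_integral_moment:
  assumes "0 < a"
  shows "(\<integral>\<^sup>+z. ennreal ((cmod z) ^ (2 * n) * (1 - (cmod z)\<^sup>2) powr a) \<partial>disk_area)
       = ennreal (Beta (real (Suc n)) (a + 1))"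
proof -
  define g where "g x = ennreal (x ^ n * (1 - x) powr a)" for x :: real
  have [measurable]: "g \<in> borel_measurable borel" unfolding g_def by measurable
  have hi: "((\<lambda>t. t powr (real (Suc n) - 1) * (1 - t) powr (a + 1 - 1)) has_integral Beta (real (Suc n)) (a + 1)) {0..1}"
    by (rule has_integral_Beta_real) (use assms in auto)
  \<comment> \<open>For \<open>n = 0\<close> the integrands differ at 0, because
    \<open>0 powr 0 = 0\<close> whereas \<open>0 ^ 0 = 1\<close>; a single point is
    negligible.\<close>
  have hi': "((\<lambda>t. t ^ n * (1 - t) powr a) has_integral Beta (real (Suc n)) (a + 1)) {0..1}"
  proof (rule has_integral_spike[OF _ _ hi])
    show "negligible {0::real}" by simp
    show "t ^ n * (1 - t) powr a = t powr (real (Suc n) - 1) * (1 - t) powr (a + 1 - 1)"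
      if "t \<in> {0..1} - {0}" for t :: real
      using that by (simp add: powr_realpow)
  qed
  have "(\<integral>\<^sup>+z. ennreal ((cmod z) ^ (2 * n) * (1 - (cmod z)\<^sup>2) powr a) \<partial>disk_area) = (\<integral>\<^sup>+z. g ((cmod z)\<^sup>2) \<partial>disk_area)"
    by (simp add: g_def power_mult)
  also have "\<dots> = (\<integral>\<^sup>+x. g x * indicator {0..1} x \<partial>lborel)"
    by (rule nn_integral_disk_area_radial) simp
  also have "\<dots> = (\<integral>\<^sup>+x. ennreal (x ^ n * (1 - x) powr a * indicator {0..1} x) \<partial>lborel)"
    by (intro nn_integral_cong) (auto simp: g_def indicator_def)
  also have "\<dots> = ennreal (Beta (real (Suc n)) (a + 1))"
  proof (rule nn_integral_has_integral_lborel)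
    show "(\<lambda>x. x ^ n * (1 - x) powr a * indicator {0..1} x) \<in> borel_measurable borel" by measurable
    show "0 \<le> x ^ n * (1 - x) powr a * indicator {0..1} x" for x :: real
      by (auto simp: indicator_def)
    show "((\<lambda>x. x ^ n * (1 - x) powr a * indicator {0..1} x) has_integral Beta (real (Suc n)) (a + 1)) UNIV"
    proof -
      have "(\<lambda>x. x ^ n * (1 - x) powr a * indicator {0..1} x)
          = (\<lambda>x::real. if x \<in> {0..1} then x ^ n * (1 - x) powr a else 0)" by auto
      with hi' show ?thesis by (simp only: has_integral_restrict_UNIV)
    qed
  qed
  finally show ?thesis .
qed

section \<open>Parseval's identity on the disk\<close>

text \<open>Rotation by \<open>c\<close> preserves the measure and multiplies the integrand by
  \<open>c ^ m * cnj (c ^ n)\<close>, so the integral vanishes once this factor differs from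
  1.\<close>

lemma integral_disk_area_orthogonal:
  assumes psi [measurable]: "psi \<in> borel_measurable borel" and mn: "m \<noteq> n"
  shows "(LINT z|disk_area. z ^ m * cnj (z ^ n) * of_real (psi (cmod z))) = 0"
proof -
  \<comment> \<open>With this angle the factor has argument \<open>(m - n) * t\<close>, nonzero and
    of absolute value at most 1, where the sine has no other zero; the same reason keeps
    \<open>c\<close> different from \<open>-1\<close>.\<close>
  define t where "t = 1 / real (m + n + 1)"
  define c where "c = cis t"
  have t: "0 < t" "t \<le> 1" by (auto simp: t_def)
  have c1: "cmod c = 1" by (simp add: c_def)
  have sin_nz: "sin x \<noteq> 0" if "x \<noteq> 0" "\<bar>x\<bar> \<le> 1" for x :: real
  proof (cases "x > 0")
    case True
    then have "sin x > 0" using that pi_gt3 by (intro sin_gt_zero) auto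
    then show ?thesis by simp
  next
    case False
    then have "sin (-x) > 0" using that pi_gt3 by (intro sin_gt_zero) auto
    then show ?thesis by simp
  qed
  have "c \<noteq> -1"
  proof
    assume "c = -1"
    then have "Im c = Im (-1)" by (rule arg_cong)
    then have "sin t = 0" by (simp add: c_def)
    with sin_nz[of t] t show False by auto
  qed
  note rot = disk_area_rotation[OF c1 this]
  define x where "x = (real m - real n) * t"
  have cc: "c ^ m * cnj (c ^ n) = cis x"
    by (simp add: c_def Complex.DeMoivre cis_cnj cis_mult x_def algebra_simps)
  have "cis x \<noteq> 1"
  proof
    assume "cis x = 1"
    then have "Im (cis x) = Im 1" by (rule arg_cong)
    then have "sin x = 0" by simp
    moreover have "x \<noteq> 0" using mn t by (auto simp: x_def)
    moreover have "\<bar>x\<bar> \<le> 1"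
      by (auto simp: x_def t_def abs_mult field_simps)
    ultimately show False using sin_nz by blast
  qed
  define F where "F z = z ^ m * cnj (z ^ n) * of_real (psi (cmod z))" for z :: complex
  have "(\<lambda>z. z ^ m * cnj (z ^ n)) \<in> borel_measurable borel"
    by (intro borel_measurable_continuous_onI continuous_intros)
  then have Fb: "F \<in> borel_measurable borel" unfolding F_def by measurable
  then have Fm: "F \<in> borel_measurable disk_area" by (rule measurable_disk_area)
  have Fc: "F (c * z) = cis x * F z" for z
    unfolding cc[symmetric] F_def by (simp add: norm_mult c1 power_mult_distrib mult_ac)
  have "integral\<^sup>L disk_area F = integral\<^sup>L (distr disk_area disk_area (\<lambda>z. c * z)) F"
    by (simp only: rot)
  also have "\<dots> = (LINT z|disk_area. F (c * z))"
    by (rule integral_distr[OF measurable_disk_rotation[OF c1] Fm])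
  also have "\<dots> = cis x * integral\<^sup>L disk_area F"
    unfolding Fc by simp
  finally have "(cis x - 1) * integral\<^sup>L disk_area F = 0" by (simp add: algebra_simps)
  with \<open>cis x \<noteq> 1\<close> show ?thesis unfolding F_def[abs_def] by simp
qed

lemma integrable_disk_area_bounded:
  fixes f :: "complex \<Rightarrow> 'b::{banach, second_countable_topology}"
  assumes "f \<in> borel_measurable disk_area" "\<And>z. cmod z < 1 \<Longrightarrow> norm (f z) \<le> B"
  shows "integrable disk_area f"
proof -
  interpret prob_space disk_area by (rule prob_space_disk_area)
  show ?thesis by (rule integrable_const_bound[where B = B]) (use assms in auto)
qed

lemma integral_polynomial_sq:
  assumes psi [measurable]: "psi \<in> borel_measurable borel"
    and bd: "\<And>r. 0 \<le> psi r" "\<And>r. psi r \<le> 1"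
  shows "(LINT z|disk_area. (cmod (\<Sum>n<N. b n * z ^ n))\<^sup>2 * psi (cmod z))
       = (\<Sum>n<N. (cmod (b n))\<^sup>2 * (LINT z|disk_area. (cmod z) ^ (2 * n) * psi (cmod z)))"
proof -
  have mes: "(\<lambda>z. z ^ m * cnj (z ^ n) * of_real (psi (cmod z))) \<in> borel_measurable disk_area" for m n
  proof -
    have "(\<lambda>z::complex. z ^ m * cnj (z ^ n)) \<in> borel_measurable borel"
      by (intro borel_measurable_continuous_onI continuous_intros)
    then have "(\<lambda>z::complex. z ^ m * cnj (z ^ n) * of_real (psi (cmod z))) \<in> borel_measurable borel"
      by measurable
    then show ?thesis by (rule measurable_disk_area)
  qed
  have int: "integrable disk_area (\<lambda>z. z ^ m * cnj (z ^ n) * of_real (psi (cmod z)))" for m n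
  proof (rule integrable_disk_area_bounded[OF mes, where B = 1])
    fix z :: complex assume "cmod z < 1"
    then have "cmod z ^ m \<le> 1" "cmod z ^ n \<le> 1" by (auto simp: power_le_one)
    then show "norm (z ^ m * cnj (z ^ n) * of_real (psi (cmod z))) \<le> 1"
      using bd[of "cmod z"] by (simp add: norm_mult norm_power mult_le_one)
  qed
  have "of_real (LINT z|disk_area. (cmod (\<Sum>n<N. b n * z ^ n))\<^sup>2 * psi (cmod z))
      = (LINT z|disk_area. (\<Sum>m<N. \<Sum>n<N. b m * cnj (b n) * (z ^ m * cnj (z ^ n) * of_real (psi (cmod z)))))"
    unfolding integral_complex_of_real[symmetric]
  proof (rule Bochner_Integration.integral_cong[OF refl])
    fix z :: complex
    have "of_real ((cmod (\<Sum>n<N. b n * z ^ n))\<^sup>2) = (\<Sum>m<N. b m * z ^ m) * cnj (\<Sum>n<N. b n * z ^ n)"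
      by (simp only: complex_norm_square)
    also have "\<dots> = (\<Sum>m<N. \<Sum>n<N. (b m * z ^ m) * cnj (b n * z ^ n))"
      by (simp only: cnj_sum sum_product)
    finally show "of_real ((cmod (\<Sum>n<N. b n * z ^ n))\<^sup>2 * psi (cmod z)) =
      (\<Sum>m<N. \<Sum>n<N. b m * cnj (b n) * (z ^ m * cnj (z ^ n) * of_real (psi (cmod z))))"
      by (simp add: sum_distrib_right sum_distrib_left mult_ac)
  qed
  also have "\<dots> = (\<Sum>m<N. \<Sum>n<N. b m * cnj (b n) * (LINT z|disk_area. z ^ m * cnj (z ^ n) * of_real (psi (cmod z))))"
    using int by (simp add: Bochner_Integration.integral_sum)
  also have "\<dots> = (\<Sum>m<N. b m * cnj (b m) * (LINT z|disk_area. z ^ m * cnj (z ^ m) * of_real (psi (cmod z))))"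
  proof (rule sum.cong[OF refl])
    fix m assume m: "m \<in> {..<N}"
    have "(\<Sum>n<N. b m * cnj (b n) * (LINT z|disk_area. z ^ m * cnj (z ^ n) * of_real (psi (cmod z))))
        = (\<Sum>n<N. if n = m then b m * cnj (b m) * (LINT z|disk_area. z ^ m * cnj (z ^ m) * of_real (psi (cmod z))) else 0)"
      using integral_disk_area_orthogonal[OF psi, of m] by (intro sum.cong[OF refl]) auto
    also have "\<dots> = b m * cnj (b m) * (LINT z|disk_area. z ^ m * cnj (z ^ m) * of_real (psi (cmod z)))"
      using m by simp
    finally show "(\<Sum>n<N. b m * cnj (b n) * (LINT z|disk_area. z ^ m * cnj (z ^ n) * of_real (psi (cmod z))))
       = b m * cnj (b m) * (LINT z|disk_area. z ^ m * cnj (z ^ m) * of_real (psi (cmod z)))" .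
  qed
  also have "\<dots> = of_real (\<Sum>n<N. (cmod (b n))\<^sup>2 * (LINT z|disk_area. (cmod z) ^ (2 * n) * psi (cmod z)))"
  proof -
    have e: "z ^ m * cnj (z ^ m) * of_real (psi (cmod z)) = of_real ((cmod z) ^ (2 * m) * psi (cmod z))" for z m
      using complex_norm_square[of "z ^ m"]
      by (simp add: norm_power power_mult power_mult_distrib[symmetric] power_commutes power2_eq_square)
    show ?thesis unfolding e integral_complex_of_real by (simp add: complex_norm_square[symmetric])
  qed
  finally show ?thesis by (simp only: of_real_eq_iff)
qed

lemma powser_norm_summable:
  fixes b :: "nat \<Rightarrow> complex"
  assumes "\<And>z. cmod z < 1 \<Longrightarrow> summable (\<lambda>n. b n * z ^ n)" "0 \<le> r" "r < 1"
  shows "summable (\<lambda>n. cmod (b n) * r ^ n)"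
proof -
  obtain s where s: "r < s" "s < 1" using dense[OF assms(3)] by auto
  have "summable (\<lambda>n. norm (b n * (of_real r) ^ n))"
    by (rule powser_insidea[of b "of_real s"]) (use s assms in auto)
  then show ?thesis using assms by (simp add: norm_mult norm_power)
qed

text \<open>Cutting the weight off at \<open>r < 1\<close> makes the partial sums uniformly bounded
  on its support, so orthogonality passes to the limit by dominated convergence, whether or not the
  full integral is finite.\<close>

lemma parseval_truncated:
  fixes b :: "nat \<Rightarrow> complex"
  assumes b: "\<And>z. cmod z < 1 \<Longrightarrow> (\<lambda>n. b n * z ^ n) sums g z"
    and r: "0 < r" "r < 1" and a: "0 < a"
  defines "psi \<equiv> \<lambda>s. (if \<bar>s\<bar> < r then (1 - s\<^sup>2) powr a else 0)"
  shows "(\<integral>\<^sup>+z. ennreal ((cmod (g z))\<^sup>2 * psi (cmod z)) \<partial>disk_area)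
       = (\<Sum>n. ennreal ((cmod (b n))\<^sup>2) * (\<integral>\<^sup>+z. ennreal ((cmod z) ^ (2 * n) * psi (cmod z)) \<partial>disk_area))"
proof -
  interpret prob_space disk_area by (rule prob_space_disk_area)
  have psi [measurable]: "psi \<in> borel_measurable borel" unfolding psi_def by measurable
  have bd: "0 \<le> psi s" "psi s \<le> 1" for s
  proof -
    show "0 \<le> psi s" by (simp add: psi_def)
    show "psi s \<le> 1"
    proof (cases "\<bar>s\<bar> < r")
      case True
      then have "s\<^sup>2 \<le> 1" using r by (simp add: abs_square_le_1)
      then have "(1 - s\<^sup>2) powr a \<le> 1" using a by (intro powr_le1) auto
      then show ?thesis by (simp add: psi_def)
    qed (simp add: psi_def)
  qed
  have sumb: "summable (\<lambda>n. b n * z ^ n)" if "cmod z < 1" for z using b[OF that] by (simp add: sums_iff)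
  define B where "B = (\<Sum>n. cmod (b n) * r ^ n)"
  have sB: "summable (\<lambda>n. cmod (b n) * r ^ n)" by (rule powser_norm_summable[OF sumb]) (use r in auto)
  define P where "P N z = (\<Sum>n<N. b n * z ^ n)" for N z
  have PB: "cmod (P N z) \<le> B" if "cmod z < r" for N z
  proof -
    have "cmod (P N z) \<le> (\<Sum>n<N. cmod (b n) * r ^ n)"
      unfolding P_def using that
      by (intro sum_norm_le) (auto simp: norm_mult norm_power intro!: mult_left_mono power_mono)
    also have "\<dots> \<le> B" unfolding B_def using r by (intro sum_le_suminf[OF sB]) auto
    finally show ?thesis .
  qed
  have lim: "(\<lambda>N. P N z) \<longlonglongrightarrow> g z" if "cmod z < 1" for z
    using b[OF that] by (simp add: sums_def P_def)
  have gB: "cmod (g z) \<le> B" if "cmod z < r" for z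
    using LIMSEQ_le_const2[OF tendsto_norm[OF lim]] PB[OF that] that r by force
  have PM: "P N \<in> borel_measurable disk_area" for N unfolding P_def
    by (intro continuous_on_measurable_disk_area continuous_intros)
  have gM: "g \<in> borel_measurable disk_area"
    by (rule borel_measurable_LIMSEQ_metric[OF PM]) (use lim in auto)
  have psiM: "(\<lambda>z. psi (cmod z)) \<in> borel_measurable disk_area"
    by (rule measurable_disk_area) simp
  have ub: "norm ((cmod w)\<^sup>2 * psi (cmod z)) \<le> B\<^sup>2" if "cmod z < r \<Longrightarrow> cmod w \<le> B" for w z
  proof (cases "cmod z < r")
    case True
    have "(cmod w)\<^sup>2 * psi (cmod z) \<le> B\<^sup>2 * 1"
      using that[OF True] bd[of "cmod z"] by (intro mult_mono power_mono) auto
    then show ?thesis using bd[of "cmod z"] by simp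
  qed (simp add: psi_def)
  have gi: "integrable disk_area (\<lambda>z. (cmod (g z))\<^sup>2 * psi (cmod z))"
    by (rule integrable_disk_area_bounded[where B = "B\<^sup>2"]) (use gM psiM gB ub in auto)
  have mi: "integrable disk_area (\<lambda>z. (cmod z) ^ (2 * n) * psi (cmod z))" for n
  proof (rule integrable_disk_area_bounded[where B = 1])
    show "(\<lambda>z. cmod z ^ (2 * n) * psi (cmod z)) \<in> borel_measurable disk_area"
      by (rule measurable_disk_area) simp
    show "norm (cmod z ^ (2 * n) * psi (cmod z)) \<le> 1" if "cmod z < 1" for z
      using that bd[of "cmod z"] by (simp add: abs_mult power_le_one mult_le_one)
  qed
  have "(\<lambda>N. LINT z|disk_area. (cmod (P N z))\<^sup>2 * psi (cmod z)) \<longlonglongrightarrow>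
        (LINT z|disk_area. (cmod (g z))\<^sup>2 * psi (cmod z))"
  proof (rule integral_dominated_convergence[where w = "\<lambda>_. B\<^sup>2"])
    show "AE z in disk_area. norm ((cmod (P i z))\<^sup>2 * psi (cmod z)) \<le> B\<^sup>2" for i
      using ub PB by (intro AE_I2) blast
    show "AE z in disk_area. (\<lambda>i. (cmod (P i z))\<^sup>2 * psi (cmod z)) \<longlonglongrightarrow> (cmod (g z))\<^sup>2 * psi (cmod z)"
      using lim by (intro AE_I2 tendsto_intros) auto
    show "(\<lambda>z. (cmod (g z))\<^sup>2 * psi (cmod z)) \<in> borel_measurable disk_area" using gM psiM by measurable
    show "(\<lambda>z. (cmod (P i z))\<^sup>2 * psi (cmod z)) \<in> borel_measurable disk_area" for i
      using PM[of i] psiM by measurable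
  qed auto
  then have s: "(\<lambda>n. (cmod (b n))\<^sup>2 * (LINT z|disk_area. (cmod z) ^ (2 * n) * psi (cmod z))) sums
        (LINT z|disk_area. (cmod (g z))\<^sup>2 * psi (cmod z))"
    unfolding sums_def P_def integral_polynomial_sq[OF psi bd] .
  have nn: "0 \<le> (cmod (b n))\<^sup>2 * (LINT z|disk_area. (cmod z) ^ (2 * n) * psi (cmod z))" for n
    by (intro mult_nonneg_nonneg Bochner_Integration.integral_nonneg) (auto simp: bd)
  have "(\<integral>\<^sup>+z. ennreal ((cmod (g z))\<^sup>2 * psi (cmod z)) \<partial>disk_area) =
      ennreal (LINT z|disk_area. (cmod (g z))\<^sup>2 * psi (cmod z))"
    by (rule nn_integral_eq_integral[OF gi]) (auto simp: bd)
  also have "\<dots> = (\<Sum>n. ennreal ((cmod (b n))\<^sup>2 * (LINT z|disk_area. (cmod z) ^ (2 * n) * psi (cmod z))))"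
    using s suminf_ennreal2[OF nn] by (simp add: sums_iff)
  also have "\<dots> = (\<Sum>n. ennreal ((cmod (b n))\<^sup>2) * (\<integral>\<^sup>+z. ennreal ((cmod z) ^ (2 * n) * psi (cmod z)) \<partial>disk_area))"
    by (intro suminf_cong, subst nn_integral_eq_integral[OF mi]) (auto simp: bd ennreal_mult')
  finally show ?thesis .
qed

text \<open>Monotone convergence as the cut-off radius increases to 1. The identity lives in
  \<open>ennreal\<close>, so finiteness of the Dirichlet integral can be read off from the
  coefficients.\<close>

lemma parseval_disk:
  fixes b :: "nat \<Rightarrow> complex"
  assumes b: "\<And>z. cmod z < 1 \<Longrightarrow> (\<lambda>n. b n * z ^ n) sums g z" and a: "0 < a"
  shows "(\<integral>\<^sup>+z. ennreal ((cmod (g z))\<^sup>2 * (1 - (cmod z)\<^sup>2) powr a) \<partial>disk_area)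
       = (\<Sum>n. ennreal ((cmod (b n))\<^sup>2 * Beta (real (Suc n)) (a + 1)))"
proof -
  define r where "r k = 1 - 1 / (real k + 2)" for k :: nat
  have r: "0 < r k" "r k < 1" for k by (auto simp: r_def field_simps)
  have rm: "r k \<le> r l" if "k \<le> l" for k l using that by (simp add: r_def frac_le)
  define psi where "psi k s = (if \<bar>s\<bar> < r k then (1 - s\<^sup>2) powr a else 0)" for k s
  have psim: "psi k s \<le> psi l s" if "k \<le> l" for k l s
    using rm[OF that] by (auto simp: psi_def)
  have psi0: "0 \<le> psi k s" for k s by (simp add: psi_def)
  have [measurable]: "psi k \<in> borel_measurable borel" for k unfolding psi_def by measurable
  have sup: "(SUP k. ennreal (c * psi k s)) = ennreal (c * (1 - s\<^sup>2) powr a)" if s: "0 \<le> s" "s < 1" "0 \<le> c" for c s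
  proof (rule antisym)
    show "(SUP k. ennreal (c * psi k s)) \<le> ennreal (c * (1 - s\<^sup>2) powr a)"
      using that by (intro SUP_least ennreal_leI) (auto simp: psi_def mult_left_mono)
    obtain k where "inverse (of_nat (Suc k)) < 1 - s" using reals_Archimedean[of "1 - s"] s(2) by (auto simp del: of_nat_Suc)
    then have "1 / (real k + 2) < 1 - s"
      by (rule order.strict_trans1[rotated]) (simp add: field_simps)
    then have "s < r k" by (simp add: r_def)
    then have "ennreal (c * (1 - s\<^sup>2) powr a) = ennreal (c * psi k s)" using that by (simp add: psi_def)
    also have "\<dots> \<le> (SUP k. ennreal (c * psi k s))" by (rule SUP_upper) simp
    finally show "ennreal (c * (1 - s\<^sup>2) powr a) \<le> (SUP k. ennreal (c * psi k s))" .
  qed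
  have gM: "g \<in> borel_measurable disk_area"
  proof (rule borel_measurable_LIMSEQ_metric)
    show "(\<lambda>z. \<Sum>n<N. b n * z ^ n) \<in> borel_measurable disk_area" for N
      by (intro continuous_on_measurable_disk_area continuous_intros)
    show "(\<lambda>N. \<Sum>n<N. b n * z ^ n) \<longlonglongrightarrow> g z" if "z \<in> space disk_area" for z
      using b[of z] that by (simp add: sums_def)
  qed
  have psiM: "(\<lambda>z. psi k (cmod z)) \<in> borel_measurable disk_area" for k
    by (rule measurable_disk_area) simp
  have mono: "(\<integral>\<^sup>+z. ennreal (h z * (1 - (cmod z)\<^sup>2) powr a) \<partial>disk_area)
      = (SUP k. \<integral>\<^sup>+z. ennreal (h z * psi k (cmod z)) \<partial>disk_area)"
    if h: "h \<in> borel_measurable disk_area" "\<And>z. 0 \<le> h z" for h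
  proof -
    have "(\<integral>\<^sup>+z. ennreal (h z * (1 - (cmod z)\<^sup>2) powr a) \<partial>disk_area)
        = (\<integral>\<^sup>+z. (SUP k. ennreal (h z * psi k (cmod z))) \<partial>disk_area)"
      by (intro nn_integral_cong) (simp add: sup h)
    also have "\<dots> = (SUP k. \<integral>\<^sup>+z. ennreal (h z * psi k (cmod z)) \<partial>disk_area)"
    proof (rule nn_integral_monotone_convergence_SUP)
      show "incseq (\<lambda>k z. ennreal (h z * psi k (cmod z)))"
        by (intro incseq_SucI le_funI ennreal_leI mult_left_mono psim h) simp
      show "(\<lambda>z. ennreal (h z * psi k (cmod z))) \<in> borel_measurable disk_area" for k
        using h(1) psiM[of k] by measurable
    qed
    finally show ?thesis .
  qed
  have "(\<integral>\<^sup>+z. ennreal ((cmod (g z))\<^sup>2 * (1 - (cmod z)\<^sup>2) powr a) \<partial>disk_area)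
     = (SUP k. \<integral>\<^sup>+z. ennreal ((cmod (g z))\<^sup>2 * psi k (cmod z)) \<partial>disk_area)"
    by (rule mono) (use gM in measurable)
  also have "\<dots> = (SUP k. \<Sum>n. ennreal ((cmod (b n))\<^sup>2) * (\<integral>\<^sup>+z. ennreal ((cmod z) ^ (2 * n) * psi k (cmod z)) \<partial>disk_area))"
    unfolding psi_def using parseval_truncated[OF b r a] by simp
  also have "\<dots> = (\<Sum>n. SUP k. ennreal ((cmod (b n))\<^sup>2) * (\<integral>\<^sup>+z. ennreal ((cmod z) ^ (2 * n) * psi k (cmod z)) \<partial>disk_area))"
  proof (rule ennreal_suminf_SUP_eq[symmetric])
    show "incseq (\<lambda>k. ennreal ((cmod (b n))\<^sup>2) * (\<integral>\<^sup>+z. ennreal ((cmod z) ^ (2 * n) * psi k (cmod z)) \<partial>disk_area))" for n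
      by (intro incseq_SucI mult_left_mono nn_integral_mono ennreal_leI psim) auto
  qed
  also have "\<dots> = (\<Sum>n. ennreal ((cmod (b n))\<^sup>2) * (\<integral>\<^sup>+z. ennreal ((cmod z) ^ (2 * n) * (1 - (cmod z)\<^sup>2) powr a) \<partial>disk_area))"
  proof (rule suminf_cong)
    fix n
    have "(\<lambda>z. cmod z ^ (2 * n)) \<in> borel_measurable disk_area" by (rule measurable_disk_area) simp
    from mono[OF this]
    show "(SUP k. ennreal ((cmod (b n))\<^sup>2) * (\<integral>\<^sup>+z. ennreal ((cmod z) ^ (2 * n) * psi k (cmod z)) \<partial>disk_area))
      = ennreal ((cmod (b n))\<^sup>2) * (\<integral>\<^sup>+z. ennreal ((cmod z) ^ (2 * n) * (1 - (cmod z)\<^sup>2) powr a) \<partial>disk_area)"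
      by (simp add: SUP_mult_left_ennreal)
  qed
  also have "\<dots> = (\<Sum>n. ennreal ((cmod (b n))\<^sup>2 * Beta (real (Suc n)) (a + 1)))"
    unfolding nn_integral_moment[OF a] by (simp only: ennreal_mult'[OF zero_le_power2])
  finally show ?thesis .
qed

section \<open>Moment problems in the sequence space\<close>

definition ip :: "(nat \<Rightarrow> complex) \<Rightarrow> (nat \<Rightarrow> complex) \<Rightarrow> complex" where
  "ip u v = (\<Sum>n. u n * cnj (v n))"

definition sqn :: "(nat \<Rightarrow> complex) \<Rightarrow> real" where
  "sqn u = (\<Sum>n. (cmod (u n))\<^sup>2)"

lemma sqn_nonneg: "u \<in> ell2 \<Longrightarrow> 0 \<le> sqn u"
  unfolding sqn_def ell2_def by (auto intro: suminf_nonneg)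

lemma sum_le_sqn: "u \<in> ell2 \<Longrightarrow> finite F \<Longrightarrow> (\<Sum>n\<in>F. (cmod (u n))\<^sup>2) \<le> sqn u"
  unfolding sqn_def ell2_def by (auto intro: sum_le_suminf)

lemma ell2_bounded_sums:
  assumes "\<And>N. (\<Sum>n<N. (cmod (u n))\<^sup>2) \<le> B"
  shows "u \<in> ell2" "sqn u \<le> B"
proof -
  have s: "summable (\<lambda>n. (cmod (u n))\<^sup>2)"
    by (rule summableI_nonneg_bounded[OF _ assms]) simp
  then show "u \<in> ell2" by (simp add: ell2_def)
  show "sqn u \<le> B" unfolding sqn_def by (rule suminf_le_const[OF s assms])
qed

lemma ell2_mult_summable:
  assumes "u \<in> ell2" "v \<in> ell2"
  shows "summable (\<lambda>n. norm (u n * cnj (v n)))"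
proof (rule summable_comparison_test')
  show "summable (\<lambda>n. (cmod (u n))\<^sup>2 + (cmod (v n))\<^sup>2)"
    using assms by (auto simp: ell2_def intro: summable_add)
  fix n
  have "2 * (cmod (u n) * cmod (v n)) \<le> (cmod (u n))\<^sup>2 + (cmod (v n))\<^sup>2"
    using sum_squares_bound[of "cmod (u n)" "cmod (v n)"] by (simp add: mult_ac)
  moreover have "0 \<le> cmod (u n) * cmod (v n)" by simp
  ultimately show "norm (norm (u n * cnj (v n))) \<le> (cmod (u n))\<^sup>2 + (cmod (v n))\<^sup>2"
    unfolding norm_mult complex_mod_cnj real_norm_def abs_norm_cancel abs_mult by linarith
qed

lemma ip_sums: "u \<in> ell2 \<Longrightarrow> v \<in> ell2 \<Longrightarrow> (\<lambda>n. u n * cnj (v n)) sums ip u v"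
  unfolding ip_def by (rule summable_sums[OF summable_norm_cancel[OF ell2_mult_summable]])

lemma ip_self: "u \<in> ell2 \<Longrightarrow> ip u u = of_real (sqn u)"
  unfolding ip_def sqn_def ell2_def
  by (simp only: complex_norm_square[symmetric] suminf_of_real mem_Collect_eq)

lemma ip_cnj: "u \<in> ell2 \<Longrightarrow> v \<in> ell2 \<Longrightarrow> ip v u = cnj (ip u v)"
proof -
  assume "u \<in> ell2" "v \<in> ell2"
  then have "(\<lambda>n. cnj (u n * cnj (v n))) sums cnj (ip u v)"
    unfolding sums_cnj by (rule ip_sums)
  then show ?thesis unfolding ip_def[of v u] by (simp add: sums_iff mult.commute)
qed

lemma Cauchy_Schwarz_sum:
  fixes f g :: "'a \<Rightarrow> complex"
  shows "(cmod (\<Sum>n\<in>F. f n * g n))\<^sup>2 \<le> (\<Sum>n\<in>F. (cmod (f n))\<^sup>2) * (\<Sum>n\<in>F. (cmod (g n))\<^sup>2)"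
proof -
  have "cmod (\<Sum>n\<in>F. f n * g n) \<le> (\<Sum>n\<in>F. cmod (f n) * cmod (g n))"
    by (rule order.trans[OF norm_sum]) (simp add: norm_mult)
  then have "(cmod (\<Sum>n\<in>F. f n * g n))\<^sup>2 \<le> (\<Sum>n\<in>F. cmod (f n) * cmod (g n))\<^sup>2"
    by (intro power_mono) auto
  also have "\<dots> \<le> (\<Sum>n\<in>F. (cmod (f n))\<^sup>2) * (\<Sum>n\<in>F. (cmod (g n))\<^sup>2)"
    by (rule Cauchy_Schwarz_ineq_sum)
  finally show ?thesis .
qed

lemma ip_Cauchy_Schwarz:
  assumes "u \<in> ell2" "v \<in> ell2"
  shows "(cmod (ip u v))\<^sup>2 \<le> sqn u * sqn v"
proof -
  have "(\<lambda>N. (cmod (\<Sum>n<N. u n * cnj (v n)))\<^sup>2) \<longlonglongrightarrow> (cmod (ip u v))\<^sup>2"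
    using ip_sums[OF assms] unfolding sums_def by (intro tendsto_intros)
  moreover have "(cmod (\<Sum>n<N. u n * cnj (v n)))\<^sup>2 \<le> sqn u * sqn v" for N
  proof -
    have "(cmod (\<Sum>n<N. u n * cnj (v n)))\<^sup>2 \<le> (\<Sum>n<N. (cmod (u n))\<^sup>2) * (\<Sum>n<N. (cmod (v n))\<^sup>2)"
      using Cauchy_Schwarz_sum[of u "\<lambda>n. cnj (v n)" "{..<N}"] by simp
    also have "\<dots> \<le> sqn u * sqn v"
      using sum_le_sqn[OF assms(1), of "{..<N}"] sum_le_sqn[OF assms(2), of "{..<N}"] sqn_nonneg[OF assms(1)]
      by (intro mult_mono) (auto intro: sum_nonneg)
    finally show ?thesis .
  qed
  ultimately show ?thesis by (intro LIMSEQ_le_const2) auto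
qed

section \<open>Linear structure and convergent series in the sequence space\<close>

lemma ell2_zero: "(\<lambda>_. 0) \<in> ell2"
  by (simp add: ell2_def)

lemma ell2_add:
  assumes "u \<in> ell2" "v \<in> ell2" shows "(\<lambda>n. u n + v n) \<in> ell2"
proof -
  have "summable (\<lambda>n. (cmod (u n + v n))\<^sup>2)"
  proof (rule summable_comparison_test')
    show "summable (\<lambda>n. 2 * (cmod (u n))\<^sup>2 + 2 * (cmod (v n))\<^sup>2)"
      using assms by (auto simp: ell2_def intro!: summable_add summable_mult)
    fix n
    have "(cmod (u n + v n))\<^sup>2 \<le> (cmod (u n) + cmod (v n))\<^sup>2"
      by (intro power_mono norm_triangle_ineq) auto
    also have "\<dots> \<le> 2 * (cmod (u n))\<^sup>2 + 2 * (cmod (v n))\<^sup>2"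
      using sum_squares_bound[of "cmod (u n)" "cmod (v n)"] by (simp add: power2_sum)
    finally show "norm ((cmod (u n + v n))\<^sup>2) \<le> 2 * (cmod (u n))\<^sup>2 + 2 * (cmod (v n))\<^sup>2" by simp
  qed
  then show ?thesis by (simp add: ell2_def)
qed

lemma ell2_scale: "u \<in> ell2 \<Longrightarrow> (\<lambda>n. c * u n) \<in> ell2"
  by (simp add: ell2_def norm_mult power_mult_distrib summable_mult)

lemma ell2_sum: "(\<And>i. i \<in> F \<Longrightarrow> u i \<in> ell2) \<Longrightarrow> (\<lambda>n. \<Sum>i\<in>F. u i n) \<in> ell2"
proof (induction F rule: infinite_finite_induct)
  case (insert i F) then show ?case by (simp add: ell2_add)
qed (auto simp: ell2_zero)

lemma ell2_diff: "u \<in> ell2 \<Longrightarrow> v \<in> ell2 \<Longrightarrow> (\<lambda>n. u n - v n) \<in> ell2"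
  using ell2_add[of u "\<lambda>n. (-1) * v n"] ell2_scale[of v "-1"] by simp

lemma ip_sum_left:
  assumes "\<And>i. i \<in> F \<Longrightarrow> x i \<in> ell2" "v \<in> ell2"
  shows "ip (\<lambda>n. \<Sum>i\<in>F. a i * x i n) v = (\<Sum>i\<in>F. a i * ip (x i) v)"
proof -
  have "(\<lambda>n. \<Sum>i\<in>F. a i * (x i n * cnj (v n))) sums (\<Sum>i\<in>F. a i * ip (x i) v)"
    using assms by (intro sums_sum sums_mult ip_sums) auto
  moreover have "(\<Sum>i\<in>F. a i * (x i n * cnj (v n))) = (\<Sum>i\<in>F. a i * x i n) * cnj (v n)" for n
    by (simp add: sum_distrib_right mult.assoc)
  ultimately show ?thesis
    unfolding ip_def[of "\<lambda>n. \<Sum>i\<in>F. a i * x i n"] by (simp add: sums_iff)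
qed

lemma ip_sum_right:
  assumes "\<And>i. i \<in> F \<Longrightarrow> x i \<in> ell2" "v \<in> ell2"
  shows "ip v (\<lambda>n. \<Sum>i\<in>F. a i * x i n) = (\<Sum>i\<in>F. cnj (a i) * ip v (x i))"
proof -
  have "(\<lambda>n. \<Sum>i\<in>F. cnj (a i) * (v n * cnj (x i n))) sums (\<Sum>i\<in>F. cnj (a i) * ip v (x i))"
    using assms by (intro sums_sum sums_mult ip_sums) auto
  moreover have "(\<Sum>i\<in>F. cnj (a i) * (v n * cnj (x i n))) = v n * cnj (\<Sum>i\<in>F. a i * x i n)" for n
    by (simp add: sum_distrib_left mult_ac)
  ultimately show ?thesis
    unfolding ip_def[of v "\<lambda>n. \<Sum>i\<in>F. a i * x i n"] by (simp add: sums_iff)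
qed

lemma ip_diff_left:
  assumes "u \<in> ell2" "v \<in> ell2" "w \<in> ell2"
  shows "ip (\<lambda>n. u n - v n) w = ip u w - ip v w"
  using sums_diff[OF ip_sums[OF assms(1,3)] ip_sums[OF assms(2,3)]]
  unfolding ip_def[of "\<lambda>n. u n - v n"] by (simp add: sums_iff algebra_simps)

lemma ip_add_left:
  assumes "u \<in> ell2" "v \<in> ell2" "w \<in> ell2"
  shows "ip (\<lambda>n. u n + v n) w = ip u w + ip v w"
  using sums_add[OF ip_sums[OF assms(1,3)] ip_sums[OF assms(2,3)]]
  unfolding ip_def[of "\<lambda>n. u n + v n"] by (simp add: sums_iff algebra_simps)

text \<open>The form of completeness that the iteration uses: Minkowski's inequality bounds finite
  sections in both indices, and the limits are taken afterwards.\<close>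

lemma ell2_geometric_series:
  assumes u: "\<And>k. u k \<in> ell2" "\<And>k. sqn (u k) \<le> (C / 2 ^ k)\<^sup>2" and C: "0 \<le> C"
  shows "\<And>n. summable (\<lambda>k. u k n)" "(\<lambda>n. \<Sum>k. u k n) \<in> ell2" "sqn (\<lambda>n. \<Sum>k. u k n) \<le> (2 * C)\<^sup>2"
proof -
  have un: "cmod (u k n) \<le> C / 2 ^ k" for k n
  proof -
    have "(cmod (u k n))\<^sup>2 \<le> (C / 2 ^ k)\<^sup>2"
      using sum_le_sqn[OF u(1), of "{n}" k] u(2)[of k] by simp
    then show ?thesis by (rule power2_le_imp_le) (use C in auto)
  qed
  have geo: "summable (\<lambda>k. C / 2 ^ k)"
    using summable_mult[OF summable_geometric[of "1/2::real"], of C] by (simp add: power_divide)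
  show s: "summable (\<lambda>k. u k n)" for n
    by (rule summable_comparison_test'[OF geo, of 0]) (use un in auto)
  have gK: "(\<Sum>k<K. C / 2 ^ k) \<le> 2 * C" for K
  proof -
    have "(\<Sum>k<K. C / 2 ^ k) = 2 * C * (1 - 1 / 2 ^ K)"
    proof (induction K)
      case (Suc K)
      have "2 * C * (1 - 1 / 2 ^ K) + C / 2 ^ K = 2 * C * (1 - 1 / 2 ^ Suc K)" by (simp add: field_simps)
      then show ?case using Suc by simp
    qed simp
    also have "\<dots> \<le> 2 * C" using C by (simp add: mult_left_le)
    finally show ?thesis .
  qed
  have part: "(\<Sum>n<N. (cmod (\<Sum>k<K. u k n))\<^sup>2) \<le> (2 * C)\<^sup>2" for N K
  proof -
    have tri: "L2_set (\<lambda>n. \<Sum>k<K. cmod (u k n)) {..<N} \<le> (\<Sum>k<K. L2_set (\<lambda>n. cmod (u k n)) {..<N})" for K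
    proof (induction K)
      case (Suc K)
      show ?case
        using Suc L2_set_triangle_ineq[of "\<lambda>n. \<Sum>k<K. cmod (u k n)" "\<lambda>n. cmod (u K n)" "{..<N}"]
        by simp
    qed (simp add: L2_set_def)
    have "L2_set (\<lambda>n. cmod (u k n)) {..<N} \<le> C / 2 ^ k" for k
      unfolding L2_set_def using sum_le_sqn[OF u(1), of "{..<N}" k] u(2)[of k] C
      by (intro real_le_lsqrt) (auto intro: sum_nonneg)
    then have "(\<Sum>k<K. L2_set (\<lambda>n. cmod (u k n)) {..<N}) \<le> (\<Sum>k<K. C / 2 ^ k)" by (intro sum_mono)
    with tri[of K] gK[of K] have "L2_set (\<lambda>n. \<Sum>k<K. cmod (u k n)) {..<N} \<le> 2 * C" by linarith
    then have "(L2_set (\<lambda>n. \<Sum>k<K. cmod (u k n)) {..<N})\<^sup>2 \<le> (2 * C)\<^sup>2"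
      by (intro power_mono) (auto simp: L2_set_nonneg)
    then have "(\<Sum>n<N. (\<Sum>k<K. cmod (u k n))\<^sup>2) \<le> (2 * C)\<^sup>2"
      unfolding L2_set_def by (simp add: sum_nonneg)
    moreover have "(\<Sum>n<N. (cmod (\<Sum>k<K. u k n))\<^sup>2) \<le> (\<Sum>n<N. (\<Sum>k<K. cmod (u k n))\<^sup>2)"
      by (intro sum_mono power_mono norm_sum) auto
    ultimately show ?thesis by linarith
  qed
  have "(\<Sum>n<N. (cmod (\<Sum>k. u k n))\<^sup>2) \<le> (2 * C)\<^sup>2" for N
  proof (rule LIMSEQ_le_const2)
    show "(\<lambda>K. \<Sum>n<N. (cmod (\<Sum>k<K. u k n))\<^sup>2) \<longlonglongrightarrow> (\<Sum>n<N. (cmod (\<Sum>k. u k n))\<^sup>2)"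
      by (intro tendsto_intros summable_LIMSEQ s)
  qed (use part in auto)
  from ell2_bounded_sums[OF this]
  show "(\<lambda>n. \<Sum>k. u k n) \<in> ell2" "sqn (\<lambda>n. \<Sum>k. u k n) \<le> (2 * C)\<^sup>2" .
qed

text \<open>The remainder after \<open>K\<close> terms is a series of the same kind with
  \<open>C / 2 ^ K\<close> in place of \<open>C\<close>, so Cauchy-Schwarz yields convergence of the
  inner products.\<close>

lemma ip_geometric_series:
  assumes u: "\<And>k. u k \<in> ell2" "\<And>k. sqn (u k) \<le> (C / 2 ^ k)\<^sup>2" and C: "0 \<le> C" and x: "x \<in> ell2"
  shows "(\<lambda>k. ip (u k) x) sums ip (\<lambda>n. \<Sum>k. u k n) x"
proof -
  define w where "w n = (\<Sum>k. u k n)" for n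
  note ser = ell2_geometric_series[OF u C]
  have w: "w \<in> ell2" unfolding w_def[abs_def] by (rule ser)
  have bound: "cmod ((\<Sum>k<K. ip (u k) x) - ip w x) \<le> 2 * (C / 2 ^ K) * sqrt (sqn x)" for K
  proof -
    have u': "u (k + K) \<in> ell2" "sqn (u (k + K)) \<le> ((C / 2 ^ K) / 2 ^ k)\<^sup>2" for k
      using u(1,2)[of "k + K"] by (simp_all add: power_add mult.commute)
    have C': "0 \<le> C / 2 ^ K" using C by simp
    note tail = ell2_geometric_series[OF u' C']
    have split: "w n - (\<Sum>k<K. 1 * u k n) = (\<Sum>k. u (k + K) n)" for n
      using suminf_split_initial_segment[OF ser(1)[of n], of K] by (simp add: w_def)
    have "ip w x - (\<Sum>k<K. ip (u k) x) = ip (\<lambda>n. w n - (\<Sum>k<K. 1 * u k n)) x"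
      using ip_sum_left[of "{..<K}" u x "\<lambda>_. 1"] u x
      by (subst ip_diff_left[OF w _ x]) (auto intro!: ell2_sum)
    then have "(cmod (ip w x - (\<Sum>k<K. ip (u k) x)))\<^sup>2 \<le> sqn (\<lambda>n. \<Sum>k. u (k + K) n) * sqn x"
      using ip_Cauchy_Schwarz[OF tail(2) x] by (simp only: split)
    also have "\<dots> \<le> (2 * (C / 2 ^ K))\<^sup>2 * sqn x"
      using tail(3) sqn_nonneg[OF x] by (intro mult_right_mono) auto
    also have "\<dots> = (2 * (C / 2 ^ K) * sqrt (sqn x))\<^sup>2"
      using sqn_nonneg[OF x] by (simp add: power_mult_distrib power_divide)
    finally have "cmod (ip w x - (\<Sum>k<K. ip (u k) x)) \<le> 2 * (C / 2 ^ K) * sqrt (sqn x)"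
      by (rule power2_le_imp_le) (use C sqn_nonneg[OF x] in auto)
    then show ?thesis by (simp add: norm_minus_commute)
  qed
  have "(\<lambda>K. 2 * (C / 2 ^ K) * sqrt (sqn x)) \<longlonglongrightarrow> 2 * (C * 0) * sqrt (sqn x)"
    unfolding divide_inverse power_inverse[symmetric]
    by (intro tendsto_intros LIMSEQ_power_zero) auto
  then have lim0: "(\<lambda>K. 2 * (C / 2 ^ K) * sqrt (sqn x)) \<longlonglongrightarrow> 0" by simp
  have "(\<lambda>K. (\<Sum>k<K. ip (u k) x) - ip w x) \<longlonglongrightarrow> 0"
    by (rule Lim_null_comparison[OF _ lim0]) (use bound in auto)
  then show ?thesis unfolding sums_def w_def by (subst LIM_zero_iff[symmetric])
qed

text \<open>For unit vectors this says that the Gram matrix over \<open>A\<close>, minus the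
  identity, has squared Hilbert-Schmidt norm at most \<open>K\<close>. Finite sections avoid any
  separate summability condition.\<close>

definition offdiag_le :: "(nat \<Rightarrow> nat \<Rightarrow> complex) \<Rightarrow> nat set \<Rightarrow> real \<Rightarrow> bool" where
  "offdiag_le x A K \<longleftrightarrow> (\<forall>F. finite F \<longrightarrow> F \<subseteq> A \<longrightarrow>
     (\<Sum>i\<in>F. \<Sum>j\<in>F - {i}. (cmod (ip (x j) (x i)))\<^sup>2) \<le> K)"

text \<open>The Hilbert-Schmidt norm dominates the operator norm, by Cauchy-Schwarz in each row. The
  rows \<open>I\<close> and the columns \<open>F\<close> may differ because errors also occur at
  indices outside the combination.\<close>

lemma offdiag_sum_le:
  assumes "offdiag_le x A K" "finite F" "F \<subseteq> A" "finite I" "I \<subseteq> A"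
  shows "(\<Sum>i\<in>I. (cmod (\<Sum>j\<in>F - {i}. a j * ip (x j) (x i)))\<^sup>2) \<le> (\<Sum>j\<in>F. (cmod (a j))\<^sup>2) * K"
proof -
  define S where "S = (\<Sum>j\<in>F. (cmod (a j))\<^sup>2)"
  have S: "0 \<le> S" by (simp add: S_def sum_nonneg)
  have "(\<Sum>i\<in>I. (cmod (\<Sum>j\<in>F - {i}. a j * ip (x j) (x i)))\<^sup>2)
     \<le> (\<Sum>i\<in>I. S * (\<Sum>j\<in>F - {i}. (cmod (ip (x j) (x i)))\<^sup>2))"
  proof (rule sum_mono)
    fix i
    have "(cmod (\<Sum>j\<in>F - {i}. a j * ip (x j) (x i)))\<^sup>2
       \<le> (\<Sum>j\<in>F - {i}. (cmod (a j))\<^sup>2) * (\<Sum>j\<in>F - {i}. (cmod (ip (x j) (x i)))\<^sup>2)"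
      by (rule Cauchy_Schwarz_sum)
    also have "\<dots> \<le> S * (\<Sum>j\<in>F - {i}. (cmod (ip (x j) (x i)))\<^sup>2)"
      unfolding S_def using assms by (intro mult_right_mono sum_mono2 sum_nonneg) auto
    finally show "(cmod (\<Sum>j\<in>F - {i}. a j * ip (x j) (x i)))\<^sup>2 \<le> S * (\<Sum>j\<in>F - {i}. (cmod (ip (x j) (x i)))\<^sup>2)" .
  qed
  also have "\<dots> = S * (\<Sum>i\<in>I. \<Sum>j\<in>F - {i}. (cmod (ip (x j) (x i)))\<^sup>2)"
    by (simp add: sum_distrib_left)
  also have "\<dots> \<le> S * (\<Sum>i\<in>I \<union> F. \<Sum>j\<in>(I \<union> F) - {i}. (cmod (ip (x j) (x i)))\<^sup>2)"
  proof (intro mult_left_mono S)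
    have "(\<Sum>i\<in>I. \<Sum>j\<in>F - {i}. (cmod (ip (x j) (x i)))\<^sup>2) \<le> (\<Sum>i\<in>I. \<Sum>j\<in>(I \<union> F) - {i}. (cmod (ip (x j) (x i)))\<^sup>2)"
      using assms by (intro sum_mono sum_mono2) auto
    also have "\<dots> \<le> (\<Sum>i\<in>I \<union> F. \<Sum>j\<in>(I \<union> F) - {i}. (cmod (ip (x j) (x i)))\<^sup>2)"
      using assms by (intro sum_mono2) (auto intro: sum_nonneg)
    finally show "(\<Sum>i\<in>I. \<Sum>j\<in>F - {i}. (cmod (ip (x j) (x i)))\<^sup>2)
      \<le> (\<Sum>i\<in>I \<union> F. \<Sum>j\<in>(I \<union> F) - {i}. (cmod (ip (x j) (x i)))\<^sup>2)" .
  qed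
  also have "\<dots> \<le> S * K"
    using assms S unfolding offdiag_le_def by (intro mult_left_mono) auto
  finally show ?thesis unfolding S_def .
qed

text \<open>Pairing the combination with its own terms gives the diagonal plus the errors
  \<open>e i\<close>. Splitting the products \<open>cmod (a i) * cmod (e i)\<close> by the
  inequality of means produces \<open>1 + 1 / 2\<close> and \<open>K / 2\<close>.\<close>

lemma sqn_combination_le:
  assumes x: "\<And>i. i \<in> A \<Longrightarrow> x i \<in> ell2" "\<And>i. i \<in> A \<Longrightarrow> ip (x i) (x i) = 1"
    and K: "offdiag_le x A K" and F: "finite F" "F \<subseteq> A"
  shows "sqn (\<lambda>n. \<Sum>i\<in>F. a i * x i n) \<le> (3 / 2 + K / 2) * (\<Sum>i\<in>F. (cmod (a i))\<^sup>2)"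
proof -
  define u where "u = (\<lambda>n. \<Sum>i\<in>F. a i * x i n)"
  define e where "e i = (\<Sum>j\<in>F - {i}. a j * ip (x j) (x i))" for i
  have u: "u \<in> ell2" unfolding u_def using x F by (intro ell2_sum ell2_scale) auto
  have ux: "ip u (x i) = a i + e i" if "i \<in> F" for i
    unfolding u_def e_def using that F x
    by (subst ip_sum_left) (auto simp: sum.remove)
  have "of_real (sqn u) = ip u u" by (simp add: ip_self u)
  also have "\<dots> = (\<Sum>i\<in>F. cnj (a i) * ip u (x i))"
    using x F u by (subst (2) u_def, subst ip_sum_right) auto
  also have "\<dots> = (\<Sum>i\<in>F. cnj (a i) * (a i + e i))" by (simp add: ux)
  finally have "cmod (of_real (sqn u)) = cmod (\<Sum>i\<in>F. cnj (a i) * (a i + e i))" by simp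
  then have "sqn u = cmod (\<Sum>i\<in>F. cnj (a i) * (a i + e i))"
    using sqn_nonneg[OF u] by simp
  also have "\<dots> \<le> (\<Sum>i\<in>F. 3 / 2 * (cmod (a i))\<^sup>2 + (cmod (e i))\<^sup>2 / 2)"
  proof (rule sum_norm_le)
    fix i
    have "cmod (cnj (a i) * (a i + e i)) \<le> cmod (a i) * (cmod (a i) + cmod (e i))"
      by (simp add: norm_mult mult_left_mono norm_triangle_ineq)
    also have "\<dots> \<le> 3 / 2 * (cmod (a i))\<^sup>2 + (cmod (e i))\<^sup>2 / 2"
      using sum_squares_bound[of "cmod (a i)" "cmod (e i)"] by (simp add: power2_eq_square algebra_simps)
    finally show "cmod (cnj (a i) * (a i + e i)) \<le> 3 / 2 * (cmod (a i))\<^sup>2 + (cmod (e i))\<^sup>2 / 2" .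
  qed
  also have "\<dots> = 3 / 2 * (\<Sum>i\<in>F. (cmod (a i))\<^sup>2) + (\<Sum>i\<in>F. (cmod (e i))\<^sup>2) / 2"
    by (simp add: sum.distrib sum_distrib_left sum_divide_distrib)
  also have "(\<Sum>i\<in>F. (cmod (e i))\<^sup>2) \<le> (\<Sum>i\<in>F. (cmod (a i))\<^sup>2) * K"
    unfolding e_def by (rule offdiag_sum_le[OF K F F])
  finally show ?thesis unfolding u_def by (simp add: algebra_simps)
qed

text \<open>Duality with the previous bound: \<open>v\<close> is tested against the combination of
  the \<open>x i\<close> with coefficients \<open>ip v (x i)\<close>. Cauchy-Schwarz bounds the
  square of the partial sum \<open>s\<close> by a constant times \<open>s\<close>, and one factor
  \<open>s\<close> cancels.\<close>

lemma bessel_ell2: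
  assumes x: "\<And>i. x i \<in> ell2" "\<And>i. ip (x i) (x i) = 1"
    and K: "offdiag_le x UNIV K" and v: "v \<in> ell2"
  shows "(\<lambda>i. ip v (x i)) \<in> ell2"
proof (rule ell2_bounded_sums)
  fix N :: nat
  define s where "s = (\<Sum>i<N. (cmod (ip v (x i)))\<^sup>2)"
  define w where "w = (\<lambda>n. \<Sum>i<N. ip v (x i) * x i n)"
  have w: "w \<in> ell2" unfolding w_def using x by (intro ell2_sum ell2_scale) auto
  have s0: "0 \<le> s" by (simp add: s_def sum_nonneg)
  have "ip v w = (\<Sum>i<N. cnj (ip v (x i)) * ip v (x i))"
    unfolding w_def using x v by (intro ip_sum_right) auto
  also have "\<dots> = of_real s"
  proof -
    have "cnj z * z = of_real ((cmod z)\<^sup>2)" for z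
      using complex_norm_square[of z] by (simp only: mult.commute)
    then show ?thesis by (simp only: s_def of_real_sum)
  qed
  finally have "s\<^sup>2 \<le> sqn v * sqn w"
    using ip_Cauchy_Schwarz[OF v w] s0 by simp
  also have "\<dots> \<le> sqn v * ((3 / 2 + K / 2) * s)"
    unfolding w_def s_def using x sqn_nonneg[OF v]
    by (intro mult_left_mono sqn_combination_le[OF _ _ K]) auto
  finally have "s * s \<le> sqn v * (3 / 2 + K / 2) * s" by (simp add: power2_eq_square mult_ac)
  then show "(\<Sum>i<N. (cmod (ip v (x i)))\<^sup>2) \<le> \<bar>sqn v * (3 / 2 + K / 2)\<bar>"
    using s0 unfolding s_def[symmetric] by (cases "s = 0") (auto simp: mult_le_cancel_right)
qed

text \<open>If the Gram matrix is close to the identity, a finite combination of the vectors solves the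
  moment problem up to half the norm of the data; iterating, the errors sum up geometrically.\<close>

lemma moment_step:
  assumes x: "\<And>i. i \<in> A \<Longrightarrow> x i \<in> ell2" "\<And>i. i \<in> A \<Longrightarrow> ip (x i) (x i) = 1"
    and K: "offdiag_le x A (1 / 16)" and a: "a \<in> ell2" "\<And>i. i \<notin> A \<Longrightarrow> a i = 0"
  shows "\<exists>u b. u \<in> ell2 \<and> sqn u \<le> 4 * sqn a \<and> b \<in> ell2 \<and> sqn b \<le> sqn a / 4 \<and>
      (\<forall>i. i \<notin> A \<longrightarrow> b i = 0) \<and> (\<forall>i\<in>A. ip u (x i) = a i - b i)"
proof -
  have sa: "summable (\<lambda>n. (cmod (a n))\<^sup>2)" using a by (simp add: ell2_def)
  \<comment> \<open>The data from \<open>N\<close> on are small enough to be left for the next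
    round, so the combination is finite.\<close>
  obtain N where N: "(\<Sum>n. (cmod (a (n + N)))\<^sup>2) \<le> sqn a / 16"
  proof (cases "sqn a = 0")
    case True
    show ?thesis by (rule that[of 0]) (use True in \<open>simp add: sqn_def\<close>)
  next
    case False
    then have "sqn a / 16 > 0" using sqn_nonneg[OF a(1)] by simp
    from suminf_exist_split[OF this sa] show ?thesis
      using that by (metis le_refl less_imp_le norm_le_zero_iff real_norm_def abs_ge_self order.trans)
  qed
  define F where "F = {i\<in>A. i < N}"
  have F: "finite F" "F \<subseteq> A" by (auto simp: F_def)
  define u where "u = (\<lambda>n. \<Sum>i\<in>F. a i * x i n)"
  define e where "e i = (\<Sum>j\<in>F - {i}. a j * ip (x j) (x i))" for i
  define b where "b i = (if i \<in> A then (if i < N then 0 else a i) - e i else 0)" for i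
  have u: "u \<in> ell2" unfolding u_def using x F by (intro ell2_sum ell2_scale) auto
  have SF: "(\<Sum>i\<in>F. (cmod (a i))\<^sup>2) \<le> sqn a" by (rule sum_le_sqn[OF a(1) F(1)])
  have "sqn u \<le> (3 / 2 + (1 / 16) / 2) * (\<Sum>i\<in>F. (cmod (a i))\<^sup>2)"
    unfolding u_def by (rule sqn_combination_le[OF x K F])
  also have "\<dots> \<le> 4 * sqn a" using SF sqn_nonneg[OF a(1)] by (intro mult_mono) (auto intro: sum_nonneg)
  finally have su: "sqn u \<le> 4 * sqn a" .
  have ux: "ip u (x i) = a i - b i" if i: "i \<in> A" for i
  proof -
    have "ip u (x i) = (\<Sum>j\<in>F. a j * ip (x j) (x i))"
      unfolding u_def using x F i by (intro ip_sum_left) auto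
    also have "\<dots> = (if i < N then a i else 0) + e i"
    proof (cases "i < N")
      case True
      then show ?thesis unfolding e_def using i x F by (subst sum.remove[of F i]) (auto simp: F_def)
    next
      case False
      then have "F - {i} = F" by (auto simp: F_def)
      then show ?thesis using False by (simp add: e_def)
    qed
    finally show ?thesis using i by (simp add: b_def)
  qed
  \<comment> \<open>Untreated data and off-diagonal errors each have squared norm at most
    \<open>sqn a / 16\<close>; squaring their difference costs a factor 2, and
    \<open>2 / 16 + 2 / 16 = 1 / 4\<close>.\<close>
  have "(\<Sum>i<M. (cmod (b i))\<^sup>2) \<le> sqn a / 4" for M
  proof -
    define I where "I = {i\<in>A. i < M}"
    have I: "finite I" "I \<subseteq> A" by (auto simp: I_def)
    have "(\<Sum>i<M. (cmod (b i))\<^sup>2) = (\<Sum>i\<in>I. (cmod (b i))\<^sup>2)"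
      by (rule sum.mono_neutral_right) (auto simp: I_def b_def)
    also have "\<dots> \<le> (\<Sum>i\<in>I. 2 * (if i < N then 0 else (cmod (a i))\<^sup>2) + 2 * (cmod (e i))\<^sup>2)"
    proof (rule sum_mono)
      fix i assume "i \<in> I"
      then have "b i = (if i < N then 0 else a i) - e i" using I by (auto simp: b_def)
      then have "(cmod (b i))\<^sup>2 \<le> (cmod (if i < N then 0 else a i) + cmod (e i))\<^sup>2"
        by (simp only:) (intro power_mono norm_triangle_ineq4 norm_ge_zero)
      also have "\<dots> \<le> 2 * (cmod (if i < N then 0 else a i))\<^sup>2 + 2 * (cmod (e i))\<^sup>2"
        using sum_squares_bound[of "cmod (if i < N then 0 else a i)" "cmod (e i)"] by (simp add: power2_sum)
      finally show "(cmod (b i))\<^sup>2 \<le> 2 * (if i < N then 0 else (cmod (a i))\<^sup>2) + 2 * (cmod (e i))\<^sup>2"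
        by (simp split: if_splits)
    qed
    also have "\<dots> = 2 * (\<Sum>i\<in>I. if i < N then 0 else (cmod (a i))\<^sup>2) + 2 * (\<Sum>i\<in>I. (cmod (e i))\<^sup>2)"
      by (simp add: sum.distrib sum_distrib_left)
    also have "(\<Sum>i\<in>I. if i < N then 0 else (cmod (a i))\<^sup>2) \<le> sqn a / 16"
    proof -
      have "(\<Sum>i\<in>I. if i < N then 0 else (cmod (a i))\<^sup>2) \<le> (\<Sum>i<N + M. if i < N then 0 else (cmod (a i))\<^sup>2)"
        by (rule sum_mono2) (auto simp: I_def)
      also have "\<dots> = (\<Sum>i\<in>{N..<N + M}. (cmod (a i))\<^sup>2)"
        by (rule sum.mono_neutral_cong_right) auto
      also have "\<dots> = (\<Sum>n<M. (cmod (a (n + N)))\<^sup>2)"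
        using sum.shift_bounds_nat_ivl[of "\<lambda>i. (cmod (a i))\<^sup>2" 0 N M] by (simp add: lessThan_atLeast0 add.commute)
      also have "\<dots> \<le> (\<Sum>n. (cmod (a (n + N)))\<^sup>2)"
        using sa summable_iff_shift[of "\<lambda>n. (cmod (a n))\<^sup>2" N] by (intro sum_le_suminf) auto
      finally show ?thesis using N by linarith
    qed
    also have "(\<Sum>i\<in>I. (cmod (e i))\<^sup>2) \<le> (\<Sum>i\<in>F. (cmod (a i))\<^sup>2) * (1 / 16)"
      unfolding e_def by (rule offdiag_sum_le[OF K F I])
    also have "(\<Sum>i\<in>F. (cmod (a i))\<^sup>2) * (1 / 16) \<le> sqn a / 16" using SF by simp
    finally show ?thesis by simp
  qed
  from ell2_bounded_sums[OF this] have "b \<in> ell2" "sqn b \<le> sqn a / 4" .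
  then show ?thesis using u su ux by (intro exI[of _ u] exI[of _ b]) (auto simp: b_def)
qed

lemma moment_problem:
  assumes x: "\<And>i. i \<in> A \<Longrightarrow> x i \<in> ell2" "\<And>i. i \<in> A \<Longrightarrow> ip (x i) (x i) = 1"
    and K: "offdiag_le x A (1 / 16)" and a: "a \<in> ell2"
  shows "\<exists>u\<in>ell2. \<forall>i\<in>A. ip u (x i) = a i"
proof -
  define D where "D = {a. a \<in> ell2 \<and> (\<forall>i. i \<notin> A \<longrightarrow> a i = 0)}"
  have "\<forall>a\<in>D. \<exists>p. fst p \<in> ell2 \<and> sqn (fst p) \<le> 4 * sqn a \<and> snd p \<in> D \<and> sqn (snd p) \<le> sqn a / 4 \<and>
      (\<forall>i\<in>A. ip (fst p) (x i) = a i - snd p i)"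
    using moment_step[OF x K] unfolding D_def by fastforce
  from bchoice[OF this] obtain p where p: "\<And>a. a \<in> D \<Longrightarrow> fst (p a) \<in> ell2"
    "\<And>a. a \<in> D \<Longrightarrow> sqn (fst (p a)) \<le> 4 * sqn a" "\<And>a. a \<in> D \<Longrightarrow> snd (p a) \<in> D"
    "\<And>a. a \<in> D \<Longrightarrow> sqn (snd (p a)) \<le> sqn a / 4"
    "\<And>a i. a \<in> D \<Longrightarrow> i \<in> A \<Longrightarrow> ip (fst (p a)) (x i) = a i - snd (p a) i"
    by blast
  \<comment> \<open>\<open>moment_step\<close> works with data vanishing off \<open>A\<close>, and
    only the values on \<open>A\<close> have to be attained.\<close>
  define a0 where "a0 = (\<lambda>i. if i \<in> A then a i else 0)"
  have "(\<Sum>i<N. (cmod (a0 i))\<^sup>2) \<le> sqn a" for N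
  proof -
    have "(\<Sum>i<N. (cmod (a0 i))\<^sup>2) \<le> (\<Sum>i<N. (cmod (a i))\<^sup>2)" by (intro sum_mono) (simp add: a0_def)
    also have "\<dots> \<le> sqn a" by (rule sum_le_sqn[OF a]) simp
    finally show ?thesis .
  qed
  then have "a0 \<in> ell2" by (rule ell2_bounded_sums(1))
  then have a0: "a0 \<in> D" by (simp add: D_def a0_def)
  define s where "s k = ((\<lambda>a. snd (p a)) ^^ k) a0" for k
  have s: "s k \<in> D" "sqn (s k) \<le> sqn a0 / 4 ^ k" for k
  proof (induction k)
    case (Suc k)
    { case 1 show ?case using p(3)[OF Suc(1)] by (simp add: s_def) }
    { case 2
      have "sqn (s (Suc k)) \<le> sqn (s k) / 4" using p(4)[OF Suc(1)] by (simp add: s_def)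
      then show ?case using Suc(2) by simp }
  qed (auto simp: s_def a0)
  \<comment> \<open>Chosen so that the bound \<open>4 * (sqn a0 / 4 ^ k)\<close> for
    \<open>sqn (u k)\<close> is the square of \<open>C / 2 ^ k\<close>.\<close>
  define C where "C = 2 * sqrt (sqn a0)"
  have q0: "0 \<le> sqn a0" using a0 sqn_nonneg by (simp add: D_def)
  have Csq: "(C / 2 ^ k)\<^sup>2 = 4 * (sqn a0 / 4 ^ k)" for k
  proof -
    have "((2::real) ^ k)\<^sup>2 = 4 ^ k" by (simp add: power2_eq_square flip: power_mult_distrib)
    then show ?thesis using q0 by (simp add: C_def power_divide power_mult_distrib)
  qed
  define u where "u k = fst (p (s k))" for k
  have u1: "u k \<in> ell2" for k unfolding u_def by (rule p(1)[OF s(1)])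
  have u2: "sqn (u k) \<le> (C / 2 ^ k)\<^sup>2" for k
  proof -
    have "sqn (u k) \<le> 4 * (sqn a0 / 4 ^ k)" using p(2)[OF s(1), of k] s(2)[of k] unfolding u_def by linarith
    also have "\<dots> = (C / 2 ^ k)\<^sup>2"
      by (rule Csq[symmetric])
    finally show ?thesis .
  qed
  have C: "0 \<le> C" using q0 by (simp add: C_def)
  show ?thesis
  proof (intro bexI ballI)
    show "(\<lambda>n. \<Sum>k. u k n) \<in> ell2" by (rule ell2_geometric_series(2)[OF u1 u2 C])
    fix i assume i: "i \<in> A"
    have "(\<lambda>k. ip (u k) (x i)) sums ip (\<lambda>n. \<Sum>k. u k n) (x i)"
      by (rule ip_geometric_series[OF u1 u2 C x(1)[OF i]])
    \<comment> \<open>On \<open>A\<close> the vector \<open>u k\<close> accounts exactly for the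
      drop from the error \<open>s k\<close> to \<open>s (Suc k)\<close>, so the series telescopes
      to the original data.\<close>
    moreover have "(\<lambda>k. ip (u k) (x i)) sums (s 0 i - 0)"
    proof -
      have "ip (u k) (x i) = s k i - s (Suc k) i" for k
        unfolding u_def using p(5)[OF s(1) i] by (simp add: s_def)
      moreover have "(\<lambda>k. s k i) \<longlonglongrightarrow> 0"
      proof (rule Lim_null_comparison)
        show "\<forall>\<^sub>F k in sequentially. norm (s k i) \<le> C / 2 ^ k"
        proof (intro always_eventually allI)
          fix k
          have "(cmod (s k i))\<^sup>2 \<le> sqn (s k)" using sum_le_sqn[of "s k" "{i}"] s(1)[of k] by (simp add: D_def)
          also have "\<dots> \<le> sqn a0 / 4 ^ k" by (rule s(2))
          also have "\<dots> \<le> 4 * (sqn a0 / 4 ^ k)"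
          proof -
            have "0 \<le> sqn a0 / 4 ^ k" using q0 by simp
            then show ?thesis by linarith
          qed
          also have "\<dots> = (C / 2 ^ k)\<^sup>2"
            by (rule Csq[symmetric])
          finally show "norm (s k i) \<le> C / 2 ^ k" by (rule power2_le_imp_le) (use C in auto)
        qed
        have "(\<lambda>k. C * (1 / 2) ^ k) \<longlonglongrightarrow> C * 0" by (intro tendsto_intros LIMSEQ_power_zero) auto
        then show "(\<lambda>k. C / 2 ^ k) \<longlonglongrightarrow> 0" by (simp add: power_divide)
      qed
      ultimately show ?thesis using telescope_sums'[of "\<lambda>k. s k i" 0] by simp
    qed
    ultimately have "ip (\<lambda>n. \<Sum>k. u k n) (x i) = s 0 i" using sums_unique2 by fastforce
    then show "ip (\<lambda>n. \<Sum>k. u k n) (x i) = a i" using i by (simp add: s_def a0_def)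
  qed
qed

text \<open>The total is a finite supremum over squares of indices, so the square below some
  \<open>N\<close> carries all but \<open>d\<close> of it. The condition on \<open>A\<close>
  tolerates one index below \<open>N\<close>, as needed for the dual vectors.\<close>

lemma offdiag_tail:
  assumes K: "offdiag_le x UNIV K" and d: "0 < d"
  shows "\<exists>N. \<forall>A. (\<forall>i\<in>A. \<forall>j\<in>A. i \<noteq> j \<longrightarrow> N \<le> i \<or> N \<le> j) \<longrightarrow> offdiag_le x A d"
proof -
  define g where "g p = (if fst p = snd p then 0 else (cmod (ip (x (snd p)) (x (fst p))))\<^sup>2)" for p :: "nat \<times> nat"
  have g0: "0 \<le> g p" for p by (simp add: g_def)
  have gs: "(\<Sum>i\<in>F. \<Sum>j\<in>F - {i}. (cmod (ip (x j) (x i)))\<^sup>2) = sum g (F \<times> F)" if "finite F" for F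
  proof -
    have "(\<Sum>j\<in>F - {i}. (cmod (ip (x j) (x i)))\<^sup>2) = (\<Sum>j\<in>F. g (i, j))" for i
      by (rule sum.mono_neutral_cong_left) (use that in \<open>auto simp: g_def\<close>)
    then show ?thesis by (simp add: sum.cartesian_product)
  qed
  define S where "S N = sum g ({..<N} \<times> {..<N})" for N
  have bdd: "bdd_above (range S)"
    using K unfolding offdiag_le_def S_def by (auto intro!: bdd_aboveI[of _ K] simp: gs[symmetric])
  obtain N where N: "(SUP n. S n) - d < S N"
    using less_cSUP_iff[OF _ bdd, of "(SUP n. S n) - d"] d by auto
  show ?thesis
  proof (intro exI allI impI)
    fix A :: "nat set" assume A: "\<forall>i\<in>A. \<forall>j\<in>A. i \<noteq> j \<longrightarrow> N \<le> i \<or> N \<le> j"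
    show "offdiag_le x A d" unfolding offdiag_le_def
    proof (intro allI impI)
      fix F assume F: "finite F" "F \<subseteq> A"
      obtain M where M: "F \<subseteq> {..<M}" using F(1) finite_nat_iff_bounded by blast
      define L where "L = max M N"
      have AF: "N \<le> i \<or> N \<le> j" if "i \<in> F" "j \<in> F" "i \<noteq> j" for i j
        using A F that by blast
      have "sum g (F \<times> F) = sum g {p\<in>F \<times> F. fst p \<noteq> snd p}"
        by (rule sum.mono_neutral_right) (use F in \<open>auto simp: g_def\<close>)
      also have "\<dots> \<le> sum g ({..<L} \<times> {..<L} - {..<N} \<times> {..<N})"
        by (rule sum_mono2) (use AF M g0 in \<open>fastforce simp: L_def\<close>)+
      also have "\<dots> = S L - S N" unfolding S_def
        by (rule sum_diff) (auto simp: L_def)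
      also have "\<dots> \<le> d" using cSUP_upper[OF UNIV_I bdd, of L] N by linarith
      finally show "(\<Sum>i\<in>F. \<Sum>j\<in>F - {i}. (cmod (ip (x j) (x i)))\<^sup>2) \<le> d" by (simp only: gs[OF F(1)])
    qed
  qed
qed

text \<open>The dual vectors vanish at all other indices, so correcting the first \<open>N\<close>
  values disturbs neither the other corrections nor the solution on the tail.\<close>

lemma moment_map_onto:
  assumes x: "\<And>i. x i \<in> ell2" "\<And>i. ip (x i) (x i) = 1"
    and K: "offdiag_le x UNIV K"
    and dual: "\<And>m. \<exists>w\<in>ell2. ip w (x m) = 1 \<and> (\<forall>n. n \<noteq> m \<longrightarrow> ip w (x n) = 0)"
    and a: "a \<in> ell2"
  shows "\<exists>u\<in>ell2. \<forall>n. ip u (x n) = a n"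
proof -
  obtain N where N: "\<And>A. (\<forall>i\<in>A. \<forall>j\<in>A. i \<noteq> j \<longrightarrow> N \<le> i \<or> N \<le> j) \<Longrightarrow> offdiag_le x A (1 / 16)"
    using offdiag_tail[OF K, of "1 / 16"] by auto
  have "offdiag_le x {N..} (1 / 16)" by (rule N) auto
  from moment_problem[OF _ _ this a] x obtain u where u: "u \<in> ell2" "\<And>i. N \<le> i \<Longrightarrow> ip u (x i) = a i"
    by auto
  from dual obtain w where w: "\<And>m. w m \<in> ell2" "\<And>m. ip (w m) (x m) = 1"
    "\<And>m n. n \<noteq> m \<Longrightarrow> ip (w m) (x n) = 0" by metis
  define c where "c m = a m - ip u (x m)" for m
  define v where "v = (\<lambda>n. \<Sum>m<N. c m * w m n)"
  have v: "v \<in> ell2" unfolding v_def using w by (intro ell2_sum ell2_scale) auto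
  have vx: "ip v (x n) = (if n < N then c n else 0)" for n
  proof -
    have "ip v (x n) = (\<Sum>m<N. c m * ip (w m) (x n))"
      unfolding v_def using w x by (intro ip_sum_left) auto
    also have "\<dots> = (\<Sum>m<N. if m = n then c n else 0)"
      by (rule sum.cong[OF refl]) (use w in auto)
    also have "\<dots> = (if n < N then c n else 0)" by simp
    finally show ?thesis .
  qed
  show ?thesis
  proof (intro bexI allI)
    show "(\<lambda>n. u n + v n) \<in> ell2" by (rule ell2_add[OF u(1) v])
    show "ip (\<lambda>n. u n + v n) (x n) = a n" for n
      using u x v by (simp add: ip_add_left vx c_def)
  qed
qed

section \<open>Weighted Dirichlet spaces as sequence spaces\<close>

text \<open>The coordinates of the reproducing kernel at \<open>z\<close> in the orthonormal basis
  of the functions \<open>sqrt (kernel_coef a n) * z ^ n\<close>.\<close>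

definition ev :: "real \<Rightarrow> complex \<Rightarrow> nat \<Rightarrow> complex" where
  "ev a z = (\<lambda>n. of_real (sqrt (kernel_coef a n)) * cnj z ^ n)"

text \<open>\<open>fun_of a\<close> is the isometry from the sequence space onto the Dirichlet space: the Taylor coefficients of
  \<open>fun_of a u\<close> are \<open>u n * sqrt (kernel_coef a n)\<close>.\<close>

definition fun_of :: "real \<Rightarrow> (nat \<Rightarrow> complex) \<Rightarrow> complex \<Rightarrow> complex" where
  "fun_of a u z = ip u (ev a z)"

lemma ev_sq: "0 < a \<Longrightarrow> (cmod (ev a z n))\<^sup>2 = kernel_coef a n * ((cmod z)\<^sup>2) ^ n"
  using kernel_coef_pos[of a n]
  by (simp add: ev_def norm_mult norm_power power_mult_distrib power_mult[symmetric] mult.commute)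

lemma ev_ell2:
  assumes "0 < a" "a < 1" "cmod z < 1"
  shows "ev a z \<in> ell2" "sqn (ev a z) = Re (kernel_fun a (of_real ((cmod z)\<^sup>2)))"
    "(1 - (cmod z)\<^sup>2) powr (- a) \<le> sqn (ev a z)" "0 < sqn (ev a z)"
proof -
  have x: "0 \<le> (cmod z)\<^sup>2" "(cmod z)\<^sup>2 < 1" using assms(3) by (auto simp: power_less_one_iff abs_square_less_1)
  note k = kernel_fun_lower[OF assms(1,2) x]
  show "ev a z \<in> ell2" "sqn (ev a z) = Re (kernel_fun a (of_real ((cmod z)\<^sup>2)))"
    using k(1) by (auto simp: ell2_def sqn_def ev_sq[OF assms(1)] sums_iff)
  then show "(1 - (cmod z)\<^sup>2) powr (- a) \<le> sqn (ev a z)" using k(3) by simp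
  moreover have "0 < (1 - (cmod z)\<^sup>2) powr (- a)" using x by simp
  ultimately show "0 < sqn (ev a z)" by linarith
qed

lemma ip_ev_ev:
  assumes "0 < a" "a < 1" "cmod z < 1" "cmod w < 1"
  shows "ip (ev a w) (ev a z) = kernel_fun a (z * cnj w)"
proof -
  have "of_real (kernel_coef a n) = (of_real (sqrt (kernel_coef a n)) :: complex) * of_real (sqrt (kernel_coef a n))" for n
    using kernel_coef_pos[OF assms(1), of n] by (simp flip: of_real_mult)
  then show ?thesis
    unfolding ip_def kernel_fun_def by (intro suminf_cong) (simp add: ev_def power_mult_distrib mult_ac)
qed

lemma fun_of_sums:
  assumes "0 < a" "a < 1" "cmod z < 1" "u \<in> ell2"
  shows "(\<lambda>n. (u n * of_real (sqrt (kernel_coef a n))) * z ^ n) sums fun_of a u z"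
  using ip_sums[OF assms(4) ev_ell2(1)[OF assms(1-3)]] by (simp add: fun_of_def ev_def mult_ac)

lemma power_series_deriv_sums:
  assumes c: "\<And>z. cmod z < 1 \<Longrightarrow> (\<lambda>n. c n * z ^ n) sums f z" and z: "cmod z < 1"
  shows "(\<lambda>n. (of_nat (Suc n) * c (Suc n)) * z ^ n) sums deriv f z"
proof -
  have s: "summable (\<lambda>n. c n * z ^ n)" if "cmod z < 1" for z using c[OF that] by (simp add: sums_iff)
  have d: "((\<lambda>z. \<Sum>n. c n * z ^ n) has_field_derivative (\<Sum>n. diffs c n * z ^ n)) (at z)"
    by (rule termdiffs_strong'[OF s z])
  have "(f has_field_derivative (\<Sum>n. diffs c n * z ^ n)) (at z)"
    by (rule has_field_derivative_transform_within_open[OF d, of unit_disk]) (use z c in \<open>auto simp: sums_iff\<close>)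
  then have "deriv f z = (\<Sum>n. diffs c n * z ^ n)" by (rule DERIV_imp_deriv)
  moreover have "summable (\<lambda>n. diffs c n * z ^ n)" by (rule termdiff_converges[OF z s])
  ultimately show ?thesis by (simp add: sums_iff diffs_def)
qed

lemma power_series_holomorphic_disk:
  assumes "\<And>z. cmod z < 1 \<Longrightarrow> (\<lambda>n. c n * z ^ n) sums f z"
  shows "f holomorphic_on unit_disk"
  by (rule power_series_holomorphic[of 0 1 c f]) (use assms in simp)

lemma nn_integral_deriv_sq:
  assumes a: "0 < a" and c: "\<And>z. cmod z < 1 \<Longrightarrow> (\<lambda>n. c n * z ^ n) sums f z"
  shows "(\<integral>\<^sup>+z. ennreal ((cmod (deriv f z))\<^sup>2 * (1 - (cmod z)\<^sup>2) powr a) \<partial>disk_area)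
    = (\<Sum>n. ennreal ((cmod (c (Suc n)))\<^sup>2 / kernel_coef a (Suc n)))"
proof -
  have "(\<integral>\<^sup>+z. ennreal ((cmod (deriv f z))\<^sup>2 * (1 - (cmod z)\<^sup>2) powr a) \<partial>disk_area)
     = (\<Sum>n. ennreal ((cmod (of_nat (Suc n) * c (Suc n)))\<^sup>2 * Beta (real (Suc n)) (a + 1)))"
    by (rule parseval_disk[OF power_series_deriv_sums[OF c] a])
  also have "\<dots> = (\<Sum>n. ennreal ((cmod (c (Suc n)))\<^sup>2 / kernel_coef a (Suc n)))"
  proof (intro suminf_cong arg_cong[where f = ennreal])
    fix n
    have "(real (Suc n))\<^sup>2 * Beta (real (Suc n)) (a + 1) = 1 / kernel_coef a (Suc n)"
      using kernel_coef_Beta[OF a, of n] kernel_coef_pos[OF a, of "Suc n"] by (simp only: field_simps)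
    moreover have "(cmod (of_nat (Suc n) * c (Suc n)))\<^sup>2 * Beta (real (Suc n)) (a + 1) =
       (cmod (c (Suc n)))\<^sup>2 * ((real (Suc n))\<^sup>2 * Beta (real (Suc n)) (a + 1))"
      by (simp only: norm_mult norm_of_nat power_mult_distrib mult_ac)
    ultimately show "(cmod (of_nat (Suc n) * c (Suc n)))\<^sup>2 * Beta (real (Suc n)) (a + 1) =
       (cmod (c (Suc n)))\<^sup>2 / kernel_coef a (Suc n)" by simp
  qed
  finally show ?thesis .
qed

lemma sqn_split: "u \<in> ell2 \<Longrightarrow> sqn u = (cmod (u 0))\<^sup>2 + (\<Sum>n. (cmod (u (Suc n)))\<^sup>2)"
  unfolding sqn_def ell2_def using suminf_split_head[of "\<lambda>n. (cmod (u n))\<^sup>2"] by simp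

lemma ell2_iff_Suc: "u \<in> ell2 \<longleftrightarrow> summable (\<lambda>n. (cmod (u (Suc n)))\<^sup>2)"
  unfolding ell2_def using summable_Suc_iff[of "\<lambda>n. (cmod (u n))\<^sup>2"] by simp

lemma deriv_cong_disk:
  assumes "\<And>z. cmod z < 1 \<Longrightarrow> f z = g z" "cmod z < 1"
  shows "deriv f z = deriv g z"
proof (rule deriv_cong_ev[OF _ refl])
  have "\<forall>\<^sub>F x in nhds z. x \<in> unit_disk" using assms by (intro eventually_nhds_in_open) auto
  then show "\<forall>\<^sub>F x in nhds z. f x = g x" by eventually_elim (use assms in auto)
qed

text \<open>Agreement of \<open>f\<close> with \<open>fun_of a u\<close> is asked on the disk only,
  since members of the space are arbitrary outside it.\<close>

lemma fun_of_deriv_sq: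
  assumes a: "0 < a" "a < 1" and u: "u \<in> ell2" and f: "\<And>z. cmod z < 1 \<Longrightarrow> f z = fun_of a u z"
  shows "f \<in> dirichlet_space a"
    and "integrable disk_area (\<lambda>z. (cmod (deriv f z))\<^sup>2 * (1 - (cmod z)\<^sup>2) powr a)"
    and "(LINT z|disk_area. (cmod (deriv f z))\<^sup>2 * (1 - (cmod z)\<^sup>2) powr a) = sqn u - (cmod (u 0))\<^sup>2"
    and "f 0 = u 0"
proof -
  have c: "(\<lambda>n. (u n * of_real (sqrt (kernel_coef a n))) * z ^ n) sums f z" if "cmod z < 1" for z
    unfolding f[OF that] by (rule fun_of_sums[OF a that u])
  have hol: "f holomorphic_on unit_disk" by (rule power_series_holomorphic_disk[OF c])
  have N: "(\<integral>\<^sup>+z. ennreal ((cmod (deriv f z))\<^sup>2 * (1 - (cmod z)\<^sup>2) powr a) \<partial>disk_area) = ennreal (sqn u - (cmod (u 0))\<^sup>2)"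
  proof -
    have "(\<integral>\<^sup>+z. ennreal ((cmod (deriv f z))\<^sup>2 * (1 - (cmod z)\<^sup>2) powr a) \<partial>disk_area)
       = (\<Sum>n. ennreal ((cmod (u (Suc n) * of_real (sqrt (kernel_coef a (Suc n)))))\<^sup>2 / kernel_coef a (Suc n)))"
      by (rule nn_integral_deriv_sq[OF a(1) c])
    also have "\<dots> = (\<Sum>n. ennreal ((cmod (u (Suc n)))\<^sup>2))"
    proof (intro suminf_cong arg_cong[where f = ennreal])
      fix n show "(cmod (u (Suc n) * of_real (sqrt (kernel_coef a (Suc n)))))\<^sup>2 / kernel_coef a (Suc n) = (cmod (u (Suc n)))\<^sup>2"
        using kernel_coef_pos[OF a(1), of "Suc n"] by (simp add: norm_mult power_mult_distrib)
    qed
    also have "\<dots> = ennreal (\<Sum>n. (cmod (u (Suc n)))\<^sup>2)"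
      by (rule suminf_ennreal2) (use u ell2_iff_Suc in auto)
    finally show ?thesis using sqn_split[OF u] by simp
  qed
  show "f \<in> dirichlet_space a" unfolding dirichlet_space_def using hol N by simp
  have "deriv f holomorphic_on unit_disk" by (rule holomorphic_deriv[OF hol]) simp
  then have "continuous_on unit_disk (deriv f)" by (rule holomorphic_on_imp_continuous_on)
  then have m: "deriv f \<in> borel_measurable disk_area" by (rule continuous_on_measurable_disk_area)
  have w: "(\<lambda>z. (1 - (cmod z)\<^sup>2) powr a) \<in> borel_measurable disk_area"
    by (rule measurable_disk_area) measurable
  have M: "(\<lambda>z. (cmod (deriv f z))\<^sup>2 * (1 - (cmod z)\<^sup>2) powr a) \<in> borel_measurable disk_area"
    using m w by measurable
  show "integrable disk_area (\<lambda>z. (cmod (deriv f z))\<^sup>2 * (1 - (cmod z)\<^sup>2) powr a)"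
    by (rule integrableI_nonneg[OF M]) (use N in auto)
  have "0 \<le> sqn u - (cmod (u 0))\<^sup>2" using sum_le_sqn[OF u, of "{0}"] by simp
  then show "(LINT z|disk_area. (cmod (deriv f z))\<^sup>2 * (1 - (cmod z)\<^sup>2) powr a) = sqn u - (cmod (u 0))\<^sup>2"
    by (subst integral_eq_nn_integral[OF M]) (simp_all add: N)
  have "(\<lambda>n. (u n * of_real (sqrt (kernel_coef a n))) * 0 ^ n) sums f 0" by (rule c) simp
  moreover have "(\<lambda>n. (u n * of_real (sqrt (kernel_coef a n))) * 0 ^ n) sums (u 0 * of_real (sqrt (kernel_coef a 0)))"
    by (rule powser_sums_zero)
  ultimately show "f 0 = u 0" using sums_unique2 by fastforce
qed

text \<open>The Taylor coefficients at 0, divided by \<open>sqrt (kernel_coef a n)\<close>, are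
  square summable by Parseval, so \<open>fun_of a\<close> reaches the whole space.\<close>

lemma dirichlet_space_coefs:
  assumes a: "0 < a" "a < 1" and f: "f \<in> dirichlet_space a"
  shows "\<exists>u\<in>ell2. \<forall>z. cmod z < 1 \<longrightarrow> f z = fun_of a u z"
proof -
  define c where "c n = (deriv ^^ n) f 0 / fact n" for n
  have hol: "f holomorphic_on ball 0 1" using f by (simp add: dirichlet_space_def)
  have c: "(\<lambda>n. c n * z ^ n) sums f z" if "cmod z < 1" for z
    unfolding c_def using holomorphic_power_series[OF hol, of z] that by simp
  define u where "u n = c n / of_real (sqrt (kernel_coef a n))" for n
  have cu: "c n = u n * of_real (sqrt (kernel_coef a n))" for n
    using kernel_coef_pos[OF a(1), of n] by (simp add: u_def)
  have un: "(cmod (u n))\<^sup>2 = (cmod (c n))\<^sup>2 / kernel_coef a n" for n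
    using kernel_coef_pos[OF a(1), of n] by (simp add: u_def norm_divide power_divide)
  have "(\<Sum>n. ennreal ((cmod (u (Suc n)))\<^sup>2)) < \<infinity>"
    using f nn_integral_deriv_sq[OF a(1) c] by (simp add: dirichlet_space_def un)
  then have "summable (\<lambda>n. (cmod (u (Suc n)))\<^sup>2)"
    by (intro summable_suminf_not_top) auto
  then have u: "u \<in> ell2" by (simp add: ell2_iff_Suc)
  moreover have "f z = fun_of a u z" if "cmod z < 1" for z
    using sums_unique2[OF c[OF that]] fun_of_sums[OF a that u] by (simp add: cu)
  ultimately show ?thesis by blast
qed

lemma deriv_fun_of_linear:
  assumes a: "0 < a" "a < 1" and u: "u \<in> ell2" "v \<in> ell2" and z: "cmod z < 1"
  shows "deriv (fun_of a (\<lambda>n. u n + c * v n)) z = deriv (fun_of a u) z + c * deriv (fun_of a v) z"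
proof -
  have h: "fun_of a u holomorphic_on unit_disk" if "u \<in> ell2" for u
    by (rule power_series_holomorphic_disk[OF fun_of_sums[OF a _ that]])
  then have d: "fun_of a u field_differentiable at z" if "u \<in> ell2" for u
    using that z by (intro holomorphic_on_imp_differentiable_at[OF h]) auto
  have "fun_of a (\<lambda>n. u n + c * v n) w = fun_of a u w + c * fun_of a v w" if "cmod w < 1" for w
  proof -
    have "ip (\<lambda>n. \<Sum>i\<in>{0::nat}. c * v n) (ev a w) = (\<Sum>i\<in>{0::nat}. c * ip v (ev a w))"
      by (rule ip_sum_left) (use u ev_ell2[OF a that] in auto)
    then show ?thesis
      unfolding fun_of_def using u ev_ell2[OF a that] by (subst ip_add_left) (auto intro: ell2_scale)
  qed
  then have "deriv (fun_of a (\<lambda>n. u n + c * v n)) z = deriv (\<lambda>w. fun_of a u w + c * fun_of a v w) z"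
    using z by (intro deriv_cong_disk) auto
  also have "\<dots> = deriv (fun_of a u) z + c * deriv (fun_of a v) z"
    using d u by (simp add: field_differentiable_mult)
  finally show ?thesis .
qed

text \<open>The factors \<open>1\<close> and \<open>-1\<close> are written out so that all four
  squares are instances of \<open>p + c * q\<close>, the pattern used for sequences and for
  derivatives alike.\<close>

lemma polarization:
  fixes p q :: complex
  shows "4 * (p * cnj q) = of_real ((cmod (p + 1 * q))\<^sup>2) - of_real ((cmod (p + (-1) * q))\<^sup>2)
     + \<i> * of_real ((cmod (p + \<i> * q))\<^sup>2) - \<i> * of_real ((cmod (p + (-\<i>) * q))\<^sup>2)"
  by (simp only: complex_norm_square) (simp add: algebra_simps)

lemma sqn_add_scale:
  assumes "u \<in> ell2" "v \<in> ell2"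
  shows "(\<lambda>n. (cmod (u n + c * v n))\<^sup>2) sums sqn (\<lambda>n. u n + c * v n)"
  using ell2_add[OF assms(1) ell2_scale[OF assms(2), of c]] by (simp add: ell2_def sqn_def summable_sums)

lemma ip_polarization:
  assumes "u \<in> ell2" "v \<in> ell2"
  shows "4 * ip u v = of_real (sqn (\<lambda>n. u n + 1 * v n)) - of_real (sqn (\<lambda>n. u n + (-1) * v n))
     + \<i> * of_real (sqn (\<lambda>n. u n + \<i> * v n)) - \<i> * of_real (sqn (\<lambda>n. u n + (-\<i>) * v n))"
proof -
  have s: "(\<lambda>n. of_real ((cmod (u n + c * v n))\<^sup>2) :: complex) sums of_real (sqn (\<lambda>n. u n + c * v n))" for c
    by (rule sums_of_real[OF sqn_add_scale[OF assms]])
  have "(\<lambda>n. 4 * (u n * cnj (v n))) sums (of_real (sqn (\<lambda>n. u n + 1 * v n)) - of_real (sqn (\<lambda>n. u n + (-1) * v n))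
     + \<i> * of_real (sqn (\<lambda>n. u n + \<i> * v n)) - \<i> * of_real (sqn (\<lambda>n. u n + (-\<i>) * v n)))"
    unfolding polarization by (intro sums_add sums_diff sums_mult s)
  moreover have "(\<lambda>n. 4 * (u n * cnj (v n))) sums (4 * ip u v)"
    by (intro sums_mult ip_sums assms)
  ultimately show ?thesis by (rule sums_unique2[symmetric])
qed

text \<open>Polarization reduces the inner product to the norm identity of
  \<open>fun_of_deriv_sq\<close>, so no bilinear version of Parseval is required.\<close>

lemma dirichlet_inner_eq_ip:
  assumes a: "0 < a" "a < 1" and u: "u \<in> ell2" "v \<in> ell2"
    and f: "\<And>z. cmod z < 1 \<Longrightarrow> f z = fun_of a u z" and g: "\<And>z. cmod z < 1 \<Longrightarrow> g z = fun_of a v z"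
  shows "dirichlet_inner a f g = ip u v"
proof -
  define W where "W z = (1 - (cmod z)\<^sup>2) powr a" for z :: complex
  define D where "D c z = (cmod (deriv (fun_of a (\<lambda>n. u n + c * v n)) z))\<^sup>2 * W z" for c z
  define s where "s c = sqn (\<lambda>n. u n + c * v n)" for c
  have uv: "(\<lambda>n. u n + c * v n) \<in> ell2" for c by (intro ell2_add ell2_scale u)
  have Di: "integrable disk_area (D c)" "integral\<^sup>L disk_area (D c) = s c - (cmod (u 0 + c * v 0))\<^sup>2" for c
    unfolding D_def W_def s_def using fun_of_deriv_sq(2,3)[OF a uv refl] by auto
  have "4 * (LINT z|disk_area. deriv f z * cnj (deriv g z) * of_real (W z))
      = (LINT z|disk_area. 4 * (deriv f z * cnj (deriv g z) * of_real (W z)))"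
    by (rule integral_mult_right_zero[symmetric])
  also have "\<dots> = (LINT z|disk_area. of_real (D 1 z) - of_real (D (-1) z) + \<i> * of_real (D \<i> z) - \<i> * of_real (D (-\<i>) z))"
  proof (rule Bochner_Integration.integral_cong[OF refl])
    fix z assume "z \<in> space disk_area"
    then have z: "cmod z < 1" by simp
    define p q where "p = deriv (fun_of a u) z" and "q = deriv (fun_of a v) z"
    have fg: "deriv f z = p" "deriv g z = q" unfolding p_def q_def by (auto intro!: deriv_cong_disk f g z)
    have Dpq: "D c z = (cmod (p + c * q))\<^sup>2 * W z" for c
      unfolding D_def p_def q_def deriv_fun_of_linear[OF a u z] ..
    have "4 * (deriv f z * cnj (deriv g z) * of_real (W z)) = (4 * (p * cnj q)) * of_real (W z)"
      by (simp add: fg mult.assoc)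
    also have "\<dots> = of_real (D 1 z) - of_real (D (-1) z) + \<i> * of_real (D \<i> z) - \<i> * of_real (D (-\<i>) z)"
      unfolding polarization Dpq of_real_mult by (simp only: algebra_simps)
    finally show "4 * (deriv f z * cnj (deriv g z) * of_real (W z)) =
       of_real (D 1 z) - of_real (D (-1) z) + \<i> * of_real (D \<i> z) - \<i> * of_real (D (-\<i>) z)" .
  qed
  also have "\<dots> = of_real (integral\<^sup>L disk_area (D 1)) - of_real (integral\<^sup>L disk_area (D (-1)))
     + \<i> * of_real (integral\<^sup>L disk_area (D \<i>)) - \<i> * of_real (integral\<^sup>L disk_area (D (-\<i>)))"
    using Di(1) by (simp add: Bochner_Integration.integral_add Bochner_Integration.integral_diff)
  also have "\<dots> = (of_real (s 1) - of_real (s (-1)) + \<i> * of_real (s \<i>) - \<i> * of_real (s (-\<i>)))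
     - (of_real ((cmod (u 0 + 1 * v 0))\<^sup>2) - of_real ((cmod (u 0 + (-1) * v 0))\<^sup>2)
     + \<i> * of_real ((cmod (u 0 + \<i> * v 0))\<^sup>2) - \<i> * of_real ((cmod (u 0 + (-\<i>) * v 0))\<^sup>2))"
    unfolding Di(2) of_real_diff by (simp only: algebra_simps)
  also have "\<dots> = 4 * ip u v - 4 * (u 0 * cnj (v 0))"
    unfolding polarization[symmetric] s_def ip_polarization[OF u, symmetric] ..
  finally have "4 * (LINT z|disk_area. deriv f z * cnj (deriv g z) * of_real (W z)) = 4 * (ip u v - u 0 * cnj (v 0))"
    by (simp only: right_diff_distrib)
  then have "(LINT z|disk_area. deriv f z * cnj (deriv g z) * of_real (W z)) = ip u v - u 0 * cnj (v 0)"
    by (subst (asm) mult_cancel_left) simp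
  then show ?thesis
    unfolding dirichlet_inner_def W_def using fun_of_deriv_sq(4)[OF a u(1) f] fun_of_deriv_sq(4)[OF a u(2) g]
    by simp
qed

lemma dirichlet_norm_eq:
  assumes a: "0 < a" "a < 1" and u: "u \<in> ell2" and f: "\<And>z. cmod z < 1 \<Longrightarrow> f z = fun_of a u z"
  shows "dirichlet_norm a f = sqrt (sqn u)"
  unfolding dirichlet_norm_def using fun_of_deriv_sq(3,4)[OF a u f] by simp

text \<open>The kernel is an arbitrary choice by \<open>SOME\<close>. The function
  \<open>fun_of a (ev a w)\<close> shows that a choice exists; any chosen one has the same inner
  products as \<open>ev a w\<close>, and testing with both vectors shows that the norms
  agree.\<close>

lemma norm_dirichlet_kernel:
  assumes a: "0 < a" "a < 1" and w: "cmod w < 1"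
  shows "dirichlet_norm a (dirichlet_kernel a w) = sqrt (sqn (ev a w))"
proof -
  note e = ev_ell2[OF a w]
  have "is_reproducing_kernel a w (fun_of a (ev a w))"
    unfolding is_reproducing_kernel_def
  proof (intro conjI ballI)
    show "fun_of a (ev a w) \<in> dirichlet_space a" by (rule fun_of_deriv_sq(1)[OF a e(1) refl])
    fix f assume "f \<in> dirichlet_space a"
    then obtain u where u: "u \<in> ell2" "\<And>z. cmod z < 1 \<Longrightarrow> f z = fun_of a u z"
      using dirichlet_space_coefs[OF a] by blast
    have "dirichlet_inner a f (fun_of a (ev a w)) = ip u (ev a w)"
      by (rule dirichlet_inner_eq_ip[OF a u(1) e(1) u(2) refl])
    then show "f w = dirichlet_inner a f (fun_of a (ev a w))" using u(2)[OF w] by (simp add: fun_of_def)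
  qed
  then have k: "is_reproducing_kernel a w (dirichlet_kernel a w)"
    unfolding dirichlet_kernel_def by (rule someI[of "is_reproducing_kernel a w"])
  then obtain v where v: "v \<in> ell2" "\<And>z. cmod z < 1 \<Longrightarrow> dirichlet_kernel a w z = fun_of a v z"
    using dirichlet_space_coefs[OF a] unfolding is_reproducing_kernel_def by blast
  have rep: "ip u (ev a w) = ip u v" if "u \<in> ell2" for u
  proof -
    have "fun_of a u w = dirichlet_inner a (fun_of a u) (dirichlet_kernel a w)"
      using k fun_of_deriv_sq(1)[OF a that refl] unfolding is_reproducing_kernel_def by blast
    then show ?thesis using dirichlet_inner_eq_ip[OF a that v(1) refl v(2)] by (simp add: fun_of_def)
  qed
  have "complex_of_real (sqn (ev a w)) = ip (ev a w) v" using rep[OF e(1)] by (simp add: ip_self e)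
  also have "\<dots> = cnj (ip v (ev a w))" by (rule ip_cnj[OF v(1) e(1)])
  also have "\<dots> = of_real (sqn v)" using rep[OF v(1)] by (simp add: ip_self v)
  finally have "sqn (ev a w) = sqn v" by simp
  then show ?thesis using dirichlet_norm_eq[OF a v] by simp
qed

section \<open>Normalized kernels and interpolation as a moment problem\<close>

definition nev :: "real \<Rightarrow> complex \<Rightarrow> nat \<Rightarrow> complex" where
  "nev a z = (\<lambda>n. of_real (1 / sqrt (sqn (ev a z))) * ev a z n)"

lemma nev_props:
  assumes a: "0 < a" "a < 1" and z: "cmod z < 1"
  shows "nev a z \<in> ell2" "\<And>u. u \<in> ell2 \<Longrightarrow> ip u (nev a z) = fun_of a u z / of_real (sqrt (sqn (ev a z)))"
    "ip (nev a z) (nev a z) = 1"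
proof -
  note e = ev_ell2[OF a z]
  show n: "nev a z \<in> ell2" unfolding nev_def by (rule ell2_scale[OF e(1)])
  show r: "ip u (nev a z) = fun_of a u z / of_real (sqrt (sqn (ev a z)))" if "u \<in> ell2" for u
    using ip_sum_right[of "{0::nat}" "\<lambda>_. ev a z" u "\<lambda>_. of_real (1 / sqrt (sqn (ev a z)))"] that e
    by (simp add: nev_def fun_of_def)
  have "ip (nev a z) (nev a z) = ip (nev a z) (ev a z) / of_real (sqrt (sqn (ev a z)))"
    by (simp add: r[OF n] fun_of_def)
  also have "ip (nev a z) (ev a z) = of_real (1 / sqrt (sqn (ev a z))) * of_real (sqn (ev a z))"
    using ip_sum_left[of "{0::nat}" "\<lambda>_. ev a z" "ev a z" "\<lambda>_. of_real (1 / sqrt (sqn (ev a z)))"] e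
    by (simp add: nev_def ip_self)
  finally show "ip (nev a z) (nev a z) = 1"
    using e(4) by (simp flip: of_real_mult of_real_divide)
qed

text \<open>Interpolation becomes a moment problem for unit vectors; equality of the image with
  \<open>ell2\<close> carries both the into and the onto half.\<close>

lemma interpolating_iff:
  assumes a: "0 < a" "a < 1"
  shows "interpolating a l \<longleftrightarrow> range l \<subseteq> unit_disk \<and> (\<lambda>u n. ip u (nev a (l n))) ` ell2 = ell2"
proof (cases "range l \<subseteq> unit_disk")
  case True
  have l: "cmod (l n) < 1" for n using subsetD[OF True, of "l n"] by simp
  have "(\<lambda>f n. f (l n) / of_real (dirichlet_norm a (dirichlet_kernel a (l n)))) ` dirichlet_space a
      = (\<lambda>u n. ip u (nev a (l n))) ` ell2"
  proof (intro equalityI subsetI)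
    fix b assume "b \<in> (\<lambda>f n. f (l n) / of_real (dirichlet_norm a (dirichlet_kernel a (l n)))) ` dirichlet_space a"
    then obtain f where f: "f \<in> dirichlet_space a"
      "b = (\<lambda>n. f (l n) / of_real (dirichlet_norm a (dirichlet_kernel a (l n))))" by blast
    then obtain u where u: "u \<in> ell2" "\<And>z. cmod z < 1 \<Longrightarrow> f z = fun_of a u z"
      using dirichlet_space_coefs[OF a] by blast
    have "b = (\<lambda>n. ip u (nev a (l n)))"
      unfolding f(2) using l by (simp add: nev_props[OF a l] u norm_dirichlet_kernel[OF a l])
    then show "b \<in> (\<lambda>u n. ip u (nev a (l n))) ` ell2" using u(1) by blast
  next
    fix b assume "b \<in> (\<lambda>u n. ip u (nev a (l n))) ` ell2"
    then obtain u where u: "u \<in> ell2" "b = (\<lambda>n. ip u (nev a (l n)))" by blast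
    have "b = (\<lambda>n. fun_of a u (l n) / of_real (dirichlet_norm a (dirichlet_kernel a (l n))))"
      unfolding u(2) by (simp add: nev_props[OF a l] u(1) norm_dirichlet_kernel[OF a l])
    moreover have "fun_of a u \<in> dirichlet_space a" by (rule fun_of_deriv_sq(1)[OF a u(1) refl])
    ultimately show "b \<in> (\<lambda>f n. f (l n) / of_real (dirichlet_norm a (dirichlet_kernel a (l n)))) ` dirichlet_space a"
      by blast
  qed
  then show ?thesis by (simp add: interpolating_def)
qed (simp add: interpolating_def)

text \<open>Multiplication by \<open>z\<close> is a weighted shift of the coordinates, with weights
  at most 2 by \<open>kernel_coef_Suc_ge\<close>.\<close>

lemma fun_of_mult_linear:
  assumes a: "0 < a" "a < 1" and u: "u \<in> ell2"
  shows "\<exists>v\<in>ell2. \<forall>z. cmod z < 1 \<longrightarrow> fun_of a v z = (z - c) * fun_of a u z"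
proof -
  define r where "r n = sqrt (kernel_coef a n)" for n
  have rp: "r n > 0" for n using kernel_coef_pos[OF a(1)] by (simp add: r_def)
  have rr: "r n / r (Suc n) \<le> 2" for n
  proof -
    have "r n \<le> sqrt (4 * kernel_coef a (Suc n))"
      unfolding r_def using kernel_coef_Suc_ge[OF a] by (intro real_sqrt_le_mono)
    then show ?thesis using rp[of "Suc n"] by (simp add: real_sqrt_mult r_def field_simps)
  qed
  define s where "s n = (case n of 0 \<Rightarrow> 0 | Suc m \<Rightarrow> u m * of_real (r m / r (Suc m)))" for n
  have "summable (\<lambda>n. (cmod (s (Suc n)))\<^sup>2)"
  proof (rule summable_comparison_test')
    show "summable (\<lambda>n. 4 * (cmod (u n))\<^sup>2)" using u by (simp add: ell2_def summable_mult)
    fix n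
    have "cmod (s (Suc n)) \<le> cmod (u n) * 2"
      unfolding s_def using rr[of n] rp[of n] rp[of "Suc n"]
      by (simp add: norm_mult norm_divide mult_left_mono[of "r n / r (Suc n)" 2 "cmod (u n)"])
         (use mult_left_mono[of "r n / r (Suc n)" 2 "cmod (u n)"] in simp)
    then have "(cmod (s (Suc n)))\<^sup>2 \<le> (cmod (u n) * 2)\<^sup>2" by (intro power_mono) auto
    then show "norm ((cmod (s (Suc n)))\<^sup>2) \<le> 4 * (cmod (u n))\<^sup>2" by (simp add: power_mult_distrib mult.commute)
  qed
  then have s: "s \<in> ell2" by (simp add: ell2_iff_Suc)
  have fs: "fun_of a s z = z * fun_of a u z" if z: "cmod z < 1" for z
  proof -
    have "(\<lambda>n. (s (Suc n) * of_real (r (Suc n))) * z ^ Suc n) sums (z * fun_of a u z)"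
    proof -
      have e: "(s (Suc n) * of_real (r (Suc n))) * z ^ Suc n = z * ((u n * of_real (r n)) * z ^ n)" for n
        using rp[of "Suc n"] by (simp add: s_def)
      show ?thesis unfolding e unfolding r_def by (rule sums_mult[OF fun_of_sums[OF a z u]])
    qed
    then have "(\<lambda>n. (s n * of_real (r n)) * z ^ n) sums (z * fun_of a u z)"
      by (subst (asm) sums_Suc_iff) (simp add: s_def)
    with fun_of_sums[OF a z s] show ?thesis using sums_unique2 unfolding r_def by blast
  qed
  show ?thesis
  proof (intro bexI allI impI)
    show "(\<lambda>n. s n - c * u n) \<in> ell2" by (intro ell2_diff ell2_scale s u)
    fix z assume z: "cmod z < 1"
    have "fun_of a (\<lambda>n. s n - c * u n) z = fun_of a s z - c * fun_of a u z"
      using ip_sum_left[of "{0::nat}" "\<lambda>_. u" "ev a z" "\<lambda>_. c"] ev_ell2[OF a z] s u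
      by (simp add: fun_of_def ip_diff_left ell2_scale)
    then show "fun_of a (\<lambda>n. s n - c * u n) z = (z - c) * fun_of a u z"
      by (simp add: fs[OF z] algebra_simps)
  qed
qed

lemma fun_of_mult_poly:
  assumes a: "0 < a" "a < 1" and u: "u \<in> ell2" and F: "finite F"
  shows "\<exists>v\<in>ell2. \<forall>z. cmod z < 1 \<longrightarrow> fun_of a v z = (\<Prod>c\<in>F. z - c) * fun_of a u z"
  using F
proof (induction F)
  case empty then show ?case using u by auto
next
  case (insert c F)
  then obtain v where v: "v \<in> ell2" "\<forall>z. cmod z < 1 \<longrightarrow> fun_of a v z = (\<Prod>c\<in>F. z - c) * fun_of a u z" by blast
  obtain v' where "v' \<in> ell2" "\<forall>z. cmod z < 1 \<longrightarrow> fun_of a v' z = (z - c) * fun_of a v z"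
    using fun_of_mult_linear[OF a v(1), of c] by blast
  then show ?case using insert v by (intro bexI[of _ v']) (auto simp: mult.assoc)
qed

lemma hilbert_schmidt_interpolating:
  assumes a: "0 < a" "a < 1" and l: "inj l" "\<And>n. cmod (l n) < 1"
    and K: "offdiag_le (\<lambda>n. nev a (l n)) UNIV K"
  shows "interpolating a l"
proof -
  note np = nev_props[OF a l(2)]
  have sp: "sqrt (sqn (ev a (l n))) \<noteq> 0" for n using ev_ell2(4)[OF a l(2), of n] by simp
  have dual: "\<exists>w\<in>ell2. ip w (nev a (l m)) = 1 \<and> (\<forall>n. n \<noteq> m \<longrightarrow> ip w (nev a (l n)) = 0)" for m
  proof -
    obtain N where N: "\<And>A. (\<forall>i\<in>A. \<forall>j\<in>A. i \<noteq> j \<longrightarrow> N \<le> i \<or> N \<le> j) \<Longrightarrow> offdiag_le (\<lambda>n. nev a (l n)) A (1 / 16)"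
      using offdiag_tail[OF K, of "1 / 16"] by auto
    \<comment> \<open>Adding the single index \<open>m\<close> to the tail is harmless: of any two
      different indices one is still at least \<open>N\<close>.\<close>
    have od: "offdiag_le (\<lambda>n. nev a (l n)) (insert m {N..}) (1 / 16)" by (rule N) auto
    have "(\<lambda>n. if n = m then 1 else 0) \<in> ell2"
      unfolding ell2_def using summable_finite[of "{m}" "\<lambda>n. (cmod (if n = m then 1 else 0))\<^sup>2"] by auto
    from moment_problem[OF np(1,3) od this] obtain u where u': "u \<in> ell2"
      "\<forall>n\<in>insert m {N..}. ip u (nev a (l n)) = (if n = m then 1 else 0)" by blast
    then have u: "u \<in> ell2" "\<And>n. n = m \<or> N \<le> n \<Longrightarrow> ip u (nev a (l n)) = (if n = m then 1 else 0)"
      by blast+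
    \<comment> \<open>The roots are the other points with index below \<open>N\<close>.
      Multiplication keeps the zeros on the tail, and injectivity of \<open>l\<close> makes the
      factor at \<open>l m\<close> nonzero.\<close>
    define F where "F = l ` ({..<N} - {m})"
    obtain v where v: "v \<in> ell2" "\<And>z. cmod z < 1 \<Longrightarrow> fun_of a v z = (\<Prod>c\<in>F. z - c) * fun_of a u z"
      using fun_of_mult_poly[OF a u(1), of F] unfolding F_def by blast
    have fm: "finite F" by (simp add: F_def)
    have vn: "ip v (nev a (l n)) = (\<Prod>c\<in>F. l n - c) * ip u (nev a (l n))" for n
      using v l by (simp add: np u)
    have nz: "(\<Prod>c\<in>F. l m - c) \<noteq> 0"
      using l(1) fm by (auto simp: F_def inj_def)
    have z: "ip v (nev a (l n)) = 0" if "n \<noteq> m" for n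
    proof (cases "n < N")
      case True
      then have "(\<Prod>c\<in>F. l n - c) = 0" using that fm by (auto simp: F_def prod_zero_iff)
      then show ?thesis by (simp add: vn)
    next
      case False then show ?thesis using u(2)[of n] that by (simp add: vn)
    qed
    define k where "k = (\<Prod>c\<in>F. l m - c)"
    have scale: "ip (\<lambda>i. (1 / k) * v i) (nev a (l n)) = (1 / k) * ip v (nev a (l n))" for n
      using ip_sum_left[of "{0::nat}" "\<lambda>_. v" "nev a (l n)" "\<lambda>_. 1 / k"] v(1) np by simp
    show ?thesis
    proof (intro bexI conjI allI impI)
      show "(\<lambda>i. (1 / k) * v i) \<in> ell2" by (rule ell2_scale[OF v(1)])
      show "ip (\<lambda>i. (1 / k) * v i) (nev a (l m)) = 1"
        unfolding scale vn using u(2)[of m] nz by (simp add: k_def)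
      show "ip (\<lambda>i. (1 / k) * v i) (nev a (l n)) = 0" if "n \<noteq> m" for n
        unfolding scale using z[OF that] by simp
    qed
  qed
  have "(\<lambda>u n. ip u (nev a (l n))) ` ell2 = ell2"
  proof (intro equalityI subsetI)
    fix b assume "b \<in> (\<lambda>u n. ip u (nev a (l n))) ` ell2"
    then show "b \<in> ell2" using bessel_ell2[OF np(1,3) K] by blast
  next
    fix b assume "b \<in> ell2"
    then obtain u where "u \<in> ell2" "\<forall>n. ip u (nev a (l n)) = b n"
      using moment_map_onto[OF np(1,3) K dual] by blast
    then show "b \<in> (\<lambda>u n. ip u (nev a (l n))) ` ell2" by (intro image_eqI[of _ _ u]) auto
  qed
  then show ?thesis unfolding interpolating_iff[OF a] using l(2) by auto
qed

text \<open>The derivative at \<open>z\<close> is the inner product with a vector \<open>v\<close>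
  whose squared norm is the kernel differentiated in both variables, taken on the diagonal. The
  coordinate \<open>v 0\<close> is 0 as constants have no derivative.\<close>

lemma deriv_fun_of_bound:
  assumes a: "0 < a" "a < 1" and u: "u \<in> ell2" and z: "cmod z < 1"
  shows "(cmod (deriv (fun_of a u) z))\<^sup>2 \<le> sqn u * ((a + 1) * (1 - (cmod z)\<^sup>2) powr (- (a + 2)))"
proof -
  define v where "v n = (case n of 0 \<Rightarrow> 0 | Suc m \<Rightarrow> of_real (real (Suc m) * sqrt (kernel_coef a (Suc m))) * cnj z ^ m)" for n
  have x: "0 \<le> (cmod z)\<^sup>2" "(cmod z)\<^sup>2 < 1" using z by (auto simp: power_less_one_iff abs_square_less_1)
  have "(cmod (v (Suc n)))\<^sup>2 = (real (Suc n))\<^sup>2 * kernel_coef a (Suc n) * ((cmod z)\<^sup>2) ^ n" for n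
    using kernel_coef_pos[OF a(1), of "Suc n"]
    by (simp add: v_def norm_mult norm_power power_mult_distrib power_mult[symmetric] mult.commute del: of_nat_Suc)
  with kernel_coef_deriv_sums[OF a(1) x]
  have vs: "(\<lambda>n. (cmod (v (Suc n)))\<^sup>2) sums ((a + 1) * (1 - (cmod z)\<^sup>2) powr (- (a + 2)))" by simp
  then have v: "v \<in> ell2" by (simp add: ell2_iff_Suc sums_iff)
  have sv: "sqn v = (a + 1) * (1 - (cmod z)\<^sup>2) powr (- (a + 2))"
    using sqn_split[OF v] vs by (simp add: sums_iff v_def)
  have "(\<lambda>n. (of_nat (Suc n) * (u (Suc n) * of_real (sqrt (kernel_coef a (Suc n))))) * z ^ n) sums deriv (fun_of a u) z"
    by (rule power_series_deriv_sums[OF fun_of_sums[OF a _ u] z])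
  then have "(\<lambda>n. u (Suc n) * cnj (v (Suc n))) sums deriv (fun_of a u) z"
    by (simp add: v_def mult_ac)
  then have "(\<lambda>n. u n * cnj (v n)) sums deriv (fun_of a u) z"
    by (subst (asm) sums_Suc_iff) (simp add: v_def)
  then have "deriv (fun_of a u) z = ip u v" using ip_sums[OF u v] sums_unique2 by blast
  then show ?thesis using ip_Cauchy_Schwarz[OF u v] sv by simp
qed

section \<open>The Gram matrix on dyadic boxes\<close>

text \<open>A weak Jordan inequality. With \<open>s = t / 2\<close>, the mean value theorem gives
  \<open>sin s >= s * cos s\<close>; doubling the angle turns this into
  \<open>sin t >= s * (1 + cos t)\<close>, which is at least \<open>s\<close>.\<close>

lemma sin_ge_half:
  fixes t :: real
  assumes "0 \<le> t" "t \<le> pi / 2"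
  shows "t / 2 \<le> sin t"
proof (cases "t = 0")
  case False
  define s where "s = t / 2"
  have s: "0 < s" "s \<le> pi / 4" using assms False by (auto simp: s_def)
  have "\<exists>x>0. x < s \<and> sin s - sin 0 = (s - 0) * cos x"
    using s by (intro MVT2) (auto intro!: derivative_eq_intros)
  then obtain x where x: "0 < x" "x < s" "sin s = s * cos x" by auto
  have "cos s \<le> cos x" using x s by (intro cos_monotone_0_pi_le) auto
  then have "s * cos s \<le> sin s" using x s by simp
  moreover have c0: "0 \<le> cos s" using s by (intro cos_ge_zero) auto
  ultimately have "s * cos s * (2 * cos s) \<le> sin s * (2 * cos s)" by (intro mult_right_mono) auto
  also have "\<dots> = sin t" using sin_double[of s] by (simp add: s_def)
  also have "s * cos s * (2 * cos s) = s * (1 + cos t)"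
    using cos_double_cos[of s] by (simp add: s_def power2_eq_square algebra_simps)
  finally have "s * (1 + cos t) \<le> sin t" .
  moreover have "0 \<le> cos t" using assms by (intro cos_ge_zero) auto
  then have "s * 1 \<le> s * (1 + cos t)" using s(1) by (intro mult_left_mono) auto
  ultimately show ?thesis unfolding s_def by linarith
qed simp

text \<open>On this range the minimum is the distance of \<open>x\<close> to the nearest integer;
  the bound is \<open>sin_ge_half\<close> with \<open>pi / 2 > 1\<close>, reflected at
  \<open>1 / 2\<close>.\<close>

lemma abs_sin_pi_ge:
  fixes x :: real
  assumes "\<bar>x\<bar> \<le> 1"
  shows "min \<bar>x\<bar> (1 - \<bar>x\<bar>) \<le> \<bar>sin (pi * x)\<bar>"
proof -
  have *: "min y (1 - y) \<le> sin (pi * y)" if y: "0 \<le> y" "y \<le> 1" for y :: real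
  proof (cases "y \<le> 1 / 2")
    case True
    have "y \<le> pi * y / 2" using y pi_gt3 mult_right_mono[of 2 pi y] by simp
    also have "\<dots> \<le> sin (pi * y)" using y True by (intro sin_ge_half) auto
    finally show ?thesis by simp
  next
    case False
    define w where "w = 1 - y"
    have w: "0 \<le> w" "w \<le> 1 / 2" using y False by (auto simp: w_def)
    have "w \<le> pi * w / 2" using w pi_gt3 mult_right_mono[of 2 pi w] by simp
    also have "\<dots> \<le> sin (pi * w)" using w by (intro sin_ge_half) auto
    also have "\<dots> = sin (pi * y)" by (simp add: w_def right_diff_distrib sin_diff)
    finally show ?thesis by (simp add: w_def)
  qed
  have "sin (pi * \<bar>x\<bar>) \<le> \<bar>sin (pi * x)\<bar>" by (cases "0 \<le> x") auto
  with *[of "\<bar>x\<bar>"] assms show ?thesis by linarith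
qed

text \<open>With \<open>S\<close> the square of \<open>sin (t / 2)\<close>, the squared modulus is
  \<open>(1 - r)^2 + 4 * r * S\<close>. Since \<open>S <= 1\<close> this is at least
  \<open>(1 + r)^2 * S\<close>, hence at least \<open>S\<close>.\<close>

lemma norm_one_minus_ge_sin:
  assumes "0 \<le> r" "r \<le> 1"
  shows "\<bar>sin (t / 2)\<bar> \<le> cmod (1 - of_real r * cis t)"
proof -
  have ct: "cos t = 1 - 2 * (sin (t / 2))\<^sup>2" using cos_double_sin[of "t / 2"] by simp
  have "(cmod (1 - of_real r * cis t))\<^sup>2 = 1 - 2 * r * cos t + r\<^sup>2 * ((cos t)\<^sup>2 + (sin t)\<^sup>2)"
    unfolding cmod_power2 by (simp add: power2_eq_square algebra_simps del: sin_cos_squared_add sin_cos_squared_add2 sin_cos_squared_add3)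
  also have "\<dots> = 1 - 2 * r * cos t + r\<^sup>2" by simp
  also have "\<dots> = (1 - r)\<^sup>2 + 4 * r * (sin (t / 2))\<^sup>2"
    unfolding ct by (simp add: power2_eq_square algebra_simps)
  also have "\<dots> \<ge> (1 - r)\<^sup>2 * (sin (t / 2))\<^sup>2 + 4 * r * (sin (t / 2))\<^sup>2"
    by (simp add: mult_left_le abs_square_le_1)
  also have "(1 - r)\<^sup>2 * (sin (t / 2))\<^sup>2 + 4 * r * (sin (t / 2))\<^sup>2 = (1 + r)\<^sup>2 * (sin (t / 2))\<^sup>2"
    by (simp add: power2_eq_square algebra_simps)
  finally have "(1 + r)\<^sup>2 * (sin (t / 2))\<^sup>2 \<le> (cmod (1 - of_real r * cis t))\<^sup>2" .
  moreover have "1 * (sin (t / 2))\<^sup>2 \<le> (1 + r)\<^sup>2 * (sin (t / 2))\<^sup>2"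
    using assms by (intro mult_right_mono) auto
  ultimately have "(sin (t / 2))\<^sup>2 \<le> (cmod (1 - of_real r * cis t))\<^sup>2" by linarith
  then show ?thesis using abs_le_square_iff[of "sin (t / 2)" "cmod (1 - of_real r * cis t)"] by simp
qed

text \<open>Truncated subtraction makes \<open>(p - q) + (q - p)\<close> the absolute difference;
  the minimum with its complement is the distance on a cycle of \<open>Q\<close> arcs.\<close>

definition cyclic_dist :: "nat \<Rightarrow> nat \<Rightarrow> nat \<Rightarrow> nat" where
  "cyclic_dist Q p q = min ((p - q) + (q - p)) (Q - ((p - q) + (q - p)))"

text \<open>Up to a constant, \<open>box_kernel\<close> bounds \<open>(1 - |z|\<^sup>2) (1 - |w|\<^sup>2) / |1 - z cnj w|\<^sup>2\<close> on a pair of boxes; the finer box is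
  replaced by its ancestor in the generation \<open>M\<close> of the coarser one.\<close>

definition box_kernel :: "nat \<times> nat \<Rightarrow> nat \<times> nat \<Rightarrow> real" where
  "box_kernel a b = (let M = min (fst a) (fst b) in
     4 ^ M / (2 ^ (fst a + fst b) *
       (1 + real (cyclic_dist (2 ^ M) (snd a div 2 ^ (fst a - M)) (snd b div 2 ^ (fst b - M))))\<^sup>2))"

lemma cyclic_dist_commute: "cyclic_dist Q p q = cyclic_dist Q q p"
  by (simp add: cyclic_dist_def add.commute)

lemma box_kernel_commute: "box_kernel a b = box_kernel b a"
  by (simp add: box_kernel_def Let_def min.commute add.commute cyclic_dist_commute)

lemma box_kernel_pos: "0 < box_kernel a b"
  by (auto simp: box_kernel_def Let_def intro!: divide_pos_pos mult_pos_pos zero_less_power add_pos_nonneg)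

lemma dyadic_ancestor:
  assumes "M \<le> n" "real k / 2 ^ n \<le> x" "x < real (k + 1) / 2 ^ n"
  shows "real (k div 2 ^ (n - M)) / 2 ^ M \<le> x" "x < (real (k div 2 ^ (n - M)) + 1) / 2 ^ M"
proof -
  define c where "c = (2::nat) ^ (n - M)"
  define p where "p = k div c"
  have c: "c > 0" by (simp add: c_def)
  have n: "(2::real) ^ n = 2 ^ M * real c" using assms(1) by (simp add: c_def power_add[symmetric])
  have "p * c \<le> k" "k < (p + 1) * c"
    using div_times_less_eq_dividend[of k c] dividend_less_div_times[OF c, of k] by (auto simp: p_def)
  then have 1: "real p * real c \<le> real k" and 2: "real (k + 1) \<le> (real p + 1) * real c"
    by (metis of_nat_mult of_nat_le_iff)
       (metis Suc_eq_plus1 Suc_leI \<open>k < (p + 1) * c\<close> of_nat_1 of_nat_add of_nat_le_iff of_nat_mult)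
  have "real p / 2 ^ M = (real p * real c) / 2 ^ n" unfolding n using c by simp
  also have "\<dots> \<le> real k / 2 ^ n" using 1 by (intro divide_right_mono) auto
  finally show "real (k div 2 ^ (n - M)) / 2 ^ M \<le> x" using assms(2) by (simp add: p_def c_def)
  have "real (k + 1) / 2 ^ n \<le> ((real p + 1) * real c) / 2 ^ n" using 2 by (intro divide_right_mono) auto
  also have "\<dots> = (real p + 1) / 2 ^ M" unfolding n using c by simp
  finally show "x < (real (k div 2 ^ (n - M)) + 1) / 2 ^ M" using assms(3) by (simp add: p_def c_def)
qed

lemma ancestor_index_less:
  fixes k :: nat
  assumes "M \<le> n" "k < 2 ^ n" shows "k div 2 ^ (n - M) < 2 ^ M"
proof (rule less_mult_imp_div_less)
  have "(2::nat) ^ n = 2 ^ M * 2 ^ (n - M)" using assms(1) by (metis le_add_diff_inverse power_add)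
  then show "k < 2 ^ M * 2 ^ (n - M)" using assms(2) by simp
qed

text \<open>The index of an arc locates its points up to one arc length \<open>1 / Q\<close>, which
  is the loss of 1 on the left. Angles are measured in full turns.\<close>

lemma cyclic_dist_le:
  fixes x y :: real
  assumes p: "real p / Q \<le> x" "x < (real p + 1) / Q" and q: "real q / Q \<le> y" "y < (real q + 1) / Q"
    and Q: "0 < Q" "Q = real R" and le: "p < R" "q < R"
  shows "real (cyclic_dist R p q) - 1 \<le> Q * min \<bar>x - y\<bar> (1 - \<bar>x - y\<bar>)" "\<bar>x - y\<bar> \<le> 1"
proof -
  have p': "real p \<le> Q * x" "Q * x < real p + 1" and q': "real q \<le> Q * y" "Q * y < real q + 1"
    using p q Q(1) by (simp_all add: field_simps)
  define D where "D = Q * \<bar>x - y\<bar>"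
  have D: "D = \<bar>Q * x - Q * y\<bar>" using Q(1) by (simp add: D_def abs_mult flip: right_diff_distrib)
  define d where "d = (p - q) + (q - p)"
  have dd: "real d = \<bar>real p - real q\<bar>" by (simp add: d_def)
  have "d \<le> R" using le by (auto simp: d_def)
  then have cd: "real (cyclic_dist R p q) = min (real d) (Q - real d)"
    by (simp add: cyclic_dist_def d_def[symmetric] Q(2) of_nat_min of_nat_diff)
  have 1: "real d - 1 \<le> D" and 2: "D \<le> real d + 1" using p' q' unfolding dd D by linarith+
  have m: "Q * min \<bar>x - y\<bar> (1 - \<bar>x - y\<bar>) = min D (Q - D)"
    using Q(1) by (simp add: D_def min_mult_distrib_left right_diff_distrib)
  show "real (cyclic_dist R p q) - 1 \<le> Q * min \<bar>x - y\<bar> (1 - \<bar>x - y\<bar>)"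
    unfolding cd m using 1 2 by linarith
  have "real p \<le> Q - 1" "real q \<le> Q - 1" using le unfolding Q(2) by linarith+
  then have "D \<le> Q" unfolding D using p' q' by linarith
  then have "Q * \<bar>x - y\<bar> \<le> Q * 1" by (simp add: D_def)
  then show "\<bar>x - y\<bar> \<le> 1" using Q(1) by (simp only: mult_le_cancel_left_pos)
qed

text \<open>Two lower bounds for the denominator are combined: the angular gap, counted in arcs of
  generation \<open>M\<close>, and the distance of the coarser box from the circle. The 64 is
  \<open>2 * 2\<close> from the two numerators times 16 from the square of the factor
  \<open>1 / 4\<close> lost in combining.\<close>

lemma dyadic_box_kernel:
  assumes z: "z \<in> dyadic_box n k" "k < 2 ^ n" and w: "w \<in> dyadic_box m j" "j < 2 ^ m"
  shows "(1 - (cmod z)\<^sup>2) * (1 - (cmod w)\<^sup>2) / (cmod (1 - z * cnj w))\<^sup>2 \<le> 64 * box_kernel (n, k) (m, j)"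
proof -
  obtain r t where z': "z = of_real r * cis t" "1 / 2 ^ (n + 1) < 1 - r" "1 - r \<le> 1 / 2 ^ n"
    "real k / 2 ^ n \<le> t / (2 * pi)" "t / (2 * pi) < real (k + 1) / 2 ^ n"
    using z(1) unfolding dyadic_box_def by blast
  obtain s v where w': "w = of_real s * cis v" "1 / 2 ^ (m + 1) < 1 - s" "1 - s \<le> 1 / 2 ^ m"
    "real j / 2 ^ m \<le> v / (2 * pi)" "v / (2 * pi) < real (j + 1) / 2 ^ m"
    using w(1) unfolding dyadic_box_def by blast
  have "(1::real) / 2 ^ n \<le> 1" "(1::real) / 2 ^ m \<le> 1" by auto
  moreover have "(0::real) < 1 / 2 ^ (n + 1)" "(0::real) < 1 / 2 ^ (m + 1)" by auto
  ultimately have rs: "0 \<le> r" "r < 1" "0 \<le> s" "s < 1" using z'(2,3) w'(2,3) by linarith+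
  define M where "M = min n m"
  define p q where "p = k div 2 ^ (n - M)" and "q = j div 2 ^ (m - M)"
  define c where "c = real (cyclic_dist (2 ^ M) p q)"
  define d where "d = cmod (1 - z * cnj w)"
  have c0: "0 \<le> c" by (simp add: c_def)
  have pM: "p < 2 ^ M" unfolding p_def using z(2) by (intro ancestor_index_less) (simp_all add: M_def)
  have qM: "q < 2 ^ M" unfolding q_def using w(2) by (intro ancestor_index_less) (simp_all add: M_def)
  have Mn: "M \<le> n" "M \<le> m" by (simp_all add: M_def)
  have Q: "(0::real) < 2 ^ M" "(2::real) ^ M = real (2 ^ M)" by simp_all
  note cl = cyclic_dist_le[OF dyadic_ancestor[OF Mn(1) z'(4,5)] dyadic_ancestor[OF Mn(2) w'(4,5)] Q,
      folded p_def q_def, OF pM qM]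
  have cd: "c - 1 \<le> 2 ^ M * min \<bar>t / (2 * pi) - v / (2 * pi)\<bar> (1 - \<bar>t / (2 * pi) - v / (2 * pi)\<bar>)"
    unfolding c_def by (rule cl(1))
  note x1 = cl(2)
  have zw: "z * cnj w = of_real (r * s) * cis (t - v)"
    unfolding z'(1) w'(1) by (simp add: cis_cnj cis_mult mult_ac)
  have rs1: "0 \<le> r * s" "r * s \<le> 1" using rs by (auto simp: mult_le_one)
  have "min \<bar>t / (2 * pi) - v / (2 * pi)\<bar> (1 - \<bar>t / (2 * pi) - v / (2 * pi)\<bar>) \<le> \<bar>sin (pi * (t / (2 * pi) - v / (2 * pi)))\<bar>"
    by (rule abs_sin_pi_ge[OF x1])
  also have "pi * (t / (2 * pi) - v / (2 * pi)) = (t - v) / 2" by (simp add: field_simps)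
  also have "\<bar>sin ((t - v) / 2)\<bar> \<le> d" unfolding d_def zw by (rule norm_one_minus_ge_sin[OF rs1])
  finally have d1: "c - 1 \<le> 2 ^ M * d"
    using cd by (meson mult_left_mono order.trans zero_le_numeral zero_le_power)
  have d2: "1 / 2 \<le> 2 ^ M * d"
  proof -
    have "1 - r * s \<le> d"
      unfolding d_def zw using norm_triangle_ineq2[of 1 "of_real (r * s) * cis (t - v)"] rs1
      by (simp add: norm_mult)
    moreover have "r * s \<le> r" "r * s \<le> s" using rs by (auto simp: mult_left_le mult_left_le_one_le)
    ultimately have "1 - r \<le> d" "1 - s \<le> d" by linarith+
    then have "1 / 2 ^ (M + 1) \<le> d" using z'(2) w'(2) by (cases "n \<le> m") (auto simp: M_def min_def)
    then show ?thesis by (simp add: field_simps)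
  qed
  \<comment> \<open>\<open>c\<close> is an integer: up to 1 the radial bound suffices, and from 2 on
    \<open>(1 + c) / 4 <= c - 1\<close>.\<close>
  have "(1 + c) / 4 \<le> 2 ^ M * d"
  proof (cases "c \<le> 1")
    case True
    then have "(1 + c) / 4 \<le> 1 / 2" by simp
    then show ?thesis using d2 by (rule order.trans)
  next
    case False
    then have "cyclic_dist (2 ^ M) p q \<ge> 2" unfolding c_def by simp
    then have "c \<ge> 2" by (simp add: c_def)
    then have "(1 + c) / 4 \<le> c - 1" by simp
    then show ?thesis using d1 by (rule order.trans)
  qed
  then have "((1 + c) / 4)\<^sup>2 \<le> (2 ^ M * d)\<^sup>2" using c0 by (intro power_mono) auto
  moreover have "((2::real) ^ M)\<^sup>2 = 4 ^ M" by (simp add: power2_eq_square flip: power_mult_distrib)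
  ultimately have d3: "(1 + c)\<^sup>2 \<le> 16 * 4 ^ M * d\<^sup>2"
    by (simp add: power_mult_distrib power_divide)
  have d0: "0 < d\<^sup>2" using d2 by (auto simp: zero_less_mult_iff)
  have c1: "0 < (1 + c)\<^sup>2" using c0 by auto
  have num: "(1 - (cmod z)\<^sup>2) * (1 - (cmod w)\<^sup>2) \<le> (2 / 2 ^ n) * (2 / 2 ^ m)"
  proof (rule mult_mono)
    have 1: "1 - r\<^sup>2 \<le> 2 / 2 ^ n" if "0 \<le> r" "r < 1" "1 - r \<le> 1 / 2 ^ n" for r :: real and n :: nat
    proof -
      have "1 - r\<^sup>2 = (1 - r) * (1 + r)" by (simp add: power2_eq_square algebra_simps)
      also have "\<dots> \<le> (1 / 2 ^ n) * 2" using that by (intro mult_mono) auto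
      finally show ?thesis by simp
    qed
    show "1 - (cmod z)\<^sup>2 \<le> 2 / 2 ^ n" "1 - (cmod w)\<^sup>2 \<le> 2 / 2 ^ m"
      using 1[of r n] 1[of s m] rs z'(3) w'(3) by (auto simp: z'(1) w'(1) norm_mult)
    show "0 \<le> 1 - (cmod w)\<^sup>2" using rs by (simp add: w'(1) norm_mult abs_square_le_1)
  qed auto
  have "(1 - (cmod z)\<^sup>2) * (1 - (cmod w)\<^sup>2) / d\<^sup>2 \<le> (2 / 2 ^ n) * (2 / 2 ^ m) / d\<^sup>2"
    using num d0 by (intro divide_right_mono) auto
  also have "\<dots> \<le> (2 / 2 ^ n) * (2 / 2 ^ m) * (16 * 4 ^ M / (1 + c)\<^sup>2)"
  proof -
    have "1 / d\<^sup>2 \<le> 16 * 4 ^ M / (1 + c)\<^sup>2" using d3 d0 c1 by (simp add: field_simps)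
    from mult_left_mono[OF this, of "(2 / 2 ^ n) * (2 / 2 ^ m)"] show ?thesis by simp
  qed
  also have "\<dots> = 64 * box_kernel (n, k) (m, j)"
    by (simp add: box_kernel_def Let_def M_def[symmetric] p_def[symmetric] q_def[symmetric] c_def[symmetric] power_add)
  finally show ?thesis by (simp add: d_def)
qed

text \<open>The kernel is bounded above and its norms are bounded below; the three powers combine to
  the quantity of \<open>dyadic_box_kernel\<close> raised to the power \<open>a\<close>.\<close>

lemma kernel_gram_bound:
  assumes a: "0 < a" "a < 1"
  shows "\<exists>C>0. \<forall>n k m j z w. k < 2 ^ n \<longrightarrow> j < 2 ^ m \<longrightarrow> z \<in> dyadic_box n k \<longrightarrow> w \<in> dyadic_box m j \<longrightarrow>
     cmod z < 1 \<longrightarrow> cmod w < 1 \<longrightarrow>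
     (cmod (ip (nev a w) (nev a z)))\<^sup>2 \<le> C * box_kernel (n, k) (m, j) powr a"
proof -
  obtain C where C: "C > 0" "\<And>z. cmod z < 1 \<Longrightarrow> cmod (kernel_fun a z) \<le> C * cmod (1 - z) powr (- a)"
    using kernel_fun_upper[OF a] by blast
  show ?thesis
  proof (intro exI conjI allI impI)
    show "C\<^sup>2 * 64 powr a > 0" using C by simp
    fix n k m j z w
    assume k: "k < 2 ^ n" and j: "j < 2 ^ m" and z: "z \<in> dyadic_box n k" and w: "w \<in> dyadic_box m j"
      and z1: "cmod z < 1" and w1: "cmod w < 1"
    define x where "x = 1 - (cmod z)\<^sup>2"
    define y where "y = 1 - (cmod w)\<^sup>2"
    define d where "d = cmod (1 - z * cnj w)"
    have xy: "0 < x" "0 < y" using z1 w1 by (auto simp: x_def y_def abs_square_less_1)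
    have zw: "cmod (z * cnj w) < 1" using z1 w1
      by (simp add: norm_mult) (metis mult_le_one mult_less_cancel_left2 less_eq_real_def norm_ge_zero mult_strict_mono mult.right_neutral less_le_not_le linorder_not_le zero_less_one)
    have d: "0 < d" using zw by (auto simp: d_def)
    have d2: "d powr (a * 2) = d\<^sup>2 powr a" using d by (simp add: powr_powr mult.commute flip: powr_numeral)
    note ez = ev_ell2[OF a z1] and ew = ev_ell2[OF a w1]
    have "ip (nev a w) (nev a z) = of_real (1 / sqrt (sqn (ev a w))) * kernel_fun a (z * cnj w) / of_real (sqrt (sqn (ev a z)))"
      using nev_props(2)[OF a z1 nev_props(1)[OF a w1]]
        ip_sum_left[of "{0::nat}" "\<lambda>_. ev a w" "ev a z" "\<lambda>_. of_real (1 / sqrt (sqn (ev a w)))"] ez ew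
      by (simp add: fun_of_def nev_def ip_ev_ev[OF a z1 w1])
    then have "(cmod (ip (nev a w) (nev a z)))\<^sup>2 = (cmod (kernel_fun a (z * cnj w)))\<^sup>2 / (sqn (ev a w) * sqn (ev a z))"
      using ez(4) ew(4) by (simp add: norm_mult norm_divide power_divide power_mult_distrib)
    also have "\<dots> \<le> (C * d powr (- a))\<^sup>2 / (y powr (- a) * x powr (- a))"
      using ez(3) ew(3) C(2)[OF zw] xy unfolding x_def y_def d_def
      by (intro frac_le power_mono mult_mono mult_pos_pos less_imp_le[OF ez(4)] less_imp_le[OF ew(4)]) auto
    also have "\<dots> = C\<^sup>2 * ((x * y / d\<^sup>2) powr a)"
      using d2 xy d by (simp add: powr_minus powr_mult powr_divide power_mult_distrib power_inverse powr_power field_simps)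
    also have "\<dots> \<le> C\<^sup>2 * ((64 * box_kernel (n, k) (m, j)) powr a)"
      using dyadic_box_kernel[OF z k w j] xy d a unfolding x_def y_def d_def
      by (intro mult_left_mono powr_mono2) auto
    also have "\<dots> = C\<^sup>2 * 64 powr a * box_kernel (n, k) (m, j) powr a"
      using box_kernel_pos[of "(n, k)" "(m, j)"] by (simp add: powr_mult)
    finally show "(cmod (ip (nev a w) (nev a z)))\<^sup>2 \<le> C\<^sup>2 * 64 powr a * box_kernel (n, k) (m, j) powr a" .
  qed
qed

lemma sum_inj_le_suminf:
  fixes g :: "nat \<Rightarrow> real"
  assumes "summable g" "\<And>i. 0 \<le> g i" "finite F" "inj_on h F"
  shows "(\<Sum>q\<in>F. g (h q)) \<le> suminf g"
  using sum_le_suminf[OF assms(1), of "h ` F"] assms by (simp add: sum.reindex)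

text \<open>The minimum is replaced by both of its arguments; each is injective in \<open>q\<close>
  on either side of \<open>p\<close>, so four copies of the series suffice.\<close>

lemma sum_cyclic_dist_le:
  fixes g :: "nat \<Rightarrow> real"
  assumes g: "summable g" "\<And>i. 0 \<le> g i" and p: "p < Q"
  shows "(\<Sum>q<Q. g (cyclic_dist Q p q)) \<le> 4 * suminf g"
proof -
  define d where "d q = (p - q) + (q - p)" for q
  have "(\<Sum>q<Q. g (cyclic_dist Q p q)) \<le> (\<Sum>q<Q. g (d q) + g (Q - d q))"
    by (intro sum_mono) (auto simp: cyclic_dist_def d_def[symmetric] min_def g)
  also have "\<dots> = (\<Sum>q<Q. g (d q)) + (\<Sum>q<Q. g (Q - d q))" by (rule sum.distrib)
  also have "\<dots> = ((\<Sum>q<p. g (d q)) + (\<Sum>q\<in>{p..<Q}. g (d q))) + ((\<Sum>q<p. g (Q - d q)) + (\<Sum>q\<in>{p..<Q}. g (Q - d q)))"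
    using p by (simp add: lessThan_atLeast0 sum.atLeastLessThan_concat)
  also have "\<dots> \<le> (suminf g + suminf g) + (suminf g + suminf g)"
    using p by (intro add_mono sum_inj_le_suminf g) (auto simp: d_def inj_on_def)
  finally show ?thesis by simp
qed

lemma sum_div_block:
  fixes f :: "nat \<Rightarrow> real"
  assumes "0 < c"
  shows "(\<Sum>j<b * c. f (j div c)) = real c * (\<Sum>q<b. f q)"
proof -
  have "(\<Sum>j<b * c. f (j div c)) = (\<Sum>q<b. \<Sum>j\<in>{q * c..<q * c + c}. f (j div c))"
    by (rule sum.nat_group[symmetric])
  also have "\<dots> = (\<Sum>q<b. \<Sum>j\<in>{q * c..<q * c + c}. f q)"
  proof (intro sum.cong refl)
    fix q j assume "j \<in> {q * c..<q * c + c}"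
    then have "j div c = q" by (intro div_nat_eqI) (auto simp: algebra_simps)
    then show "f (j div c) = f q" by simp
  qed
  also have "\<dots> = real c * (\<Sum>q<b. f q)" by (simp add: sum_distrib_left)
  finally show ?thesis .
qed

text \<open>Let \<open>e = |n - m|\<close>. The kernel contributes
  \<open>2 powr (- beta * e)\<close>; the weight and the number \<open>2 ^ (m - M)\<close> of
  descendants together contribute \<open>2 powr (e / 2)\<close>, whichever generation is finer. The
  sum over positions converges because \<open>2 * beta > 1\<close>.\<close>

lemma box_kernel_level_sum:
  assumes beta: "1 / 2 < beta" and k: "k < 2 ^ n"
  defines "Z \<equiv> 4 * (\<Sum>i. (1 + real i) powr (- (2 * beta)))"
  shows "(\<Sum>j<2 ^ m. box_kernel (n, k) (m, j) powr beta * 2 powr ((real n - real m) / 2))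
     \<le> Z * (2 powr (1 / 2 - beta)) ^ ((n - m) + (m - n))"
proof -
  define M where "M = min n m"
  define p where "p = k div 2 ^ (n - M)"
  define g where "g i = (1 + real i) powr (- (2 * beta))" for i :: nat
  have gs: "summable g"
  proof -
    have "summable (\<lambda>i. real (Suc i) powr (- (2 * beta)))"
      using summable_Suc_iff[of "\<lambda>i. real i powr (- (2 * beta))"] summable_real_powr_iff[of "- (2 * beta)"] beta by simp
    then show ?thesis by (simp add: g_def[abs_def] add.commute)
  qed
  have pM: "p < 2 ^ M" unfolding p_def using k by (intro ancestor_index_less) (simp_all add: M_def)
  define e where "e = (n - m) + (m - n)"
  have eM: "real (n + m) - 2 * real M = real e" by (auto simp: e_def M_def min_def)
  have bk: "box_kernel (n, k) (m, j) powr beta = 2 powr (- (beta * real e)) * g (cyclic_dist (2 ^ M) p (j div 2 ^ (m - M)))" for j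
  proof -
    define c where "c = 1 + real (cyclic_dist (2 ^ M) p (j div 2 ^ (m - M)))"
    have c: "c > 0" by (simp add: c_def add_pos_nonneg)
    have "box_kernel (n, k) (m, j) = 4 ^ M / (2 ^ (n + m) * c\<^sup>2)"
      by (simp add: box_kernel_def Let_def M_def[symmetric] p_def[symmetric] c_def)
    also have "\<dots> = 2 powr (- real e) * c powr (- 2)"
    proof -
      have "(4::real) ^ M = 2 powr (2 * real M)"
        by (simp add: powr_realpow[symmetric] powr_powr[symmetric])
      moreover have "(2::real) ^ (n + m) = 2 powr real (n + m)" by (rule powr_realpow[symmetric]) simp
      moreover have "c\<^sup>2 = c powr 2" using c by simp
      ultimately have "4 ^ M / (2 ^ (n + m) * c\<^sup>2) = 2 powr (2 * real M - real (n + m)) * c powr (- 2)"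
        by (simp only: powr_diff powr_minus) (simp add: field_simps)
      then show ?thesis using eM by (simp add: algebra_simps)
    qed
    finally show ?thesis using c
      by (simp add: powr_mult powr_powr g_def c_def[symmetric] mult_ac)
  qed
  have "(\<Sum>j<2 ^ m. box_kernel (n, k) (m, j) powr beta * 2 powr ((real n - real m) / 2))
     = 2 powr (- (beta * real e)) * 2 powr ((real n - real m) / 2) * (\<Sum>j<2 ^ M * 2 ^ (m - M). g (cyclic_dist (2 ^ M) p (j div 2 ^ (m - M))))"
  proof -
    have "(2::nat) ^ m = 2 ^ M * 2 ^ (m - M)" by (simp add: M_def power_add[symmetric])
    then show ?thesis unfolding bk sum_distrib_left by (simp add: mult_ac)
  qed
  also have "(\<Sum>j<2 ^ M * 2 ^ (m - M). g (cyclic_dist (2 ^ M) p (j div 2 ^ (m - M)))) = 2 ^ (m - M) * (\<Sum>q<2 ^ M. g (cyclic_dist (2 ^ M) p q))"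
    using sum_div_block[of "2 ^ (m - M)" "\<lambda>q. g (cyclic_dist (2 ^ M) p q)" "2 ^ M"] by simp
  also have "2 powr (- (beta * real e)) * 2 powr ((real n - real m) / 2) * (2 ^ (m - M) * (\<Sum>q<2 ^ M. g (cyclic_dist (2 ^ M) p q)))
     \<le> 2 powr (- (beta * real e)) * 2 powr ((real n - real m) / 2) * (2 ^ (m - M) * Z)"
    unfolding Z_def g_def[symmetric] using pM
    by (intro mult_left_mono sum_cyclic_dist_le gs) (auto simp: g_def)
  also have "\<dots> = Z * (2 powr (1 / 2 - beta)) ^ e"
  proof -
    have "(2 powr (1 / 2 - beta)) ^ e = (2::real) powr ((1 / 2 - beta) * real e)"
      by (simp add: powr_powr powr_realpow[symmetric])
    moreover have "(2::real) ^ (m - M) = 2 powr real (m - M)" by (rule powr_realpow[symmetric]) simp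
    moreover have "- (beta * real e) + (real n - real m) / 2 + real (m - M) = (1 / 2 - beta) * real e"
      by (auto simp: e_def M_def min_def field_simps)
    ultimately show ?thesis by (simp only: mult_ac powr_add[symmetric] mult.assoc[symmetric]) (simp add: powr_add[symmetric] mult_ac add_ac)
  qed
  finally show ?thesis by (simp add: e_def)
qed

section \<open>Schur's test over dyadic boxes\<close>

text \<open>One half-open shape serves for the dyadic boxes and for the cells into which they are
  cut.\<close>

definition polar_rect :: "real \<Rightarrow> real \<Rightarrow> real \<Rightarrow> real \<Rightarrow> complex set" where
  "polar_rect r0 r1 t0 t1 = (\<lambda>p. of_real (fst p) * cis (snd p)) ` ({r0..<r1} \<times> {t0..<t1})"

lemma dyadic_box_polar_rect:
  "dyadic_box n k = polar_rect (1 - 1 / 2 ^ n) (1 - 1 / 2 ^ (n + 1)) (2 * pi * (real k / 2 ^ n)) (2 * pi * (real (k + 1) / 2 ^ n))"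
proof -
  have r: "1 / 2 ^ (n + 1) < 1 - r \<and> 1 - r \<le> 1 / 2 ^ n \<longleftrightarrow> r \<in> {1 - 1 / 2 ^ n..<1 - 1 / 2 ^ (n + 1)}" for r :: real
    by auto
  have t: "real k / 2 ^ n \<le> t / (2 * pi) \<and> t / (2 * pi) < real (k + 1) / 2 ^ n \<longleftrightarrow>
      t \<in> {2 * pi * (real k / 2 ^ n)..<2 * pi * (real (k + 1) / 2 ^ n)}" for t
    by (simp add: pos_le_divide_eq pos_divide_less_eq mult.commute)
  show ?thesis
    unfolding dyadic_box_def polar_rect_def conj_assoc[symmetric]
    unfolding conj_assoc t unfolding conj_assoc[symmetric] unfolding conj_assoc[of _ _ "_ \<le> _"] r
    by force
qed

text \<open>A half-open rectangle is a countable union of compact ones, and continuous images of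
  compact sets are compact; injectivity of the polar map does not enter.\<close>

lemma polar_rect_borel: "polar_rect r0 r1 t0 t1 \<in> sets borel"
proof -
  have I: "{x0..<x1} = (\<Union>i::nat. {x0..x1 - 1 / real (Suc i)})" for x0 x1 :: real
  proof (intro equalityI subsetI)
    fix x assume x: "x \<in> {x0..<x1}"
    then obtain i :: nat where "inverse (of_nat (Suc i)) < x1 - x" using reals_Archimedean[of "x1 - x"] by auto
    then have "x \<le> x1 - 1 / real (Suc i)" by (simp add: inverse_eq_divide del: of_nat_Suc)
    then show "x \<in> (\<Union>i::nat. {x0..x1 - 1 / real (Suc i)})" using x by auto
  next
    fix x assume "x \<in> (\<Union>i::nat. {x0..x1 - 1 / real (Suc i)})"
    then obtain i :: nat where i: "x0 \<le> x" "x \<le> x1 - 1 / real (Suc i)" by auto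
    have "0 < 1 / real (Suc i)" by simp
    with i have "x < x1" by linarith
    then show "x \<in> {x0..<x1}" using i by simp
  qed
  define P where "P = (\<lambda>p::real \<times> real. complex_of_real (fst p) * cis (snd p))"
  have "polar_rect r0 r1 t0 t1 = (\<Union>i. \<Union>j. P ` ({r0..r1 - 1 / real (Suc i)} \<times> {t0..t1 - 1 / real (Suc j)}))"
    unfolding polar_rect_def P_def[symmetric] I by blast
  also have "\<dots> \<in> sets borel"
  proof -
    have "P ` ({r0..r1 - 1 / real (Suc i)} \<times> {t0..t1 - 1 / real (Suc j)}) \<in> sets borel" for i j
      unfolding P_def
      by (intro borel_closed compact_imp_closed compact_continuous_image compact_Times continuous_intros) auto
    then show ?thesis by (intro sets.countable_UN) auto
  qed
  finally show ?thesis .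
qed

lemma dyadic_box_borel: "dyadic_box n k \<in> sets borel"
  unfolding dyadic_box_polar_rect by (rule polar_rect_borel)

text \<open>The definition does not say that \<open>r\<close> is nonnegative, but
  \<open>1 - r <= 1 / 2 ^ n <= 1\<close> forces it, so \<open>r\<close> is the modulus.\<close>

lemma dyadic_box_norm:
  assumes "z \<in> dyadic_box n k"
  shows "1 / 2 ^ (n + 1) < 1 - cmod z" "1 - cmod z \<le> 1 / 2 ^ n" "cmod z < 1"
proof -
  obtain r t where z: "z = of_real r * cis t" "1 / 2 ^ (n + 1) < 1 - r" "1 - r \<le> 1 / 2 ^ n"
    using assms unfolding dyadic_box_def by blast
  have "(1::real) / 2 ^ n \<le> 1" by simp
  then have "0 \<le> r" using z(3) by linarith
  then have "cmod z = r" unfolding z(1) by (simp add: norm_mult)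
  moreover have "(0::real) < 1 / 2 ^ (n + 1)" by simp
  ultimately show "1 / 2 ^ (n + 1) < 1 - cmod z" "1 - cmod z \<le> 1 / 2 ^ n" "cmod z < 1" using z by linarith+
qed

lemma dyadic_box_subset: "dyadic_box n k \<subseteq> unit_disk"
proof
  fix z assume "z \<in> dyadic_box n k"
  from dyadic_box_norm(3)[OF this] show "z \<in> unit_disk" by simp
qed

lemma dyadic_box_cover:
  assumes "cmod z < 1"
  shows "\<exists>n k. k < 2 ^ n \<and> z \<in> dyadic_box n k"
proof -
  define r where "r = cmod z"
  have r: "0 \<le> r" "r < 1" using assms by (auto simp: r_def)
  obtain N where N: "(1/2::real) ^ N < 1 - r" using real_arch_pow_inv[of "1 - r" "1/2"] r by auto
  define n where "n = (LEAST n. (1/2::real) ^ (n + 1) < 1 - r)"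
  have "(1/2::real) ^ (N + 1) < 1 - r" using N by (rule order.strict_trans1[rotated]) (simp add: power_decreasing)
  then have n1: "(1/2::real) ^ (n + 1) < 1 - r" unfolding n_def by (rule LeastI)
  have n2: "1 - r \<le> (1/2::real) ^ n"
  proof (cases n)
    case 0 then show ?thesis using r by simp
  next
    case (Suc m)
    then have "m < (LEAST n. (1/2::real) ^ (n + 1) < 1 - r)" by (simp add: n_def)
    from not_less_Least[OF this] show ?thesis using Suc by simp
  qed
  define t where "t = Arg2pi z"
  have t: "0 \<le> t" "t < 2 * pi" "z = of_real r * cis t"
    using Arg2pi[of z] by (auto simp: t_def r_def cis_conv_exp is_Arg_def)
  define x where "x = t / (2 * pi)"
  have x: "0 \<le> x" "x < 1" using t by (auto simp: x_def)
  define k where "k = nat \<lfloor>x * 2 ^ n\<rfloor>"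
  have k: "real k \<le> x * 2 ^ n" "x * 2 ^ n < real k + 1" using x by (auto simp: k_def)
  have "x * 2 ^ n < 1 * 2 ^ n" using x by (intro mult_strict_right_mono) auto
  then have "real k < 2 ^ n" using k(1) by linarith
  then have "k < 2 ^ n" by simp
  moreover have "z \<in> dyadic_box n k"
    unfolding dyadic_box_def mem_Collect_eq x_def[symmetric]
  proof (intro exI conjI)
    show "z = of_real r * cis t" by (rule t(3))
    show "1 / 2 ^ (n + 1) < 1 - r" "1 - r \<le> 1 / 2 ^ n" using n1 n2 by (simp_all add: power_one_over)
    show "real k / 2 ^ n \<le> t / (2 * pi)" "t / (2 * pi) < real (k + 1) / 2 ^ n"
      unfolding x_def[symmetric] using k by (simp_all add: pos_divide_le_eq pos_less_divide_eq add.commute)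
  qed
  ultimately show ?thesis by blast
qed

text \<open>The modulus determines the generation; the normalized argument \<open>Arg2pi\<close>
  then determines the index.\<close>

lemma dyadic_box_unique:
  assumes z: "z \<in> dyadic_box n k" "k < 2 ^ n" and w: "z \<in> dyadic_box m j" "j < 2 ^ m"
  shows "n = m \<and> k = j"
proof -
  have aux: False if "n < m" "z \<in> dyadic_box n k" "z \<in> dyadic_box m j" for n m k j
  proof -
    have "(1::real) / 2 ^ m \<le> 1 / 2 ^ (n + 1)" using that(1) by (intro divide_left_mono power_increasing) auto
    then show False using dyadic_box_norm(1)[OF that(2)] dyadic_box_norm(2)[OF that(3)] by linarith
  qed
  have nm: "n = m" using aux[of n m k j] aux[of m n j k] z w by (metis linorder_neqE_nat)
  obtain r t where z': "z = of_real r * cis t" "1 - r \<le> 1 / 2 ^ n"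
    "real k / 2 ^ n \<le> t / (2 * pi)" "t / (2 * pi) < real (k + 1) / 2 ^ n"
    using z(1) unfolding dyadic_box_def by blast
  obtain s v where w': "z = of_real s * cis v" "1 - s \<le> 1 / 2 ^ n"
    "real j / 2 ^ n \<le> v / (2 * pi)" "v / (2 * pi) < real (j + 1) / 2 ^ n"
    using w(1) unfolding dyadic_box_def nm by blast
  have "(1::real) / 2 ^ n \<le> 1" by simp
  then have rs: "0 \<le> r" "0 \<le> s" using z'(2) w'(2) by linarith+
  have "k = j"
  \<comment> \<open>At the origin the angle is arbitrary, but the origin belongs to generation 0,
    which has a single index.\<close>
  proof (cases "cmod z = 0")
    case True
    have "n = 0"
    proof (rule ccontr)
      assume "n \<noteq> 0"
      then have "(1::real) / 2 ^ n < 1" by (simp add: one_less_power)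
      then show False using dyadic_box_norm(2)[OF z(1)] True by simp
    qed
    then show ?thesis using z(2) w(2) nm by simp
  next
    case False
    then have r0: "0 < r" "0 < s" 
    proof -
      have "r \<noteq> 0" using False z'(1) by auto
      moreover have "s \<noteq> 0" using False w'(1) by auto
      ultimately show "0 < r" "0 < s" using rs by auto
    qed
    have range: "0 \<le> t \<and> t < 2 * pi" if "k < 2 ^ n" "real k / 2 ^ n \<le> t / (2 * pi)" "t / (2 * pi) < real (k + 1) / 2 ^ n" for t k
    proof -
      have "0 \<le> real k / 2 ^ n" by simp
      then have "0 \<le> t / (2 * pi)" using that by linarith
      moreover have "real (k + 1) / 2 ^ n \<le> 1"
      proof -
        have "k + 1 \<le> 2 ^ n" using that by simp
        then have "real (k + 1) \<le> real (2 ^ n)" by (simp only: of_nat_le_iff)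
        then show ?thesis by (simp add: divide_le_eq)
      qed
      then have "t / (2 * pi) < 1" using that by linarith
      ultimately show ?thesis by (simp add: zero_le_divide_iff divide_less_eq) (metis pi_gt_zero not_less)
    qed
    have "Arg2pi z = t" by (rule Arg2pi_unique[of r]) (use z' r0 range[OF z(2) z'(3,4)] in \<open>auto simp: cis_conv_exp\<close>)
    moreover have "Arg2pi z = v"
      by (rule Arg2pi_unique[of s]) (use w' r0 range[OF _ w'(3,4)] w(2) nm in \<open>auto simp: cis_conv_exp\<close>)
    ultimately have "t = v" by simp
    then have "real k / 2 ^ n < real (j + 1) / 2 ^ n" "real j / 2 ^ n < real (k + 1) / 2 ^ n"
      using z'(3,4) w'(3,4) by (metis order.strict_trans1)+
    then have "real k < real (j + 1)" "real j < real (k + 1)" by (simp_all add: divide_less_cancel)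
    then show ?thesis by linarith
  qed
  with nm show ?thesis by simp
qed

text \<open>Pairs of generation and position. Sums over this set are written as integrals for
  counting measure, so that Tonelli exchanges them with expectations.\<close>

definition box_index :: "(nat \<times> nat) set" where
  "box_index = {b. snd b < 2 ^ fst b}"

definition dbox :: "nat \<times> nat \<Rightarrow> complex set" where
  "dbox b = dyadic_box (fst b) (snd b)"

lemma dbox_borel: "dbox b \<in> sets borel"
  unfolding dbox_def by (rule dyadic_box_borel)

lemma dbox_subset: "dbox b \<subseteq> unit_disk"
  unfolding dbox_def by (rule dyadic_box_subset)

lemma dbox_unique:
  assumes "z \<in> dbox a" "z \<in> dbox b" "a \<in> box_index" "b \<in> box_index"
  shows "a = b"
proof -
  have "fst a = fst b \<and> snd a = snd b"
    by (rule dyadic_box_unique[of z]) (use assms in \<open>simp_all add: dbox_def box_index_def\<close>)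
  then show ?thesis by (simp add: prod_eq_iff)
qed

lemma dbox_cover:
  assumes "cmod z < 1" shows "\<exists>b\<in>box_index. z \<in> dbox b"
proof -
  obtain n k where "k < 2 ^ n" "z \<in> dyadic_box n k" using dyadic_box_cover[OF assms] by blast
  then show ?thesis by (intro bexI[of _ "(n, k)"]) (simp_all add: dbox_def box_index_def)
qed

lemma nn_integral_box_index:
  "(\<integral>\<^sup>+b. f b * indicator box_index b \<partial>count_space UNIV) = (\<Sum>n. \<Sum>k<2 ^ n. f (n, k))"
proof -
  have "(\<integral>\<^sup>+b. f b * indicator box_index b \<partial>count_space UNIV)
     = (\<integral>\<^sup>+n. \<integral>\<^sup>+k. f (n, k) * indicator box_index (n, k) \<partial>count_space UNIV \<partial>count_space UNIV)"
    using nn_integral_fst_count_space[of "\<lambda>b. f b * indicator box_index b"] by simp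
  also have "\<dots> = (\<Sum>n. \<integral>\<^sup>+k. f (n, k) * indicator box_index (n, k) \<partial>count_space UNIV)"
    by (rule nn_integral_count_space_nat)
  also have "\<dots> = (\<Sum>n. \<Sum>k<2 ^ n. f (n, k))"
  proof (rule suminf_cong)
    fix n :: nat
    have "(\<integral>\<^sup>+k. f (n, k) * indicator box_index (n, k) \<partial>count_space UNIV)
       = (\<Sum>k<2 ^ n. f (n, k) * indicator box_index (n, k))"
      by (rule nn_integral_count_space') (auto simp: box_index_def)
    then show "(\<integral>\<^sup>+k. f (n, k) * indicator box_index (n, k) \<partial>count_space UNIV) = (\<Sum>k<2 ^ n. f (n, k))"
      by (simp add: box_index_def)
  qed
  finally show ?thesis .
qed

section \<open>Schur's test for the box kernel\<close>

lemma nn_integral_count_space_swap: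
  fixes f :: "'a \<Rightarrow> 'b \<Rightarrow> ennreal"
  shows "(\<integral>\<^sup>+a. \<integral>\<^sup>+b. f a b \<partial>count_space UNIV \<partial>count_space UNIV) = (\<integral>\<^sup>+b. \<integral>\<^sup>+a. f a b \<partial>count_space UNIV \<partial>count_space UNIV)"
  using nn_integral_fst_count_space[of "\<lambda>p. f (fst p) (snd p)"] nn_integral_snd_count_space[of "\<lambda>p. f (fst p) (snd p)"]
  by simp

lemma sum_geometric_abs_le:
  fixes x :: real
  assumes "0 \<le> x" "x < 1"
  shows "(\<Sum>m<L. x ^ ((n - m) + (m - n))) \<le> 2 / (1 - x)"
proof -
  have geo: "summable (\<lambda>i. x ^ i)" "(\<Sum>i. x ^ i) = 1 / (1 - x)"
    using assms by (auto simp: summable_geometric suminf_geometric)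
  have inj: "(\<Sum>m\<in>F. x ^ h m) \<le> 1 / (1 - x)" if "finite F" "inj_on h F" for F and h :: "nat \<Rightarrow> nat"
    using sum_inj_le_suminf[of "\<lambda>i. x ^ i" F h] geo that assms by simp
  have "(\<Sum>m<L. x ^ ((n - m) + (m - n))) = (\<Sum>m\<in>{..<L} \<inter> {..<n}. x ^ ((n - m) + (m - n))) + (\<Sum>m\<in>{..<L} - {..<n}. x ^ ((n - m) + (m - n)))"
    by (subst sum.Int_Diff[of _ _ "{..<n}"]) auto
  also have "\<dots> \<le> 1 / (1 - x) + 1 / (1 - x)"
    by (intro add_mono inj) (auto simp: inj_on_def)
  finally show ?thesis by simp
qed

text \<open>The sums over single generations decay geometrically in \<open>|n - m|\<close>, with
  ratio \<open>2 powr (1 / 2 - beta) < 1\<close>; the two directions give the factor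
  \<open>2 / (1 - x)\<close>.\<close>

lemma box_kernel_schur:
  assumes beta: "1 / 2 < beta"
  shows "\<exists>C\<ge>0. \<forall>a\<in>box_index.
    (\<integral>\<^sup>+b. ennreal (box_kernel a b powr beta * 2 powr ((real (fst a) - real (fst b)) / 2)) * indicator box_index b \<partial>count_space UNIV)
      \<le> ennreal C"
proof -
  define Z where "Z = 4 * (\<Sum>i. (1 + real i) powr (- (2 * beta)))"
  define x where "x = 2 powr (1 / 2 - beta)"
  have x: "0 \<le> x" "x < 1" using beta powr_less_mono[of "1 / 2 - beta" 0 2] by (auto simp: x_def)
  have Z: "0 \<le> Z"
  proof -
    have "summable (\<lambda>i. real (Suc i) powr (- (2 * beta)))"
      using summable_Suc_iff[of "\<lambda>i. real i powr (- (2 * beta))"] summable_real_powr_iff[of "- (2 * beta)"] beta by simp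
    then have "summable (\<lambda>i. (1 + real i) powr (- (2 * beta)))" by (simp add: add.commute)
    then show ?thesis unfolding Z_def by (simp add: suminf_nonneg)
  qed
  show ?thesis
  proof (intro exI conjI ballI)
    show "0 \<le> Z * (2 / (1 - x))" using Z x by simp
    fix a assume a: "a \<in> box_index"
    obtain n k where nk: "a = (n, k)" "k < 2 ^ n" using a by (cases a) (auto simp: box_index_def)
    define e where "e m = (n - m) + (m - n)" for m
    have "(\<integral>\<^sup>+b. ennreal (box_kernel a b powr beta * 2 powr ((real (fst a) - real (fst b)) / 2)) * indicator box_index b \<partial>count_space UNIV)
       = (\<Sum>m. \<Sum>j<2 ^ m. ennreal (box_kernel a (m, j) powr beta * 2 powr ((real n - real m) / 2)))"
      by (subst nn_integral_box_index) (simp add: nk)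
    also have "\<dots> = (\<Sum>m. ennreal (\<Sum>j<2 ^ m. box_kernel a (m, j) powr beta * 2 powr ((real n - real m) / 2)))"
      by (intro suminf_cong sum_ennreal) auto
    also have "\<dots> \<le> (\<Sum>m. ennreal (Z * x ^ e m))"
      using box_kernel_level_sum[OF beta nk(2)] unfolding Z_def x_def e_def nk(1)
      by (intro suminf_le ennreal_leI) auto
    also have "\<dots> = (SUP L. \<Sum>m<L. ennreal (Z * x ^ e m))" by (rule suminf_eq_SUP)
    also have "\<dots> \<le> ennreal (Z * (2 / (1 - x)))"
    proof (rule SUP_least)
      fix L
      have "(\<Sum>m<L. ennreal (Z * x ^ e m)) = ennreal (Z * (\<Sum>m<L. x ^ e m))"
        using Z x by (subst sum_ennreal) (auto simp: sum_distrib_left)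
      also have "\<dots> \<le> ennreal (Z * (2 / (1 - x)))"
        using Z sum_geometric_abs_le[OF x] by (intro ennreal_leI mult_left_mono) (auto simp: e_def)
      finally show "(\<Sum>m<L. ennreal (Z * x ^ e m)) \<le> ennreal (Z * (2 / (1 - x)))" .
    qed
    finally show "(\<integral>\<^sup>+b. ennreal (box_kernel a b powr beta * 2 powr ((real (fst a) - real (fst b)) / 2)) * indicator box_index b \<partial>count_space UNIV)
      \<le> ennreal (Z * (2 / (1 - x)))" .
  qed
qed

text \<open>Schur's test with the weight \<open>2 powr (- n / 2)\<close> on the boxes of generation \<open>n\<close>.\<close>

lemma box_kernel_quadratic:
  fixes U :: "nat \<times> nat \<Rightarrow> real"
  assumes beta: "1 / 2 < beta" and U: "\<And>b. 0 \<le> U b"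
    and fin: "(\<integral>\<^sup>+b. ennreal ((U b)\<^sup>2) * indicator box_index b \<partial>count_space UNIV) < \<infinity>"
  shows "(\<integral>\<^sup>+a. \<integral>\<^sup>+b. ennreal (box_kernel a b powr beta * U a * U b) * (indicator box_index a * indicator box_index b)
     \<partial>count_space UNIV \<partial>count_space UNIV) < \<infinity>"
proof -
  obtain C where C: "0 \<le> C" "\<And>a. a \<in> box_index \<Longrightarrow>
    (\<integral>\<^sup>+b. ennreal (box_kernel a b powr beta * 2 powr ((real (fst a) - real (fst b)) / 2)) * indicator box_index b \<partial>count_space UNIV)
      \<le> ennreal C" using box_kernel_schur[OF beta] by blast
  define t where "t a b = 2 powr ((real (fst a) - real (fst b)) / 2)" for a b :: "nat \<times> nat"
  define g where "g a b = ennreal (box_kernel a b powr beta * (U a)\<^sup>2 * t a b) * (indicator box_index a * indicator box_index b)" for a b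
  have t: "0 < t a b" "t a b * t b a = 1" for a b
    by (simp_all add: t_def powr_add[symmetric] add_divide_distrib[symmetric])
  have le: "ennreal (box_kernel a b powr beta * U a * U b) * (indicator box_index a * indicator box_index b) \<le> g a b + g b a" for a b
  proof -
    \<comment> \<open>Splitting the product as \<open>(U a * s) * (U b / s)\<close> produces two
      weighted squares. As \<open>box_kernel\<close> is symmetric they are \<open>g a b\<close> and
      \<open>g b a\<close>, so the row estimate also handles the columns.\<close>
    define s where "s = sqrt (t a b)"
    have s: "0 < s" "s\<^sup>2 = t a b" using t(1)[of a b] by (auto simp: s_def)
    have tb: "t b a = 1 / s\<^sup>2" using t(2)[of a b] t(1)[of a b] s by (simp add: field_simps)
    have "U a * U b = (U a * s) * (U b / s)" using s by simp
    also have "\<dots> \<le> (U a * s)\<^sup>2 + (U b / s)\<^sup>2"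
    proof -
      have "0 \<le> (U a * s) * (U b / s)" using s U[of a] U[of b] by simp
      moreover have "2 * ((U a * s) * (U b / s)) \<le> (U a * s)\<^sup>2 + (U b / s)\<^sup>2"
        using sum_squares_bound[of "U a * s" "U b / s"] by (simp only: mult.assoc)
      moreover have "p \<le> q" if "0 \<le> p" "2 * p \<le> q" for p q :: real using that by linarith
      ultimately show ?thesis by blast
    qed
    also have "\<dots> = (U a)\<^sup>2 * t a b + (U b)\<^sup>2 * t b a" using s by (simp add: power_mult_distrib power_divide tb)
    finally have "box_kernel a b powr beta * (U a * U b) \<le> box_kernel a b powr beta * ((U a)\<^sup>2 * t a b + (U b)\<^sup>2 * t b a)"
      by (intro mult_left_mono) auto
    then have "ennreal (box_kernel a b powr beta * U a * U b) \<le>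
      ennreal (box_kernel a b powr beta * (U a)\<^sup>2 * t a b + box_kernel b a powr beta * (U b)\<^sup>2 * t b a)"
      by (intro ennreal_leI) (simp add: algebra_simps box_kernel_commute[of b a])
    also have "\<dots> = ennreal (box_kernel a b powr beta * (U a)\<^sup>2 * t a b) + ennreal (box_kernel b a powr beta * (U b)\<^sup>2 * t b a)"
      using t(1)[of a b] t(1)[of b a] by (intro ennreal_plus) auto
    finally show ?thesis
      unfolding g_def by (auto simp: indicator_def)
  qed
  have G: "(\<integral>\<^sup>+a. \<integral>\<^sup>+b. g a b \<partial>count_space UNIV \<partial>count_space UNIV) < \<infinity>"
  proof -
    have "(\<integral>\<^sup>+b. g a b \<partial>count_space UNIV) \<le> ennreal ((U a)\<^sup>2) * indicator box_index a * ennreal C" for a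
    proof (cases "a \<in> box_index")
      case True
      have "(\<integral>\<^sup>+b. g a b \<partial>count_space UNIV) = (\<integral>\<^sup>+b. ennreal ((U a)\<^sup>2) * (ennreal (box_kernel a b powr beta * t a b) * indicator box_index b) \<partial>count_space UNIV)"
      proof (rule nn_integral_cong)
        fix b
        have "ennreal (box_kernel a b powr beta * (U a)\<^sup>2 * t a b) = ennreal ((U a)\<^sup>2) * ennreal (box_kernel a b powr beta * t a b)"
          using t(1)[of a b] by (subst ennreal_mult[symmetric]) (auto simp: mult_ac)
        then show "g a b = ennreal ((U a)\<^sup>2) * (ennreal (box_kernel a b powr beta * t a b) * indicator box_index b)"
          using True by (simp add: g_def mult.assoc)
      qed
      also have "\<dots> = ennreal ((U a)\<^sup>2) * (\<integral>\<^sup>+b. (ennreal (box_kernel a b powr beta * t a b) * indicator box_index b) \<partial>count_space UNIV)"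
        by (rule nn_integral_cmult) simp
      also have "\<dots> \<le> ennreal ((U a)\<^sup>2) * ennreal C"
        using C(2)[OF True] unfolding t_def by (intro mult_left_mono) auto
      finally show ?thesis using True by simp
    qed (simp add: g_def)
    then have "(\<integral>\<^sup>+a. \<integral>\<^sup>+b. g a b \<partial>count_space UNIV \<partial>count_space UNIV) \<le> (\<integral>\<^sup>+a. ennreal ((U a)\<^sup>2) * indicator box_index a * ennreal C \<partial>count_space UNIV)"
      by (intro nn_integral_mono) auto
    also have "\<dots> = (\<integral>\<^sup>+a. ennreal ((U a)\<^sup>2) * indicator box_index a \<partial>count_space UNIV) * ennreal C"
      by (rule nn_integral_multc) simp
    also have "\<dots> < \<infinity>" using fin by (simp add: ennreal_mult_less_top)
    finally show ?thesis .
  qed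
  have "(\<integral>\<^sup>+a. \<integral>\<^sup>+b. ennreal (box_kernel a b powr beta * U a * U b) * (indicator box_index a * indicator box_index b)
     \<partial>count_space UNIV \<partial>count_space UNIV) \<le> (\<integral>\<^sup>+a. \<integral>\<^sup>+b. g a b + g b a \<partial>count_space UNIV \<partial>count_space UNIV)"
    by (intro nn_integral_mono le)
  also have "\<dots> = (\<integral>\<^sup>+a. \<integral>\<^sup>+b. g a b \<partial>count_space UNIV \<partial>count_space UNIV) + (\<integral>\<^sup>+a. \<integral>\<^sup>+b. g b a \<partial>count_space UNIV \<partial>count_space UNIV)"
    by (simp add: nn_integral_add)
  also have "(\<integral>\<^sup>+a. \<integral>\<^sup>+b. g b a \<partial>count_space UNIV \<partial>count_space UNIV) = (\<integral>\<^sup>+a. \<integral>\<^sup>+b. g a b \<partial>count_space UNIV \<partial>count_space UNIV)"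
    by (rule nn_integral_count_space_swap)
  finally show ?thesis using G by (simp add: order.strict_trans1)
qed

text \<open>The exponent \<open>beta > 1 / 2\<close> of the proof interpolates between the trivial bound and Schur's test:
  \<open>1 / gam = 1 - a / (2 * beta)\<close>.\<close>

lemma box_energy_finite:
  fixes m :: "nat \<times> nat \<Rightarrow> real"
  assumes gam: "1 < gam" "gam \<le> 2" "gam * (1 - a) < 1" and a: "0 < a" and m: "\<And>b. 0 \<le> m b"
    and fin: "(\<integral>\<^sup>+b. ennreal (m b powr gam) * indicator box_index b \<partial>count_space UNIV) < \<infinity>"
  shows "(\<integral>\<^sup>+x. \<integral>\<^sup>+y. ennreal (box_kernel x y powr a * m x * m y) * (indicator box_index x * indicator box_index y)
     \<partial>count_space UNIV \<partial>count_space UNIV) < \<infinity>"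
proof -
  \<comment> \<open>\<open>th\<close> is the interpolation weight: \<open>beta * th = a\<close>, and
    the exponents of the masses add up to 1. The condition \<open>gam * (1 - a) < 1\<close> amounts
    to \<open>beta > 1 / 2\<close>, and \<open>gam <= 2\<close> to \<open>th <= 1\<close>.\<close>
  define beta where "beta = a * gam / (2 * (gam - 1))"
  define th where "th = 2 * (gam - 1) / gam"
  have beta: "1 / 2 < beta" using gam unfolding beta_def by (simp add: field_simps)
  have th: "0 < th" "th \<le> 1" using gam by (auto simp: th_def)
  have bt: "beta * th = a" using gam by (simp add: beta_def th_def)
  define U where "U b = m b powr (gam / 2)" for b
  have U2: "(U b)\<^sup>2 = m b powr gam" for b
    using m[of b] by (cases "m b = 0") (auto simp: U_def power2_eq_square powr_add[symmetric])
  have le: "box_kernel x y powr a * m x * m y \<le> box_kernel x y powr beta * U x * U y + m x powr gam * m y powr gam" for x y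
  proof (cases "m x = 0 \<or> m y = 0")
    case False
    define p where "p = m x * m y"
    define k where "k = box_kernel x y"
    have pk: "0 < p" "0 < k" using False m[of x] m[of y] box_kernel_pos[of x y] by (auto simp: p_def k_def less_le)
    define X where "X = k powr beta * p powr (gam / 2)"
    define Y where "Y = p powr gam"
    have XY: "0 < X" "0 < Y" using pk by (auto simp: X_def Y_def)
    have exps: "gam / 2 * th + gam * (1 - th) = 1" using gam by (simp add: th_def field_simps)
    \<comment> \<open>The term is a weighted geometric mean of the Schur term \<open>X\<close> and
      the separated term \<open>Y\<close>, hence at most their maximum.\<close>
    have "k powr a * p = X powr th * Y powr (1 - th)"
    proof -
      have "X powr th * Y powr (1 - th) = k powr (beta * th) * p powr (gam / 2 * th + gam * (1 - th))"
        using pk by (simp add: X_def Y_def powr_mult powr_powr powr_add)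
      then show ?thesis unfolding bt exps using pk by simp
    qed
    also have "\<dots> \<le> max X Y powr th * max X Y powr (1 - th)"
      using XY th by (intro mult_mono powr_mono2) auto
    also have "\<dots> = max X Y" using XY by (simp add: powr_add[symmetric])
    also have "\<dots> \<le> X + Y" using XY by simp
    finally show ?thesis using m[of x] m[of y]
      by (simp add: X_def Y_def p_def k_def U_def powr_mult mult.assoc)
  qed (use m in \<open>auto simp: U_def\<close>)
  have sep: "(\<integral>\<^sup>+x. \<integral>\<^sup>+y. ennreal (m x powr gam * m y powr gam) * (indicator box_index x * indicator box_index y)
     \<partial>count_space UNIV \<partial>count_space UNIV) < \<infinity>"
  proof -
    define S where "S = (\<integral>\<^sup>+b. ennreal (m b powr gam) * indicator box_index b \<partial>count_space UNIV)"
    have "(\<integral>\<^sup>+x. \<integral>\<^sup>+y. ennreal (m x powr gam * m y powr gam) * (indicator box_index x * indicator box_index y)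
     \<partial>count_space UNIV \<partial>count_space UNIV)
      = (\<integral>\<^sup>+x. (ennreal (m x powr gam) * indicator box_index x) * S \<partial>count_space UNIV)"
      unfolding S_def
      by (subst nn_integral_cmult[symmetric]) (auto intro!: nn_integral_cong simp: ennreal_mult mult_ac)
    also have "\<dots> = S * S" unfolding S_def by (rule nn_integral_multc) simp
    finally show ?thesis using fin by (simp add: S_def ennreal_mult_less_top)
  qed
  have quad: "(\<integral>\<^sup>+x. \<integral>\<^sup>+y. ennreal (box_kernel x y powr beta * U x * U y) * (indicator box_index x * indicator box_index y)
     \<partial>count_space UNIV \<partial>count_space UNIV) < \<infinity>"
    by (rule box_kernel_quadratic[OF beta]) (use fin U2 in \<open>auto simp: U_def\<close>)
  have "(\<integral>\<^sup>+x. \<integral>\<^sup>+y. ennreal (box_kernel x y powr a * m x * m y) * (indicator box_index x * indicator box_index y)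
     \<partial>count_space UNIV \<partial>count_space UNIV)
    \<le> (\<integral>\<^sup>+x. \<integral>\<^sup>+y. ennreal (box_kernel x y powr beta * U x * U y) * (indicator box_index x * indicator box_index y)
       + ennreal (m x powr gam * m y powr gam) * (indicator box_index x * indicator box_index y)
     \<partial>count_space UNIV \<partial>count_space UNIV)"
  proof (intro nn_integral_mono)
    fix x y
    have "ennreal (box_kernel x y powr a * m x * m y) \<le> ennreal (box_kernel x y powr beta * U x * U y) + ennreal (m x powr gam * m y powr gam)"
    proof -
      have "ennreal (box_kernel x y powr a * m x * m y) \<le> ennreal (box_kernel x y powr beta * U x * U y + m x powr gam * m y powr gam)"
        by (rule ennreal_leI[OF le])
      also have "\<dots> = ennreal (box_kernel x y powr beta * U x * U y) + ennreal (m x powr gam * m y powr gam)"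
        by (intro ennreal_plus) (auto simp: U_def)
      finally show ?thesis .
    qed
    then show "ennreal (box_kernel x y powr a * m x * m y) * (indicator box_index x * indicator box_index y) \<le>
       ennreal (box_kernel x y powr beta * U x * U y) * (indicator box_index x * indicator box_index y)
       + ennreal (m x powr gam * m y powr gam) * (indicator box_index x * indicator box_index y)"
      by (auto simp: indicator_def)
  qed
  also have "\<dots> < \<infinity>" using quad sep by (simp add: nn_integral_add)
  finally show ?thesis .
qed

section \<open>Poisson counts and almost sure interpolation\<close>

definition poisson_weight :: "real \<Rightarrow> nat \<Rightarrow> real" where
  "poisson_weight x j = x ^ j / fact j * exp (- x)"

lemma poisson_weight_nonneg: "0 \<le> x \<Longrightarrow> 0 \<le> poisson_weight x j"
  by (simp add: poisson_weight_def)

lemma poisson_weight_sums: "poisson_weight x sums 1"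
proof -
  have "(\<lambda>j. x ^ j /\<^sub>R fact j) sums exp x" by (rule exp_converges)
  from sums_mult2[OF this, of "exp (- x)"]
  have "(\<lambda>j. x ^ j / fact j * exp (- x)) sums (exp x * exp (- x))"
    by (simp add: divide_inverse mult.commute)
  then show ?thesis by (simp add: poisson_weight_def[abs_def] exp_minus)
qed

lemma poisson_weight_Suc: "real (Suc j) * poisson_weight x (Suc j) = x * poisson_weight x j"
  by (simp add: poisson_weight_def divide_simps del: of_nat_Suc)

lemma poisson_weight_mean: "(\<lambda>j. real j * poisson_weight x j) sums x"
proof -
  have "(\<lambda>j. real (Suc j) * poisson_weight x (Suc j)) sums (x * 1)"
    unfolding poisson_weight_Suc by (intro sums_mult poisson_weight_sums)
  then show ?thesis by (subst (asm) sums_Suc_iff) simp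
qed

lemma poisson_weight_factorial_moment: "(\<lambda>j. real j * (real j - 1) * poisson_weight x j) sums x\<^sup>2"
proof -
  have e: "real (Suc j) * (real (Suc j) - 1) * poisson_weight x (Suc j) = x * (real j * poisson_weight x j)" for j
    using poisson_weight_Suc[of j x] by (simp add: mult_ac del: of_nat_Suc) (simp add: algebra_simps)
  have "(\<lambda>j. real (Suc j) * (real (Suc j) - 1) * poisson_weight x (Suc j)) sums (x * x)"
    unfolding e by (intro sums_mult poisson_weight_mean)
  then show ?thesis by (subst (asm) sums_Suc_iff) (simp add: power2_eq_square)
qed

context
  fixes M :: "'w measure" and N :: "'w \<Rightarrow> ennreal" and x :: real
  assumes M: "prob_space M" and x: "0 \<le> x" and N: "poisson_distributed M N (ennreal x)"
begin

lemma poisson_measurable: "N \<in> borel_measurable M"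
  using N by (simp add: poisson_distributed_def)

lemma poisson_prob: "measure M {\<omega> \<in> space M. N \<omega> = of_nat j} = poisson_weight x j"
  using N x by (simp add: poisson_distributed_def poisson_weight_def)

lemma poisson_event: "{\<omega> \<in> space M. N \<omega> = of_nat j} \<in> sets M"
proof -
  have "{\<omega> \<in> space M. N \<omega> = of_nat j} = N -` {of_nat j} \<inter> space M" by auto
  then show ?thesis using measurable_sets[OF poisson_measurable, of "{of_nat j}"] by simp
qed

text \<open>Counts are \<open>ennreal\<close> valued; since the weights of the natural numbers
  already sum to 1, all other values form a null event.\<close>

lemma poisson_AE_nat: "AE \<omega> in M. \<exists>j::nat. N \<omega> = of_nat j"
proof -
  interpret prob_space M by (rule M)
  define A where "A j = {\<omega> \<in> space M. N \<omega> = of_nat j}" for j :: nat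
  have A: "A j \<in> sets M" for j unfolding A_def by (rule poisson_event)
  have "disjoint_family A" by (auto simp: disjoint_family_on_def A_def)
  then have "(\<lambda>j. measure M (A j)) sums measure M (\<Union>j. A j)"
    using A by (intro finite_measure_UNION) auto
  moreover have "(\<lambda>j. measure M (A j)) sums 1"
    using poisson_weight_sums[of x] by (simp add: A_def poisson_prob)
  ultimately have "prob (\<Union>j. A j) = 1" by (rule sums_unique2)
  moreover have "(\<Union>j. A j) \<in> events" using A by auto
  ultimately have "AE \<omega> in M. \<omega> \<in> (\<Union>j. A j)" by (simp add: prob_eq_1)
  then show ?thesis by eventually_elim (auto simp: A_def)
qed

lemma poisson_nn_integral:
  "(\<integral>\<^sup>+\<omega>. g (N \<omega>) \<partial>M) = (\<Sum>j. g (of_nat j) * ennreal (poisson_weight x j))"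
proof -
  interpret prob_space M by (rule M)
  define A where "A j = {\<omega> \<in> space M. N \<omega> = of_nat j}" for j :: nat
  have A: "A j \<in> sets M" for j unfolding A_def by (rule poisson_event)
  have "(\<integral>\<^sup>+\<omega>. g (N \<omega>) \<partial>M) = (\<integral>\<^sup>+\<omega>. (\<Sum>j. g (of_nat j) * indicator (A j) \<omega>) \<partial>M)"
  proof (rule nn_integral_cong_AE)
    show "AE \<omega> in M. g (N \<omega>) = (\<Sum>j. g (of_nat j) * indicator (A j) \<omega>)"
      using poisson_AE_nat AE_space
    proof eventually_elim
      fix \<omega> assume "\<exists>j::nat. N \<omega> = of_nat j" and w: "\<omega> \<in> space M"
      then obtain j :: nat where j: "N \<omega> = of_nat j" by blast
      have "(\<Sum>i. g (of_nat i) * indicator (A i) \<omega>) = (\<Sum>i\<in>{j}. g (of_nat i) * indicator (A i) \<omega>)"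
        by (rule suminf_finite) (use j in \<open>auto simp: A_def indicator_def\<close>)
      then show "g (N \<omega>) = (\<Sum>i. g (of_nat i) * indicator (A i) \<omega>)" using j w by (simp add: A_def)
    qed
  qed
  also have "\<dots> = (\<Sum>j. \<integral>\<^sup>+\<omega>. g (of_nat j) * indicator (A j) \<omega> \<partial>M)"
    by (rule nn_integral_suminf) (use A in measurable)
  also have "\<dots> = (\<Sum>j. g (of_nat j) * ennreal (poisson_weight x j))"
    by (intro suminf_cong) (simp add: nn_integral_cmult_indicator A emeasure_eq_measure poisson_prob A_def poisson_event)
  finally show ?thesis .
qed

lemma poisson_mean: "(\<integral>\<^sup>+\<omega>. N \<omega> \<partial>M) = ennreal x"
proof -
  have "(\<integral>\<^sup>+\<omega>. N \<omega> \<partial>M) = (\<Sum>j. of_nat j * ennreal (poisson_weight x j))"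
    using poisson_nn_integral[of "\<lambda>n. n"] by simp
  also have "\<dots> = (\<Sum>j. ennreal (real j * poisson_weight x j))"
    by (simp add: ennreal_mult' ennreal_of_nat_eq_real_of_nat)
  also have "\<dots> = ennreal x"
    using poisson_weight_mean[of x] by (subst suminf_ennreal2) (auto simp: sums_iff poisson_weight_nonneg x)
  finally show ?thesis .
qed

lemma poisson_factorial_moment: "(\<integral>\<^sup>+\<omega>. N \<omega> * (N \<omega> - 1) \<partial>M) = ennreal (x\<^sup>2)"
proof -
  have "(\<integral>\<^sup>+\<omega>. N \<omega> * (N \<omega> - 1) \<partial>M) = (\<Sum>j. of_nat j * (of_nat j - 1) * ennreal (poisson_weight x j))"
    by (rule poisson_nn_integral[of "\<lambda>n. n * (n - 1)"])
  also have "\<dots> = (\<Sum>j. ennreal (real j * (real j - 1) * poisson_weight x j))"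
  proof (rule suminf_cong)
    fix j
    show "of_nat j * (of_nat j - 1) * ennreal (poisson_weight x j) = ennreal (real j * (real j - 1) * poisson_weight x j)"
    \<comment> \<open>For \<open>j = 0\<close> subtraction in \<open>ennreal\<close> truncates, but
      the factor 0 makes both sides vanish.\<close>
    proof (cases j)
      case (Suc i)
      have "of_nat j - (1::ennreal) = ennreal (real j - 1)"
        using ennreal_minus[of 1 "real j"] by (simp add: ennreal_of_nat_eq_real_of_nat)
      then show ?thesis using Suc poisson_weight_nonneg[OF x, of j]
        by (simp add: ennreal_mult ennreal_of_nat_eq_real_of_nat)
    qed simp
  qed
  also have "\<dots> = ennreal (x\<^sup>2)"
  proof (subst suminf_ennreal2)
    show "0 \<le> real j * (real j - 1) * poisson_weight x j" for j
      using poisson_weight_nonneg[OF x, of j] by (cases j) auto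
  qed (use poisson_weight_factorial_moment[of x] in \<open>auto simp: sums_iff\<close>)
  finally show ?thesis .
qed

text \<open>Follows from \<open>exp x >= 1 + x + x^2 / 2\<close>. The rational bound is comparable
  to \<open>x^2\<close> for small \<open>x\<close> and stays away from 0 for large \<open>x\<close>,
  the two regimes used in \<open>box_sums_unbounded\<close>.\<close>

lemma poisson_prob_ge_2: "x\<^sup>2 / (2 + 2 * x + x\<^sup>2) \<le> measure M {\<omega> \<in> space M. 2 \<le> N \<omega>}"
proof -
  interpret prob_space M by (rule M)
  note [measurable] = poisson_measurable
  have ev: "{\<omega> \<in> space M. 2 \<le> N \<omega>} \<in> events" by measurable
  have "1 = prob (space M)" by (simp add: prob_space)
  also have "\<dots> \<le> prob (({\<omega> \<in> space M. N \<omega> = of_nat 0} \<union> {\<omega> \<in> space M. N \<omega> = of_nat 1}) \<union> {\<omega> \<in> space M. 2 \<le> N \<omega>})"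
  proof (rule finite_measure_mono_AE)
    show "AE \<omega> in M. \<omega> \<in> space M \<longrightarrow> \<omega> \<in> ({\<omega> \<in> space M. N \<omega> = of_nat 0} \<union> {\<omega> \<in> space M. N \<omega> = of_nat 1}) \<union> {\<omega> \<in> space M. 2 \<le> N \<omega>}"
      using poisson_AE_nat
    proof eventually_elim
      fix \<omega> assume "\<exists>j::nat. N \<omega> = of_nat j"
      then obtain j :: nat where j: "N \<omega> = of_nat j" by blast
      consider "j = 0" | "j = 1" | "2 \<le> j" by linarith
      then show "\<omega> \<in> space M \<longrightarrow> \<omega> \<in> ({\<omega> \<in> space M. N \<omega> = of_nat 0} \<union> {\<omega> \<in> space M. N \<omega> = of_nat 1}) \<union> {\<omega> \<in> space M. 2 \<le> N \<omega>}"
      proof cases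
        case 3
        then have "(of_nat 2 :: ennreal) \<le> of_nat j" by (simp only: of_nat_le_iff)
        then show ?thesis using j by simp
      qed (use j in auto)
    qed
    show "({\<omega> \<in> space M. N \<omega> = of_nat 0} \<union> {\<omega> \<in> space M. N \<omega> = of_nat 1}) \<union> {\<omega> \<in> space M. 2 \<le> N \<omega>} \<in> events"
      using poisson_event[of 0] poisson_event[of 1] ev by (intro sets.Un)
  qed
  also have "\<dots> \<le> prob ({\<omega> \<in> space M. N \<omega> = of_nat 0} \<union> {\<omega> \<in> space M. N \<omega> = of_nat 1}) + prob {\<omega> \<in> space M. 2 \<le> N \<omega>}"
    using poisson_event[of 0] poisson_event[of 1] ev by (intro measure_Un_le sets.Un)
  also have "prob ({\<omega> \<in> space M. N \<omega> = of_nat 0} \<union> {\<omega> \<in> space M. N \<omega> = of_nat 1}) \<le> poisson_weight x 0 + poisson_weight x 1"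
    unfolding poisson_prob[symmetric] using poisson_event[of 0] poisson_event[of 1] by (intro measure_Un_le)
  finally have "1 \<le> (1 + x) * exp (- x) + prob {\<omega> \<in> space M. 2 \<le> N \<omega>}"
    by (simp add: poisson_weight_def algebra_simps)
  moreover have "(1 + x) * exp (- x) \<le> (1 + x) / (1 + x + x\<^sup>2 / 2)"
  proof -
    have "1 + x + x\<^sup>2 / 2 \<le> exp x" using exp_lower_Taylor_quadratic[OF x] .
    moreover have "0 < 1 + x + x\<^sup>2 / 2" using x by (simp add: add_pos_nonneg)
    ultimately have "(1 + x) / exp x \<le> (1 + x) / (1 + x + x\<^sup>2 / 2)" using x by (intro divide_left_mono) auto
    then show ?thesis by (simp only: exp_minus divide_inverse)
  qed
  moreover have "1 - (1 + x) / (1 + x + x\<^sup>2 / 2) = x\<^sup>2 / (2 + 2 * x + x\<^sup>2)"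
  proof -
    have "0 < 1 + x + x\<^sup>2 / 2" "0 < 2 + 2 * x + x\<^sup>2" using x by (simp_all add: add_pos_nonneg)
    then show ?thesis by (simp add: field_simps)
  qed
  ultimately show ?thesis by linarith
qed

end

text \<open>For \<open>ennreal\<close> values this is Tonelli on the product of the two
  distributions, with no integrability condition.\<close>

lemma (in prob_space) indep_var_nn_integral_mult:
  fixes X Y :: "'a \<Rightarrow> ennreal"
  assumes "indep_var borel X borel Y"
  shows "(\<integral>\<^sup>+\<omega>. X \<omega> * Y \<omega> \<partial>M) = (\<integral>\<^sup>+\<omega>. X \<omega> \<partial>M) * (\<integral>\<^sup>+\<omega>. Y \<omega> \<partial>M)"
proof -
  have X [measurable]: "X \<in> borel_measurable M" and Y [measurable]: "Y \<in> borel_measurable M"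
    and eq: "distr M borel X \<Otimes>\<^sub>M distr M borel Y = distr M (borel \<Otimes>\<^sub>M borel) (\<lambda>\<omega>. (X \<omega>, Y \<omega>))"
    using assms by (auto simp: indep_var_distribution_eq)
  interpret X: prob_space "distr M borel X" by (rule prob_space_distr[OF X])
  interpret Y: prob_space "distr M borel Y" by (rule prob_space_distr[OF Y])
  have m: "(\<lambda>p. fst p * snd p) \<in> borel_measurable (borel \<Otimes>\<^sub>M (borel :: ennreal measure))" by measurable
  have m': "(\<lambda>p. fst p * snd p) \<in> borel_measurable (distr M borel X \<Otimes>\<^sub>M distr M borel Y)"
    using m by (simp add: eq)
  have "(\<integral>\<^sup>+\<omega>. X \<omega> * Y \<omega> \<partial>M) = (\<integral>\<^sup>+p. fst p * snd p \<partial>(distr M borel X \<Otimes>\<^sub>M distr M borel Y))"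
    unfolding eq by (subst nn_integral_distr) (use m in auto)
  also have "\<dots> = (\<integral>\<^sup>+x. \<integral>\<^sup>+y. x * y \<partial>distr M borel Y \<partial>distr M borel X)"
    by (subst Y.nn_integral_fst[OF m', symmetric]) simp
  also have "\<dots> = (\<integral>\<^sup>+x. x * (\<integral>\<^sup>+y. y \<partial>distr M borel Y) \<partial>distr M borel X)"
    by (intro nn_integral_cong nn_integral_cmult) simp
  also have "\<dots> = (\<integral>\<^sup>+x. x \<partial>distr M borel X) * (\<integral>\<^sup>+y. y \<partial>distr M borel Y)"
    by (rule nn_integral_multc) simp
  also have "\<dots> = (\<integral>\<^sup>+\<omega>. X \<omega> \<partial>M) * (\<integral>\<^sup>+\<omega>. Y \<omega> \<partial>M)"
    by (simp add: nn_integral_distr)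
  finally show ?thesis .
qed

text \<open>If \<open>n\<close> counts the points in each box, this is the number of ordered pairs
  of different points, the first in box \<open>a\<close> and the second in box
  \<open>b\<close>.\<close>

definition pair_count :: "(nat \<times> nat \<Rightarrow> ennreal) \<Rightarrow> nat \<times> nat \<Rightarrow> nat \<times> nat \<Rightarrow> ennreal" where
  "pair_count n a b = n a * (if a = b then n b - 1 else n b)"

text \<open>Pairs of points are grouped by their boxes; excluding \<open>i\<close> itself in its own
  box is what produces \<open>n b - 1\<close>.\<close>

lemma sum_pairs_le_box_sum:
  fixes l :: "nat \<Rightarrow> complex" and h :: "nat \<times> nat \<Rightarrow> nat \<times> nat \<Rightarrow> ennreal"
  assumes l: "inj l" and b: "\<And>i. bx i \<in> box_index" "\<And>i. l i \<in> dbox (bx i)" and F: "finite F"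
  defines "n \<equiv> \<lambda>b. emeasure (count_space UNIV) (dbox b \<inter> range l)"
  shows "(\<Sum>i\<in>F. \<Sum>j\<in>F - {i}. h (bx i) (bx j)) \<le>
    (\<integral>\<^sup>+a. \<integral>\<^sup>+b. h a b * pair_count n a b * (indicator box_index a * indicator box_index b) \<partial>count_space UNIV \<partial>count_space UNIV)"
proof -
  define B where "B = bx ` F"
  have B: "finite B" "B \<subseteq> box_index" using F b by (auto simp: B_def)
  have card_le: "of_nat (card S) \<le> n a" if "finite S" "\<And>i. i \<in> S \<Longrightarrow> bx i = a" for S a
  proof -
    have "of_nat (card S) = of_nat (card (l ` S))" using l by (simp add: card_image inj_on_subset)
    also have "\<dots> = emeasure (count_space UNIV) (l ` S)" using that by (simp add: emeasure_count_space_finite)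
    also have "\<dots> \<le> n a" unfolding n_def using that b by (intro emeasure_mono) auto
    finally show ?thesis .
  qed
  have inner: "(\<Sum>j\<in>F - {i}. h (bx i) (bx j)) \<le> (\<Sum>b\<in>B. h (bx i) b * (if bx i = b then n b - 1 else n b))"
    if i: "i \<in> F" for i
  proof -
    have "(\<Sum>j\<in>F - {i}. h (bx i) (bx j)) = (\<Sum>b\<in>B. \<Sum>j | j \<in> F - {i} \<and> bx j = b. h (bx i) (bx j))"
      by (rule sum.group[symmetric]) (use F B in \<open>auto simp: B_def\<close>)
    also have "\<dots> \<le> (\<Sum>b\<in>B. h (bx i) b * (if bx i = b then n b - 1 else n b))"
    proof (rule sum_mono)
      fix b
      define S where "S = {j \<in> F - {i}. bx j = b}"
      have S: "finite S" using F by (simp add: S_def)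
      have "(\<Sum>j | j \<in> F - {i} \<and> bx j = b. h (bx i) (bx j)) = (\<Sum>j\<in>S. h (bx i) b)"
        unfolding S_def by (intro sum.cong) auto
      also have "\<dots> = h (bx i) b * of_nat (card S)" by (simp add: mult.commute)
      also have "\<dots> \<le> h (bx i) b * (if bx i = b then n b - 1 else n b)"
      proof (intro mult_left_mono)
        show "of_nat (card S) \<le> (if bx i = b then n b - 1 else n b)"
        proof (cases "bx i = b")
          case True
          have "of_nat (card (insert i S)) \<le> n b" by (rule card_le) (use S True in \<open>auto simp: S_def\<close>)
          moreover have "card (insert i S) = card S + 1" using S by (simp add: S_def)
          ultimately have "of_nat (card S) + 1 \<le> n b" by (simp add: add.commute)
          then have "of_nat (card S) + 1 - 1 \<le> n b - 1" by (rule ennreal_minus_mono) simp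
          then show ?thesis using True by (simp add: ennreal_add_diff_cancel_right)
        next
          case False
          moreover have "of_nat (card S) \<le> n b" by (rule card_le) (use S in \<open>auto simp: S_def\<close>)
          ultimately show ?thesis by simp
        qed
      qed simp
      finally show "(\<Sum>j | j \<in> F - {i} \<and> bx j = b. h (bx i) (bx j)) \<le> h (bx i) b * (if bx i = b then n b - 1 else n b)" .
    qed
    finally show ?thesis .
  qed
  define H where "H a = (\<Sum>b\<in>B. h a b * (if a = b then n b - 1 else n b))" for a
  have "(\<Sum>i\<in>F. \<Sum>j\<in>F - {i}. h (bx i) (bx j)) \<le> (\<Sum>i\<in>F. H (bx i))"
    unfolding H_def using inner by (intro sum_mono)
  also have "\<dots> = (\<Sum>a\<in>B. \<Sum>i | i \<in> F \<and> bx i = a. H (bx i))"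
    by (rule sum.group[symmetric]) (use F B in \<open>auto simp: B_def\<close>)
  also have "\<dots> \<le> (\<Sum>a\<in>B. n a * H a)"
  proof (rule sum_mono)
    fix a
    have "(\<Sum>i | i \<in> F \<and> bx i = a. H (bx i)) = (\<Sum>i | i \<in> F \<and> bx i = a. H a)" by (intro sum.cong) auto
    also have "\<dots> = of_nat (card {i \<in> F. bx i = a}) * H a" by simp
    also have "\<dots> \<le> n a * H a" using F by (intro mult_right_mono card_le) auto
    finally show "(\<Sum>i | i \<in> F \<and> bx i = a. H (bx i)) \<le> n a * H a" .
  qed
  also have "\<dots> = (\<Sum>a\<in>B. \<Sum>b\<in>B. h a b * pair_count n a b)"
    by (simp add: H_def pair_count_def sum_distrib_left mult_ac)
  also have "\<dots> = (\<integral>\<^sup>+a. \<integral>\<^sup>+b. h a b * pair_count n a b * (indicator B a * indicator B b) \<partial>count_space UNIV \<partial>count_space UNIV)"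
  proof -
    have "(\<integral>\<^sup>+b. h a b * pair_count n a b * (indicator B a * indicator B b) \<partial>count_space UNIV)
       = (\<Sum>b\<in>B. h a b * pair_count n a b) * indicator B a" for a
    proof -
      have "(\<integral>\<^sup>+b. h a b * pair_count n a b * (indicator B a * indicator B b) \<partial>count_space UNIV)
         = (\<Sum>b\<in>B. h a b * pair_count n a b * (indicator B a * indicator B b))"
        by (rule nn_integral_count_space') (use B in auto)
      then show ?thesis by (simp add: sum_distrib_right)
    qed
    moreover have "(\<integral>\<^sup>+a. (\<Sum>b\<in>B. h a b * pair_count n a b) * indicator B a \<partial>count_space UNIV)
       = (\<Sum>a\<in>B. (\<Sum>b\<in>B. h a b * pair_count n a b) * indicator B a)"
      by (rule nn_integral_count_space') (use B in auto)
    ultimately show ?thesis by simp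
  qed
  also have "\<dots> \<le> (\<integral>\<^sup>+a. \<integral>\<^sup>+b. h a b * pair_count n a b * (indicator box_index a * indicator box_index b) \<partial>count_space UNIV \<partial>count_space UNIV)"
    using B by (intro nn_integral_mono mult_left_mono) (auto simp: indicator_def)
  finally show ?thesis .
qed

text \<open>The pathwise criterion: up to the constant of \<open>kernel_gram_bound\<close>, the
  energy bounds every finite section of the Hilbert-Schmidt sum.\<close>

lemma interpolating_if_box_energy_finite:
  fixes l :: "nat \<Rightarrow> complex"
  assumes a: "0 < a" "a < 1" and l: "inj l" "\<And>i. cmod (l i) < 1"
  defines "n \<equiv> \<lambda>b. emeasure (count_space UNIV) (dbox b \<inter> range l)"
  assumes fin: "(\<integral>\<^sup>+x. \<integral>\<^sup>+y. ennreal (box_kernel x y powr a) * pair_count n x y * (indicator box_index x * indicator box_index y) \<partial>count_space UNIV \<partial>count_space UNIV) < \<infinity>"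
  shows "interpolating a l"
proof -
  define E where "E = (\<integral>\<^sup>+x. \<integral>\<^sup>+y. ennreal (box_kernel x y powr a) * pair_count n x y * (indicator box_index x * indicator box_index y) \<partial>count_space UNIV \<partial>count_space UNIV)"
  have E: "E < \<infinity>" using fin by (simp add: E_def)
  obtain C where C: "C > 0" "\<And>n k m j z w. k < 2 ^ n \<Longrightarrow> j < 2 ^ m \<Longrightarrow> z \<in> dyadic_box n k \<Longrightarrow> w \<in> dyadic_box m j \<Longrightarrow>
     cmod z < 1 \<Longrightarrow> cmod w < 1 \<Longrightarrow> (cmod (ip (nev a w) (nev a z)))\<^sup>2 \<le> C * box_kernel (n, k) (m, j) powr a"
    using kernel_gram_bound[OF a] by blast
  have "\<forall>i. \<exists>b. b \<in> box_index \<and> l i \<in> dbox b" using dbox_cover l(2) by blast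
  then obtain bx where bx: "\<And>i. bx i \<in> box_index" "\<And>i. l i \<in> dbox (bx i)" by metis
  have gram: "(cmod (ip (nev a (l j)) (nev a (l i))))\<^sup>2 \<le> C * box_kernel (bx i) (bx j) powr a" for i j
    using C(2)[of "snd (bx i)" "fst (bx i)" "snd (bx j)" "fst (bx j)" "l i" "l j"] bx l(2)
    by (simp add: box_index_def dbox_def)
  have "offdiag_le (\<lambda>i. nev a (l i)) UNIV (C * enn2real E)"
    unfolding offdiag_le_def
  proof (intro allI impI)
    fix F :: "nat set" assume F: "finite F"
    define S where "S = (\<Sum>i\<in>F. \<Sum>j\<in>F - {i}. box_kernel (bx i) (bx j) powr a)"
    have S0: "0 \<le> S" unfolding S_def by (intro sum_nonneg) auto
    have "ennreal S = (\<Sum>i\<in>F. \<Sum>j\<in>F - {i}. ennreal (box_kernel (bx i) (bx j) powr a))"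
      by (simp add: S_def sum_nonneg)
    also have "\<dots> \<le> E"
      unfolding E_def n_def by (rule sum_pairs_le_box_sum[OF l(1) bx F])
    finally have "ennreal S \<le> ennreal (enn2real E)" using E by simp
    then have SE: "S \<le> enn2real E" by simp
    have "(\<Sum>i\<in>F. \<Sum>j\<in>F - {i}. (cmod (ip (nev a (l j)) (nev a (l i))))\<^sup>2) \<le> (\<Sum>i\<in>F. \<Sum>j\<in>F - {i}. C * box_kernel (bx i) (bx j) powr a)"
      by (intro sum_mono gram)
    also have "\<dots> = C * S" by (simp add: S_def sum_distrib_left)
    also have "\<dots> \<le> C * enn2real E" using SE C(1) by simp
    finally show "(\<Sum>i\<in>F. \<Sum>j\<in>F - {i}. (cmod (ip (nev a (l j)) (nev a (l i))))\<^sup>2) \<le> C * enn2real E" .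
  qed
  then show ?thesis by (rule hilbert_schmidt_interpolating[OF a l])
qed

lemma borel_measurable_nn_integral_count_space_pairs:
  fixes f :: "'a \<Rightarrow> nat \<times> nat \<Rightarrow> ennreal"
  assumes "\<And>b. (\<lambda>\<omega>. f \<omega> b) \<in> borel_measurable M"
  shows "(\<lambda>\<omega>. \<integral>\<^sup>+b. f \<omega> b \<partial>count_space UNIV) \<in> borel_measurable M"
proof -
  have "(\<integral>\<^sup>+b. f \<omega> b \<partial>count_space UNIV) = (\<Sum>i. f \<omega> (prod_decode i))" for \<omega>
    using nn_integral_bij_count_space[OF bij_prod_decode, of "f \<omega>"]
    by (simp add: nn_integral_count_space_nat)
  then show ?thesis using assms by (simp add: borel_measurable_suminf_order)
qed

section \<open>The energy of the Poisson process and its expectation\<close>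

locale disk_poisson_process =
  fixes M :: "'w measure" and \<mu> :: "complex measure" and X :: "nat \<Rightarrow> 'w \<Rightarrow> complex"
  assumes sets_mu: "sets \<mu> = sets (restrict_space borel unit_disk)"
    and loc_fin: "locally_finite_on_disk \<mu>"
    and process: "poisson_process M \<mu> X"
begin

sublocale prob_space M
  using process by (simp add: poisson_process_def)

lemma in_sets_mu: "A \<in> sets borel \<Longrightarrow> A \<subseteq> unit_disk \<Longrightarrow> A \<in> sets \<mu>"
  by (simp add: sets_mu sets_restrict_space_iff)

text \<open>A box keeps a positive distance from the unit circle, so it lies in a compact disk of
  finite mass.\<close>

lemma box_finite: "A \<in> sets borel \<Longrightarrow> A \<subseteq> dbox b \<Longrightarrow> emeasure \<mu> A = ennreal (measure \<mu> A)"
proof -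
  assume A: "A \<in> sets borel" "A \<subseteq> dbox b"
  define K where "K = cball (0::complex) (1 - 1 / 2 ^ (fst b + 1))"
  have K: "compact K" by (simp add: K_def)
  have K1: "K \<subseteq> unit_disk"
  proof
    fix z assume "z \<in> K"
    then have "cmod z \<le> 1 - 1 / 2 ^ (fst b + 1)" by (simp add: K_def)
    moreover have "(0::real) < 1 / 2 ^ (fst b + 1)" by simp
    ultimately have "cmod z < 1" by linarith
    then show "z \<in> unit_disk" by simp
  qed
  have "A \<subseteq> K"
  proof
    fix z assume "z \<in> A"
    then have "z \<in> dyadic_box (fst b) (snd b)" using A by (auto simp: dbox_def)
    from dyadic_box_norm(1)[OF this] show "z \<in> K" by (simp add: K_def)
  qed
  moreover have "K \<in> sets \<mu>" using K K1 by (intro in_sets_mu borel_closed compact_imp_closed)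
  ultimately have "emeasure \<mu> A \<le> emeasure \<mu> K" by (rule emeasure_mono)
  also have "\<dots> < \<infinity>" using loc_fin K K1 unfolding locally_finite_on_disk_def by blast
  finally show ?thesis by (intro emeasure_eq_ennreal_measure) auto
qed

lemma count_poisson:
  assumes "A \<in> sets borel" "A \<subseteq> dbox b"
  shows "poisson_distributed M (point_count X A) (ennreal (measure \<mu> A))"
proof -
  have "A \<subseteq> unit_disk" using assms(2) dbox_subset[of b] by (rule order.trans)
  then have "poisson_distributed M (point_count X A) (emeasure \<mu> A)"
    using process assms(1) unfolding poisson_process_def by blast
  then show ?thesis by (simp only: box_finite[OF assms])
qed

lemma count_indep:
  assumes "A \<in> sets borel" "B \<in> sets borel" "A \<subseteq> dbox a" "B \<subseteq> dbox b" "A \<inter> B = {}"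
  shows "indep_var borel (point_count X A) borel (point_count X B)"
proof -
  have "A \<subseteq> unit_disk" "B \<subseteq> unit_disk"
    using assms(3,4) dbox_subset[of a] dbox_subset[of b] by (meson order.trans)+
  then show ?thesis using process assms(1,2,5) unfolding poisson_process_def by blast
qed

lemma nn_integral_pair_count:
  assumes ab: "a \<in> box_index" "b \<in> box_index"
  shows "(\<lambda>\<omega>. pair_count (\<lambda>b. point_count X (dbox b) \<omega>) a b) \<in> borel_measurable M"
    and "(\<integral>\<^sup>+\<omega>. pair_count (\<lambda>b. point_count X (dbox b) \<omega>) a b \<partial>M) = ennreal (measure \<mu> (dbox a) * measure \<mu> (dbox b))"
proof -
  note cp = count_poisson[OF dbox_borel order_refl]
  note [measurable] = poisson_measurable[OF prob_space_axioms measure_nonneg cp]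
  show "(\<lambda>\<omega>. pair_count (\<lambda>b. point_count X (dbox b) \<omega>) a b) \<in> borel_measurable M"
    unfolding pair_count_def by (cases "a = b") simp_all
  show "(\<integral>\<^sup>+\<omega>. pair_count (\<lambda>b. point_count X (dbox b) \<omega>) a b \<partial>M) = ennreal (measure \<mu> (dbox a) * measure \<mu> (dbox b))"
  proof (cases "a = b")
    case True
    then show ?thesis
      using poisson_factorial_moment[OF prob_space_axioms measure_nonneg cp, of b]
      by (simp add: pair_count_def power2_eq_square)
  next
    case False
    have "dbox a \<inter> dbox b = {}" using dbox_unique[OF _ _ ab] False by blast
    from indep_var_nn_integral_mult[OF count_indep[OF dbox_borel dbox_borel order_refl order_refl this]]
    show ?thesis using False
      by (simp add: pair_count_def poisson_mean[OF prob_space_axioms measure_nonneg cp] ennreal_mult)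
  qed
qed

text \<open>Covers both positive statements: for \<open>gam = 2\<close> the condition
  \<open>gam * (1 - a) < 1\<close> reads \<open>a > 1 / 2\<close>.\<close>

lemma AE_interpolating:
  assumes gam: "1 < gam" "gam \<le> 2" "gam * (1 - a) < 1" and a: "0 < a" "a < 1"
    and fin: "(\<Sum>n. \<Sum>k<2 ^ n. ennreal (measure \<mu> (dyadic_box n k) powr gam)) < \<infinity>"
  shows "AE \<omega> in M. interpolating a (\<lambda>n. X n \<omega>)"
proof -
  define m where "m b = measure \<mu> (dbox b)" for b
  have "(\<integral>\<^sup>+b. ennreal (m b powr gam) * indicator box_index b \<partial>count_space UNIV) < \<infinity>"
    using fin by (subst nn_integral_box_index) (simp add: m_def dbox_def)
  from box_energy_finite[OF gam a(1) _ this]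
  have en: "(\<integral>\<^sup>+x. \<integral>\<^sup>+y. ennreal (box_kernel x y powr a * m x * m y) * (indicator box_index x * indicator box_index y)
     \<partial>count_space UNIV \<partial>count_space UNIV) < \<infinity>" by (simp add: m_def)
  define g where "g \<omega> x y = ennreal (box_kernel x y powr a) * pair_count (\<lambda>b. point_count X (dbox b) \<omega>) x y *
      (indicator box_index x * indicator box_index y)" for \<omega> x y
  have gm: "(\<lambda>\<omega>. g \<omega> x y) \<in> borel_measurable M" for x y
  proof (cases "x \<in> box_index \<and> y \<in> box_index")
    case True
    then have [measurable]: "(\<lambda>\<omega>. pair_count (\<lambda>b. point_count X (dbox b) \<omega>) x y) \<in> borel_measurable M"
      by (intro nn_integral_pair_count(1)) auto
    show ?thesis unfolding g_def by measurable
  next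
    case False
    then have "g \<omega> x y = 0" for \<omega> by (auto simp: g_def)
    then show ?thesis by simp
  qed
  have gi: "(\<integral>\<^sup>+\<omega>. g \<omega> x y \<partial>M) = ennreal (box_kernel x y powr a * m x * m y) * (indicator box_index x * indicator box_index y)" for x y
  proof (cases "x \<in> box_index \<and> y \<in> box_index")
    case True
    then show ?thesis
    proof -
      have "(\<integral>\<^sup>+\<omega>. g \<omega> x y \<partial>M) = (\<integral>\<^sup>+\<omega>. ennreal (box_kernel x y powr a) * pair_count (\<lambda>b. point_count X (dbox b) \<omega>) x y \<partial>M)"
        using True by (simp add: g_def)
      also have "\<dots> = ennreal (box_kernel x y powr a) * ennreal (m x * m y)"
        using nn_integral_pair_count[of x y] True by (subst nn_integral_cmult) (simp_all add: m_def)
      also have "\<dots> = ennreal (box_kernel x y powr a * m x * m y)"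
        by (simp add: ennreal_mult'[symmetric] mult.assoc)
      finally show ?thesis using True by simp
    qed
  next
    case False
    then have "g \<omega> x y = 0" for \<omega> by (auto simp: g_def)
    moreover have "ennreal (box_kernel x y powr a * m x * m y) * (indicator box_index x * indicator box_index y) = 0"
      using False by auto
    ultimately show ?thesis by simp
  qed
  have gm2: "(\<lambda>\<omega>. \<integral>\<^sup>+y. g \<omega> x y \<partial>count_space UNIV) \<in> borel_measurable M" for x
    by (rule borel_measurable_nn_integral_count_space_pairs[OF gm])
  have gm3: "(\<lambda>\<omega>. \<integral>\<^sup>+x. \<integral>\<^sup>+y. g \<omega> x y \<partial>count_space UNIV \<partial>count_space UNIV) \<in> borel_measurable M"
    by (rule borel_measurable_nn_integral_count_space_pairs[OF gm2])
  \<comment> \<open>By Tonelli the mean of the random energy is the energy of the masses; a finite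
    mean leaves the energy finite almost surely.\<close>
  have "(\<integral>\<^sup>+\<omega>. \<integral>\<^sup>+x. \<integral>\<^sup>+y. g \<omega> x y \<partial>count_space UNIV \<partial>count_space UNIV \<partial>M)
     = (\<integral>\<^sup>+x. \<integral>\<^sup>+\<omega>. \<integral>\<^sup>+y. g \<omega> x y \<partial>count_space UNIV \<partial>M \<partial>count_space UNIV)"
    by (rule nn_integral_count_space_nn_integral[OF _ gm2]) simp
  also have "\<dots> = (\<integral>\<^sup>+x. \<integral>\<^sup>+y. \<integral>\<^sup>+\<omega>. g \<omega> x y \<partial>M \<partial>count_space UNIV \<partial>count_space UNIV)"
    by (intro nn_integral_cong nn_integral_count_space_nn_integral gm) simp
  also have "\<dots> < \<infinity>" using en by (simp only: gi)
  finally have "AE \<omega> in M. (\<integral>\<^sup>+x. \<integral>\<^sup>+y. g \<omega> x y \<partial>count_space UNIV \<partial>count_space UNIV) \<noteq> \<infinity>"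
    by (intro nn_integral_noteq_infinite gm3) auto
  moreover have "AE \<omega> in M. inj (\<lambda>n. X n \<omega>)" using process by (simp add: poisson_process_def)
  ultimately show ?thesis using AE_space
  proof eventually_elim
    fix \<omega> assume e: "(\<integral>\<^sup>+x. \<integral>\<^sup>+y. g \<omega> x y \<partial>count_space UNIV \<partial>count_space UNIV) \<noteq> \<infinity>"
      and i: "inj (\<lambda>n. X n \<omega>)" and w: "\<omega> \<in> space M"
    have "cmod (X n \<omega>) < 1" for n
      using process w by (simp add: poisson_process_def)
    then show "interpolating a (\<lambda>n. X n \<omega>)"
      using e i by (intro interpolating_if_box_energy_finite a) (auto simp: g_def point_count_def less_top)
  qed
qed

end

section \<open>Close pairs and failure of interpolation\<close>

lemma cis_lipschitz: "cmod (cis s - cis t) \<le> \<bar>s - t\<bar>"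
proof -
  have "cis s - cis t = cis t * (exp (\<i> * of_real (s - t)) - 1)"
    by (simp add: cis_conv_exp right_diff_distrib exp_diff)
  then have "cmod (cis s - cis t) = 2 * \<bar>sin ((s - t) / 2)\<bar>"
    by (simp only: norm_mult norm_cis dist_exp_i_1 mult_1)
  also have "\<dots> \<le> 2 * \<bar>(s - t) / 2\<bar>" by (intro mult_left_mono abs_sin_x_le_abs_x) simp
  finally show ?thesis by simp
qed

lemma polar_rect_diameter:
  assumes "z \<in> polar_rect r0 r1 t0 t1" "w \<in> polar_rect r0 r1 t0 t1" "0 \<le> r0" "r1 \<le> 1"
  shows "cmod (z - w) \<le> (r1 - r0) + (t1 - t0)"
proof -
  obtain r t where z: "z = of_real r * cis t" "r0 \<le> r" "r < r1" "t0 \<le> t" "t < t1"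
    using assms(1) by (auto simp: polar_rect_def)
  obtain s v where w: "w = of_real s * cis v" "r0 \<le> s" "s < r1" "t0 \<le> v" "v < t1"
    using assms(2) by (auto simp: polar_rect_def)
  have "z - w = of_real (r - s) * cis t + of_real s * (cis t - cis v)"
    by (simp add: z(1) w(1) algebra_simps)
  then have "cmod (z - w) \<le> cmod (of_real (r - s) * cis t) + cmod (of_real s * (cis t - cis v))"
    by (simp only: norm_triangle_ineq)
  also have "\<dots> = \<bar>r - s\<bar> + \<bar>s\<bar> * cmod (cis t - cis v)" by (simp only: norm_mult norm_of_real norm_cis mult_1_right)
  also have "\<dots> \<le> \<bar>r - s\<bar> + 1 * \<bar>t - v\<bar>"
    using assms(3,4) w by (intro add_left_mono mult_mono cis_lipschitz) auto
  also have "\<dots> \<le> (r1 - r0) + (t1 - t0)" using z w by (simp add: abs_if)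
  finally show ?thesis .
qed

lemma interval_subdivision:
  fixes x :: real
  assumes "0 < d" "x0 \<le> x" "x < x0 + real L * d"
  shows "\<exists>i<L. x0 + real i * d \<le> x \<and> x < x0 + (real i + 1) * d"
proof (intro exI conjI)
  define i where "i = nat \<lfloor>(x - x0) / d\<rfloor>"
  have "0 \<le> (x - x0) / d" using assms by simp
  then have i: "real i \<le> (x - x0) / d" "(x - x0) / d < real i + 1" by (auto simp: i_def)
  have i': "real i * d \<le> x - x0" "x - x0 < (real i + 1) * d"
    using i assms(1) by (simp_all add: pos_le_divide_eq pos_divide_less_eq)
  show "x0 + real i * d \<le> x" "x < x0 + (real i + 1) * d" using i' by linarith+
  have "real i * d < real L * d" using i' assms by linarith
  then show "i < L" using assms(1) by simp
qed

text \<open>Radius and angle are each cut into \<open>L\<close> equal parts, of lengths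
  \<open>dr\<close> and \<open>dt\<close>. A cell has diameter at most \<open>dr + dt\<close>, and
  the 8 comes from \<open>1 / 2 + 2 * pi < 8\<close>.\<close>

lemma dyadic_box_subdivision:
  assumes L: "0 < L"
  shows "\<exists>R :: nat \<times> nat \<Rightarrow> complex set. (\<forall>p. R p \<in> sets borel) \<and>
     dyadic_box n k = (\<Union>p\<in>{..<L} \<times> {..<L}. R p) \<and>
     (\<forall>p\<in>{..<L} \<times> {..<L}. \<forall>z\<in>R p. \<forall>w\<in>R p. cmod (z - w) \<le> 8 / (real L * 2 ^ n))"
proof -
  define r0 where "r0 = 1 - 1 / (2::real) ^ n"
  define dr where "dr = 1 / (2 ^ (n + 1) * real L)"
  define t0 where "t0 = 2 * pi * (real k / 2 ^ n)"
  define dt where "dt = 2 * pi / (2 ^ n * real L)"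
  have d: "0 < dr" "0 < dt" using L by (auto simp: dr_def dt_def)
  have r1: "1 - 1 / 2 ^ (n + 1) = r0 + real L * dr" using L by (simp add: r0_def dr_def field_simps)
  have t1: "2 * pi * (real (k + 1) / 2 ^ n) = t0 + real L * dt" using L by (simp add: t0_def dt_def field_simps)
  have box: "dyadic_box n k = polar_rect r0 (r0 + real L * dr) t0 (t0 + real L * dt)"
    unfolding dyadic_box_polar_rect r0_def[symmetric] t0_def[symmetric] r1 t1 ..
  define R where "R p = polar_rect (r0 + real (fst p) * dr) (r0 + (real (fst p) + 1) * dr)
      (t0 + real (snd p) * dt) (t0 + (real (snd p) + 1) * dt)" for p :: "nat \<times> nat"
  have step: "(real i + 1) * e \<le> real L * e" if "i < L" "0 < e" for i and e :: real
  proof -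
    have "real (i + 1) \<le> real L" using that(1) by (simp only: of_nat_le_iff)
    then show ?thesis using that(2) by (intro mult_right_mono) auto
  qed
  have "dyadic_box n k = (\<Union>p\<in>{..<L} \<times> {..<L}. R p)"
  proof (intro equalityI subsetI)
    fix z assume "z \<in> dyadic_box n k"
    then obtain r t where z: "z = of_real r * cis t" "r0 \<le> r" "r < r0 + real L * dr" "t0 \<le> t" "t < t0 + real L * dt"
      unfolding box polar_rect_def by auto
    obtain i where i: "i < L" "r0 + real i * dr \<le> r" "r < r0 + (real i + 1) * dr"
      using interval_subdivision[OF d(1) z(2,3)] by blast
    obtain j where j: "j < L" "t0 + real j * dt \<le> t" "t < t0 + (real j + 1) * dt"
      using interval_subdivision[OF d(2) z(4,5)] by blast
    have "z \<in> R (i, j)" unfolding R_def polar_rect_def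
      by (rule image_eqI[of _ _ "(r, t)"]) (use z i j in auto)
    then show "z \<in> (\<Union>p\<in>{..<L} \<times> {..<L}. R p)" using i j by blast
  next
    fix z assume "z \<in> (\<Union>p\<in>{..<L} \<times> {..<L}. R p)"
    then obtain i j where ij: "i < L" "j < L" "z \<in> R (i, j)" by auto
    then obtain r t where z: "z = of_real r * cis t" "r0 + real i * dr \<le> r" "r < r0 + (real i + 1) * dr"
      "t0 + real j * dt \<le> t" "t < t0 + (real j + 1) * dt"
      unfolding R_def polar_rect_def by auto
    have "0 \<le> real i * dr" "0 \<le> real j * dt" using d by auto
    then have "r0 \<le> r" "r < r0 + real L * dr" "t0 \<le> t" "t < t0 + real L * dt"
      using z step[OF ij(1) d(1)] step[OF ij(2) d(2)] by linarith+
    then show "z \<in> dyadic_box n k" unfolding box polar_rect_def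
      by (intro image_eqI[of _ _ "(r, t)"]) (use z in auto)
  qed
  moreover have "cmod (z - w) \<le> 8 / (real L * 2 ^ n)" if p: "p \<in> {..<L} \<times> {..<L}" "z \<in> R p" "w \<in> R p" for p z w
  proof -
    have "0 \<le> r0" by (simp add: r0_def)
    moreover have "0 \<le> real (fst p) * dr" using d by simp
    ultimately have lo: "0 \<le> r0 + real (fst p) * dr" by linarith
    have "r0 + real L * dr \<le> 1" unfolding r1[symmetric] by simp
    moreover have "(real (fst p) + 1) * dr \<le> real L * dr" using p(1) d by (intro step) auto
    ultimately have hi: "r0 + (real (fst p) + 1) * dr \<le> 1" by linarith
    have "cmod (z - w) \<le> (r0 + (real (fst p) + 1) * dr - (r0 + real (fst p) * dr)) + (t0 + (real (snd p) + 1) * dt - (t0 + real (snd p) * dt))"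
      by (rule polar_rect_diameter[OF p(2,3)[unfolded R_def] lo hi])
    also have "\<dots> = dr + dt" by (simp add: algebra_simps)
    also have "\<dots> = (1 / 2 + 2 * pi) / (real L * 2 ^ n)" using L by (simp add: dr_def dt_def field_simps)
    also have "\<dots> \<le> 8 / (real L * 2 ^ n)" using pi_less_4 pi_approx by (intro divide_right_mono) auto
    finally show ?thesis .
  qed
  moreover have "R p \<in> sets borel" for p unfolding R_def by (rule polar_rect_borel)
  ultimately show ?thesis by blast
qed

text \<open>Pairwise independence bounds the variance of the number of events by its mean
  \<open>s\<close>. As \<open>c <= s / 2\<close>, Chebyshev at distance \<open>s / 2\<close> yields
  \<open>s / (s / 2)^2 = 4 / s\<close>.\<close>

lemma (in prob_space) prob_pairwise_sum_le:
  assumes F: "finite F" and ev: "\<And>i. i \<in> F \<Longrightarrow> A i \<in> events"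
    and indep: "\<And>i j. i \<in> F \<Longrightarrow> j \<in> F \<Longrightarrow> i \<noteq> j \<Longrightarrow> prob (A i \<inter> A j) = prob (A i) * prob (A j)"
    and s: "2 * c \<le> (\<Sum>i\<in>F. prob (A i))" "0 < (\<Sum>i\<in>F. prob (A i))"
  shows "{\<omega> \<in> space M. (\<Sum>i\<in>F. indicator (A i) \<omega>) \<le> c} \<in> events"
    and "prob {\<omega> \<in> space M. (\<Sum>i\<in>F. indicator (A i) \<omega>) \<le> c} \<le> 4 / (\<Sum>i\<in>F. prob (A i))"
proof -
  define s where "s = (\<Sum>i\<in>F. prob (A i))"
  define S where "S \<omega> = (\<Sum>i\<in>F. indicator (A i) \<omega> :: real)" for \<omega>
  have s0: "0 < s" "2 * c \<le> s" using s by (auto simp: s_def)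
  have Sm [measurable]: "S \<in> borel_measurable M"
    unfolding S_def using ev by (intro borel_measurable_sum borel_measurable_indicator) auto
  show ev': "{\<omega> \<in> space M. (\<Sum>i\<in>F. indicator (A i) \<omega>) \<le> c} \<in> events"
    unfolding S_def[symmetric] by measurable
  have sq: "(S \<omega>)\<^sup>2 = (\<Sum>i\<in>F. \<Sum>j\<in>F. indicator (A i \<inter> A j) \<omega>)" for \<omega>
    by (simp add: S_def power2_eq_square sum_product indicator_inter_arith)
  have int: "integrable M (\<lambda>\<omega>. indicator (A i \<inter> A j) \<omega> :: real)" if "i \<in> F" "j \<in> F" for i j
    using ev that by (intro integrable_real_indicator) (auto simp: less_top[symmetric])
  have int1: "integrable M (\<lambda>\<omega>. indicator (A i) \<omega> :: real)" if "i \<in> F" for i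
    using int[OF that that] by simp
  have i2: "integrable M (\<lambda>\<omega>. (S \<omega>)\<^sup>2)" unfolding sq using int by (intro Bochner_Integration.integrable_sum) auto
  have i1: "integrable M S" unfolding S_def using int1 by (intro Bochner_Integration.integrable_sum) auto
  have E1: "expectation S = s"
  proof -
    have "expectation S = (\<Sum>i\<in>F. expectation (\<lambda>\<omega>. indicator (A i) \<omega> :: real))"
      unfolding S_def using int1 by (intro Bochner_Integration.integral_sum) auto
    also have "\<dots> = s" unfolding s_def using ev by (intro sum.cong) auto
    finally show ?thesis .
  qed
  have "expectation (\<lambda>\<omega>. (S \<omega>)\<^sup>2) = (\<Sum>i\<in>F. \<Sum>j\<in>F. prob (A i \<inter> A j))"
  proof -
    have "expectation (\<lambda>\<omega>. (S \<omega>)\<^sup>2) = (\<Sum>i\<in>F. \<Sum>j\<in>F. expectation (\<lambda>\<omega>. indicator (A i \<inter> A j) \<omega> :: real))"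
      unfolding sq using int
      by (subst Bochner_Integration.integral_sum) (auto intro!: sum.cong Bochner_Integration.integral_sum Bochner_Integration.integrable_sum)
    also have "\<dots> = (\<Sum>i\<in>F. \<Sum>j\<in>F. prob (A i \<inter> A j))"
      using ev by (intro sum.cong) auto
    finally show ?thesis .
  qed
  also have "\<dots> \<le> (\<Sum>i\<in>F. \<Sum>j\<in>F. (if j = i then prob (A i) else 0) + prob (A i) * prob (A j))"
  proof (intro sum_mono)
    fix i j assume "i \<in> F" "j \<in> F"
    then show "prob (A i \<inter> A j) \<le> (if j = i then prob (A i) else 0) + prob (A i) * prob (A j)"
      using indep by (cases "i = j") auto
  qed
  also have "\<dots> = s + s * s"
    using F by (simp add: sum.distrib s_def sum_product)
  finally have "expectation (\<lambda>\<omega>. (S \<omega>)\<^sup>2) \<le> s + s * s" .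
  then have var: "variance S \<le> s" using variance_eq[OF i1 i2] by (simp add: E1 power2_eq_square)
  have "prob {\<omega> \<in> space M. S \<omega> \<le> c} \<le> prob {\<omega> \<in> space M. s / 2 \<le> \<bar>S \<omega> - expectation S\<bar>}"
  proof (rule finite_measure_mono)
    have "s / 2 \<le> \<bar>x - s\<bar>" if "x \<le> c" for x using that s0 by (simp add: abs_if)
    then show "{\<omega> \<in> space M. S \<omega> \<le> c} \<subseteq> {\<omega> \<in> space M. s / 2 \<le> \<bar>S \<omega> - expectation S\<bar>}"
      unfolding E1 by auto
  qed measurable
  also have "\<dots> \<le> variance S / (s / 2)\<^sup>2"
    by (rule Chebyshev_inequality[OF Sm i2]) (use s0 in simp)
  also have "\<dots> \<le> s / (s / 2)\<^sup>2" using var by (intro divide_right_mono) auto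
  also have "\<dots> = 4 / s" using s0 by (simp add: power2_eq_square)
  finally show "prob {\<omega> \<in> space M. (\<Sum>i\<in>F. indicator (A i) \<omega>) \<le> c} \<le> 4 / (\<Sum>i\<in>F. prob (A i))"
    by (simp add: S_def s_def)
qed

text \<open>The divergence half of Borel-Cantelli by second moments, as only pairs of events are
  known to be independent. Finite subsets replace partial sums since no enumeration of
  \<open>I\<close> is fixed.\<close>

lemma (in prob_space) pairwise_borel_cantelli:
  assumes ev: "\<And>i. i \<in> I \<Longrightarrow> A i \<in> events"
    and indep: "\<And>i j. i \<in> I \<Longrightarrow> j \<in> I \<Longrightarrow> i \<noteq> j \<Longrightarrow> prob (A i \<inter> A j) = prob (A i) * prob (A j)"
    and div: "\<And>c. \<exists>F. finite F \<and> F \<subseteq> I \<and> c \<le> (\<Sum>i\<in>F. prob (A i))"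
  shows "AE \<omega> in M. infinite {i \<in> I. \<omega> \<in> A i}"
proof -
  have "AE \<omega> in M. \<exists>F. finite F \<and> F \<subseteq> I \<and> m < card {i \<in> F. \<omega> \<in> A i}" for m :: nat
  proof -
    have "\<exists>F. finite F \<and> F \<subseteq> I \<and> 2 * real m + real k + 1 \<le> (\<Sum>i\<in>F. prob (A i))" for k :: nat
      by (rule div)
    then obtain F where F: "\<And>k. finite (F k)" "\<And>k. F k \<subseteq> I"
      "\<And>k. 2 * real m + real k + 1 \<le> (\<Sum>i\<in>F k. prob (A i))" by metis
    \<comment> \<open>With mean at least \<open>2 * m + k + 1\<close>, at most \<open>m\<close>
      occurrences among \<open>F k\<close> have probability at most \<open>4 / (k + 1)\<close>; that
      this happens for every \<open>k\<close> is therefore a null event.\<close>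
    define D where "D k = {\<omega> \<in> space M. (\<Sum>i\<in>F k. indicator (A i) \<omega>) \<le> real m}" for k
    have D: "D k \<in> events" "prob (D k) \<le> 4 / real (Suc k)" for k
    proof -
      have s: "2 * real m \<le> (\<Sum>i\<in>F k. prob (A i))" "0 < (\<Sum>i\<in>F k. prob (A i))"
        "real (Suc k) \<le> (\<Sum>i\<in>F k. prob (A i))" using F(3)[of k] by auto
      have A: "\<And>i. i \<in> F k \<Longrightarrow> A i \<in> events"
        "\<And>i j. i \<in> F k \<Longrightarrow> j \<in> F k \<Longrightarrow> i \<noteq> j \<Longrightarrow> prob (A i \<inter> A j) = prob (A i) * prob (A j)"
        using ev indep F(2) by blast+
      note p = prob_pairwise_sum_le[OF F(1) A s(1,2)]
      show "D k \<in> events" unfolding D_def by (rule p(1))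
      have "prob (D k) \<le> 4 / (\<Sum>i\<in>F k. prob (A i))" unfolding D_def by (rule p(2))
      also have "\<dots> \<le> 4 / real (Suc k)" using s by (intro divide_left_mono) auto
      finally show "prob (D k) \<le> 4 / real (Suc k)" .
    qed
    have I: "(\<Inter>k. D k) \<in> events" using D(1) by blast
    have "prob (\<Inter>k. D k) \<le> 4 / real (Suc k)" for k
      using finite_measure_mono[OF _ D(1), of "\<Inter>k. D k" k] D(2)[of k] by force
    moreover have "(\<lambda>k. 4 / real (Suc k)) \<longlonglongrightarrow> 0"
      by (rule LIMSEQ_Suc[OF lim_const_over_n])
    ultimately have "prob (\<Inter>k. D k) \<le> 0"
      by (intro LIMSEQ_le_const[of "\<lambda>k. 4 / real (Suc k)"]) auto
    then have "(\<Inter>k. D k) \<in> null_sets M" using I by (simp add: null_sets_def emeasure_eq_measure measure_le_0_iff)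
    then have "AE \<omega> in M. \<omega> \<notin> (\<Inter>k. D k)" by (rule AE_not_in)
    then show ?thesis using AE_space
    proof eventually_elim
      fix \<omega> assume "\<omega> \<notin> (\<Inter>k. D k)" "\<omega> \<in> space M"
      then obtain k where "real m < (\<Sum>i\<in>F k. indicator (A i) \<omega>)" by (auto simp: D_def not_le)
      also have "(\<Sum>i\<in>F k. indicator (A i) \<omega> :: real) = real (card {i \<in> F k. \<omega> \<in> A i})"
        using F(1)[of k] by (simp add: indicator_def sum.If_cases Int_def)
      finally have "m < card {i \<in> F k. \<omega> \<in> A i}" by simp
      then show "\<exists>F. finite F \<and> F \<subseteq> I \<and> m < card {i \<in> F. \<omega> \<in> A i}" using F(1,2) by blast
    qed
  qed
  then have "AE \<omega> in M. \<forall>m. \<exists>F. finite F \<and> F \<subseteq> I \<and> m < card {i \<in> F. \<omega> \<in> A i}"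
    by (simp add: AE_all_countable)
  then show ?thesis
  proof eventually_elim
    fix \<omega> assume a: "\<forall>m. \<exists>F. finite F \<and> F \<subseteq> I \<and> m < card {i \<in> F. \<omega> \<in> A i}"
    show "infinite {i \<in> I. \<omega> \<in> A i}"
    proof
      assume fin: "finite {i \<in> I. \<omega> \<in> A i}"
      obtain F where "F \<subseteq> I" "card {i \<in> I. \<omega> \<in> A i} < card {i \<in> F. \<omega> \<in> A i}" using a by blast
      moreover have "card {i \<in> F. \<omega> \<in> A i} \<le> card {i \<in> I. \<omega> \<in> A i}"
        using \<open>F \<subseteq> I\<close> by (intro card_mono fin) auto
      ultimately show False by simp
    qed
  qed
qed

text \<open>If the sums of \<open>q\<close> stayed below \<open>d\<close>, only finitely many boxes
  could have \<open>y > 1\<close>, each contributing at least \<open>1 / 5\<close>; on the others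
  \<open>m^2 <= c^2 * y^2 <= 5 * c^2 * q\<close>. The squares of \<open>m\<close> would then have a
  finite sum. The 5 is \<open>2 + 2 + 1\<close>, the denominator at \<open>y = 1\<close>.\<close>

lemma box_sums_unbounded:
  fixes m y q :: "nat \<times> nat \<Rightarrow> real"
  assumes div: "(\<Sum>n. \<Sum>k<2 ^ n. ennreal ((m (n, k))\<^sup>2)) = \<infinity>"
    and m: "\<And>b. 0 \<le> m b" "\<And>b. m b \<le> c * y b" and y: "\<And>b. 0 \<le> y b"
    and q: "\<And>b. (y b)\<^sup>2 / (2 + 2 * y b + (y b)\<^sup>2) \<le> q b"
  shows "\<exists>F. finite F \<and> F \<subseteq> box_index \<and> d \<le> (\<Sum>b\<in>F. q b)"
proof (rule ccontr)
  assume neg: "\<not> (\<exists>F. finite F \<and> F \<subseteq> box_index \<and> d \<le> (\<Sum>b\<in>F. q b))"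
  have bd: "(\<Sum>b\<in>F. q b) < d" if "finite F" "F \<subseteq> box_index" for F
  proof (rule ccontr)
    assume "\<not> (\<Sum>b\<in>F. q b) < d"
    then have "d \<le> (\<Sum>b\<in>F. q b)" by simp
    with neg that show False by blast
  qed
  have pos: "0 < 2 + 2 * y b + (y b)\<^sup>2" for b using y[of b] by (simp add: add_pos_nonneg)
  have q0: "0 \<le> q b" for b
  proof -
    have "0 \<le> (y b)\<^sup>2 / (2 + 2 * y b + (y b)\<^sup>2)" using pos[of b] by (simp add: less_imp_le)
    then show ?thesis using q[of b] by (rule order.trans)
  qed
  have small: "(y b)\<^sup>2 \<le> 5 * q b" if "y b \<le> 1" for b
  proof -
    have "(y b)\<^sup>2 \<le> 1" using that y[of b] by (simp add: abs_square_le_1)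
    then have "(y b)\<^sup>2 / 5 \<le> (y b)\<^sup>2 / (2 + 2 * y b + (y b)\<^sup>2)"
      using that pos[of b] by (intro divide_left_mono) auto
    then have "(y b)\<^sup>2 / 5 \<le> q b" using q[of b] by (rule order.trans)
    then show ?thesis by simp
  qed
  have large: "1 / 5 \<le> q b" if "1 < y b" for b
  proof -
    have "y b * 1 \<le> y b * y b" using that by (intro mult_left_mono) auto
    then have "y b \<le> (y b)\<^sup>2" by (simp only: power2_eq_square mult_1_right)
    then have "2 + 2 * y b + (y b)\<^sup>2 \<le> 5 * (y b)\<^sup>2" using that by linarith
    then have "1 / 5 \<le> (y b)\<^sup>2 / (2 + 2 * y b + (y b)\<^sup>2)"
      using pos[of b] by (simp add: pos_le_divide_eq)
    then show ?thesis using q[of b] by (rule order.trans)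
  qed
  define G where "G = {b \<in> box_index. 1 < y b}"
  have G: "finite G"
  proof (rule ccontr)
    assume "infinite G"
    then obtain F where F: "finite F" "card F = nat \<lceil>5 * d\<rceil>" "F \<subseteq> G"
      using infinite_arbitrarily_large by blast
    have "d \<le> real (card F) * (1 / 5)" unfolding F(2) by linarith
    also have "\<dots> = (\<Sum>b\<in>F. 1 / 5)" by simp
    also have "\<dots> \<le> (\<Sum>b\<in>F. q b)" using F(3) large by (intro sum_mono) (auto simp: G_def)
    also have "\<dots> < d" using F by (intro bd) (auto simp: G_def)
    finally show False by simp
  qed
  have qfin: "(\<integral>\<^sup>+b. ennreal (q b) * indicator box_index b \<partial>count_space UNIV) \<le> ennreal d"
  proof -
    have "(\<Sum>n<N. \<Sum>k<2 ^ n. ennreal (q (n, k))) \<le> ennreal d" for N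
    proof -
      define F where "F = (SIGMA n:{..<N}. {..<(2::nat) ^ n})"
      have "(\<Sum>n<N. \<Sum>k<2 ^ n. ennreal (q (n, k))) = (\<Sum>b\<in>F. ennreal (q b))"
        unfolding F_def by (subst sum.Sigma) auto
      also have "\<dots> = ennreal (\<Sum>b\<in>F. q b)" by (simp add: q0)
      also have "\<dots> \<le> ennreal d"
      proof -
        have "finite F" "F \<subseteq> box_index" by (auto simp: F_def box_index_def)
        from bd[OF this] show ?thesis by (intro ennreal_leI) simp
      qed
      finally show ?thesis .
    qed
    then show ?thesis
      by (subst nn_integral_box_index) (simp add: suminf_eq_SUP SUP_le_iff)
  qed
  have "(\<Sum>n. \<Sum>k<2 ^ n. ennreal ((m (n, k))\<^sup>2)) = (\<integral>\<^sup>+b. ennreal ((m b)\<^sup>2) * indicator box_index b \<partial>count_space UNIV)"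
    by (rule nn_integral_box_index[symmetric])
  also have "\<dots> \<le> (\<integral>\<^sup>+b. ennreal (5 * c\<^sup>2) * (ennreal (q b) * indicator box_index b) + ennreal ((m b)\<^sup>2) * indicator G b \<partial>count_space UNIV)"
  proof (rule nn_integral_mono)
    fix b
    show "ennreal ((m b)\<^sup>2) * indicator box_index b \<le> ennreal (5 * c\<^sup>2) * (ennreal (q b) * indicator box_index b) + ennreal ((m b)\<^sup>2) * indicator G b"
    proof (cases "b \<in> box_index \<and> b \<notin> G")
      case True
      then have "y b \<le> 1" by (auto simp: G_def)
      have "(m b)\<^sup>2 \<le> (c * y b)\<^sup>2" using m by (intro power_mono) auto
      also have "\<dots> = c\<^sup>2 * (y b)\<^sup>2" by (rule power_mult_distrib)
      also have "\<dots> \<le> c\<^sup>2 * (5 * q b)" using small[OF \<open>y b \<le> 1\<close>] by (intro mult_left_mono) auto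
      finally have "ennreal ((m b)\<^sup>2) \<le> ennreal (5 * c\<^sup>2 * q b)" by (intro ennreal_leI) (simp add: mult_ac)
      also have "\<dots> = ennreal (5 * c\<^sup>2) * ennreal (q b)" by (intro ennreal_mult q0) simp
      finally show ?thesis using True by simp
    next
      case False
      then show ?thesis by (cases "b \<in> G") (auto simp: G_def intro!: add_increasing)
    qed
  qed
  also have "\<dots> = ennreal (5 * c\<^sup>2) * (\<integral>\<^sup>+b. ennreal (q b) * indicator box_index b \<partial>count_space UNIV) + (\<Sum>b\<in>G. ennreal ((m b)\<^sup>2))"
  proof -
    have "(\<integral>\<^sup>+b. ennreal ((m b)\<^sup>2) * indicator G b \<partial>count_space UNIV) = (\<Sum>b\<in>G. ennreal ((m b)\<^sup>2) * indicator G b)"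
      by (rule nn_integral_count_space') (use G in auto)
    then show ?thesis by (simp add: nn_integral_add nn_integral_cmult)
  qed
  also have "\<dots> < \<infinity>"
  proof -
    have "(\<integral>\<^sup>+b. ennreal (q b) * indicator box_index b \<partial>count_space UNIV) < \<infinity>"
      using qfin by (rule order.strict_trans1) simp
    then show ?thesis using G by (simp add: ennreal_mult_less_top)
  qed
  finally show False using div by simp
qed

section \<open>Close pairs of random points\<close>

context disk_poisson_process
begin

lemma heavy_sub_box:
  assumes L: "0 < L"
  shows "\<exists>B. B \<in> sets borel \<and> B \<subseteq> dbox b \<and> measure \<mu> (dbox b) \<le> (real L)\<^sup>2 * measure \<mu> B \<and>
    (\<forall>z\<in>B. \<forall>w\<in>B. cmod (z - w) \<le> 8 / (real L * 2 ^ fst b))"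
proof -
  obtain R :: "nat \<times> nat \<Rightarrow> complex set" where R: "\<And>p. R p \<in> sets borel"
    "dbox b = (\<Union>p\<in>{..<L} \<times> {..<L}. R p)"
    "\<And>p z w. p \<in> {..<L} \<times> {..<L} \<Longrightarrow> z \<in> R p \<Longrightarrow> w \<in> R p \<Longrightarrow> cmod (z - w) \<le> 8 / (real L * 2 ^ fst b)"
    using dyadic_box_subdivision[OF L, of "fst b" "snd b"] unfolding dbox_def by metis
  define P where "P = {..<L} \<times> {..<L}"
  have P: "finite P" "P \<noteq> {}" "real (card P) = (real L)\<^sup>2" using L by (auto simp: P_def power2_eq_square)
  have Rb: "R p \<subseteq> dbox b" if "p \<in> P" for p using R(2) that by (auto simp: P_def)
  have "\<exists>p\<in>P. measure \<mu> (dbox b) \<le> (real L)\<^sup>2 * measure \<mu> (R p)"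
  proof (rule ccontr)
    assume "\<not> ?thesis"
    then have lt: "(real L)\<^sup>2 * measure \<mu> (R p) < measure \<mu> (dbox b)" if "p \<in> P" for p using that by force
    have sets: "R p \<in> sets \<mu>" if "p \<in> P" for p
      by (rule in_sets_mu[OF R(1)]) (use Rb[OF that] dbox_subset[of b] in blast)
    have "(real L)\<^sup>2 * measure \<mu> (dbox b) \<le> (real L)\<^sup>2 * (\<Sum>p\<in>P. measure \<mu> (R p))"
      unfolding R(2) P_def[symmetric] using P sets by (intro mult_left_mono measure_UNION_le) auto
    also have "\<dots> = (\<Sum>p\<in>P. (real L)\<^sup>2 * measure \<mu> (R p))" by (rule sum_distrib_left)
    also have "\<dots> < (\<Sum>p\<in>P. measure \<mu> (dbox b))" by (rule sum_strict_mono[OF P(1,2) lt])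
    also have "\<dots> = (real L)\<^sup>2 * measure \<mu> (dbox b)" by (simp add: P(3))
    finally show False by simp
  qed
  then obtain p where p: "p \<in> P" "measure \<mu> (dbox b) \<le> (real L)\<^sup>2 * measure \<mu> (R p)" by blast
  show ?thesis
    by (intro exI[of _ "R p"] conjI ballI R(1) Rb p R(3)) (use p(1) in \<open>auto simp: P_def\<close>)
qed

text \<open>The sub-boxes lose at most a factor \<open>L^2\<close> of mass, so their counts still
  satisfy the divergence criterion for each fixed \<open>L\<close>. Sub-boxes of different boxes are
  disjoint, which gives pairwise independence.\<close>

lemma AE_close_pairs:
  assumes L: "0 < L" and div: "(\<Sum>n. \<Sum>k<2 ^ n. (emeasure \<mu> (dyadic_box n k))\<^sup>2) = \<infinity>"
  shows "AE \<omega> in M. infinite {b \<in> box_index. \<exists>i j. i \<noteq> j \<and> X i \<omega> \<in> dbox b \<and> X j \<omega> \<in> dbox b \<and>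
     cmod (X i \<omega> - X j \<omega>) \<le> 8 / (real L * 2 ^ fst b)}"
proof -
  from heavy_sub_box[OF L] obtain B where B: "\<And>b. B b \<in> sets borel" "\<And>b. B b \<subseteq> dbox b"
    "\<And>b. measure \<mu> (dbox b) \<le> (real L)\<^sup>2 * measure \<mu> (B b)"
    "\<And>b z w. z \<in> B b \<Longrightarrow> w \<in> B b \<Longrightarrow> cmod (z - w) \<le> 8 / (real L * 2 ^ fst b)" by metis
  define A where "A b = {\<omega> \<in> space M. 2 \<le> point_count X (B b) \<omega>}" for b
  note cp = count_poisson[OF B(1,2)]
  note [measurable] = poisson_measurable[OF prob_space_axioms measure_nonneg cp]
  have ev: "A b \<in> events" for b unfolding A_def by measurable
  have div': "(\<Sum>n. \<Sum>k<2 ^ n. ennreal ((measure \<mu> (dbox (n, k)))\<^sup>2)) = \<infinity>"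
  proof -
    have "(emeasure \<mu> (dyadic_box n k))\<^sup>2 = ennreal ((measure \<mu> (dbox (n, k)))\<^sup>2)" for n k
      using box_finite[OF dbox_borel order_refl, of "(n, k)"] by (simp add: dbox_def ennreal_power)
    then show ?thesis using div by simp
  qed
  have "AE \<omega> in M. infinite {b \<in> box_index. \<omega> \<in> A b}"
  proof (rule pairwise_borel_cantelli[OF ev])
    show "\<exists>F. finite F \<and> F \<subseteq> box_index \<and> c \<le> (\<Sum>b\<in>F. prob (A b))" for c
      by (rule box_sums_unbounded[OF div' measure_nonneg B(3) measure_nonneg])
         (use poisson_prob_ge_2[OF prob_space_axioms measure_nonneg cp] in \<open>simp add: A_def\<close>)
    fix a b assume ab: "a \<in> box_index" "b \<in> box_index" "a \<noteq> b"
    have "B a \<inter> B b = {}" using dbox_unique[OF _ _ ab(1,2)] ab(3) B(2) by blast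
    from indep_varD[OF count_indep[OF B(1) B(1) B(2) B(2) this], of "{2..}" "{2..}"]
    show "prob (A a \<inter> A b) = prob (A a) * prob (A b)"
    proof -
      have "(\<lambda>\<omega>. (point_count X (B a) \<omega>, point_count X (B b) \<omega>)) -` ({2..} \<times> {2..}) \<inter> space M = A a \<inter> A b"
        "point_count X (B a) -` {2..} \<inter> space M = A a" "point_count X (B b) -` {2..} \<inter> space M = A b"
        by (auto simp: A_def)
      with indep_varD[OF count_indep[OF B(1) B(1) B(2) B(2) \<open>B a \<inter> B b = {}\<close>], of "{2..}" "{2..}"]
      show ?thesis by simp
    qed
  qed
  then show ?thesis
  proof eventually_elim
    fix \<omega> assume inf: "infinite {b \<in> box_index. \<omega> \<in> A b}"
    have sub: "{b \<in> box_index. \<omega> \<in> A b} \<subseteq> {b \<in> box_index. \<exists>i j. i \<noteq> j \<and> X i \<omega> \<in> dbox b \<and> X j \<omega> \<in> dbox b \<and>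
       cmod (X i \<omega> - X j \<omega>) \<le> 8 / (real L * 2 ^ fst b)}"
    proof (intro subsetI CollectI conjI; elim CollectE conjE)
      fix b assume b: "b \<in> box_index" "\<omega> \<in> A b"
      define S where "S = B b \<inter> range (\<lambda>n. X n \<omega>)"
      \<comment> \<open>\<open>point_count\<close> counts points rather than indices, so a count of
        at least 2 supplies two different points and hence two different indices.\<close>
      have S2: "2 \<le> emeasure (count_space UNIV) S" using b(2) by (simp add: A_def point_count_def S_def)
      have "\<exists>z w. z \<in> S \<and> w \<in> S \<and> z \<noteq> w"
      proof (rule ccontr)
        assume "\<not> ?thesis"
        then obtain z where "S \<subseteq> {z}" by blast
        then have "emeasure (count_space UNIV) S \<le> emeasure (count_space UNIV) {z}" by (intro emeasure_mono) auto
        also have "\<dots> = 1" by (simp add: emeasure_count_space_finite)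
        finally have "(2::ennreal) \<le> 1" using S2 by (rule order.trans[rotated])
        then show False by simp
      qed
      then obtain z w where zw: "z \<in> S" "w \<in> S" "z \<noteq> w" by blast
      then obtain i j where ij: "z = X i \<omega>" "w = X j \<omega>" by (auto simp: S_def)
      have zwB: "z \<in> B b" "w \<in> B b" using zw by (auto simp: S_def)
      show "\<exists>i j. i \<noteq> j \<and> X i \<omega> \<in> dbox b \<and> X j \<omega> \<in> dbox b \<and> cmod (X i \<omega> - X j \<omega>) \<le> 8 / (real L * 2 ^ fst b)"
        using zw(3) subsetD[OF B(2) zwB(1)] subsetD[OF B(2) zwB(2)] B(4)[OF zwB] unfolding ij
        by (intro exI[of _ i] exI[of _ j]) auto
    qed
    show "infinite {b \<in> box_index. \<exists>i j. i \<noteq> j \<and> X i \<omega> \<in> dbox b \<and> X j \<omega> \<in> dbox b \<and>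
       cmod (X i \<omega> - X j \<omega>) \<le> 8 / (real L * 2 ^ fst b)}"
      using infinite_super[OF sub inf] .
  qed
qed

end

text \<open>The mean value inequality is applied on a disk around 0 containing the box, which itself
  need not be convex; on that disk \<open>1 - (cmod x)^2\<close> is at least
  \<open>1 / 2 ^ (n + 1)\<close>.\<close>

lemma fun_of_diff_le:
  assumes a: "0 < a" "a < 1" and u: "u \<in> ell2" and z: "z \<in> dbox b" and w: "w \<in> dbox b"
  shows "cmod (fun_of a u z - fun_of a u w) \<le>
    sqrt (sqn u * (a + 1)) * 2 powr (real (fst b + 1) * (a + 2) / 2) * cmod (z - w)"
proof -
  define n where "n = fst b"
  define rho where "rho = 1 - 1 / (2::real) ^ (n + 1)"
  have rho: "rho < 1" by (simp add: rho_def)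
  have zS: "z \<in> ball 0 rho" "w \<in> ball 0 rho"
    using dyadic_box_norm(1)[of z "fst b" "snd b"] dyadic_box_norm(1)[of w "fst b" "snd b"] z w
    by (auto simp: dbox_def rho_def n_def)
  have hol: "fun_of a u holomorphic_on unit_disk"
    by (rule power_series_holomorphic_disk[OF fun_of_sums[OF a _ u]])
  have "cmod (fun_of a u z - fun_of a u w) \<le> (sqrt (sqn u * (a + 1)) * 2 powr (real (n + 1) * (a + 2) / 2)) * cmod (z - w)"
  proof (rule field_differentiable_bound[OF convex_ball _ _ zS])
    fix x :: complex assume x: "x \<in> ball 0 rho"
    then have x1: "cmod x < 1" using rho by simp
    show "(fun_of a u has_field_derivative deriv (fun_of a u) x) (at x within ball 0 rho)"
      using holomorphic_derivI[OF hol open_ball, of x] x1 by (simp add: has_field_derivative_at_within)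
    have "1 / 2 ^ (n + 1) \<le> 1 - (cmod x)\<^sup>2"
    proof -
      have "(cmod x)\<^sup>2 \<le> cmod x" using x1 by (simp add: power2_eq_square mult_left_le)
      then show ?thesis using x by (simp add: rho_def)
    qed
    moreover have "(1::real) / 2 ^ (n + 1) = 2 powr (- real (n + 1))"
      by (simp only: powr_minus_divide powr_realpow[OF zero_less_numeral])
    ultimately have "(1 - (cmod x)\<^sup>2) powr (- (a + 2)) \<le> (2 powr (- real (n + 1))) powr (- (a + 2))"
      using a by (intro powr_mono2') auto
    also have "\<dots> = (2 powr (real (n + 1) * (a + 2) / 2))\<^sup>2"
      by (simp add: powr_powr power2_eq_square powr_add[symmetric] algebra_simps add_divide_distrib)
    finally have p: "(1 - (cmod x)\<^sup>2) powr (- (a + 2)) \<le> (2 powr (real (n + 1) * (a + 2) / 2))\<^sup>2" .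
    have su: "0 \<le> sqn u * (a + 1)" using sqn_nonneg[OF u] a by simp
    have "(cmod (deriv (fun_of a u) x))\<^sup>2 \<le> (sqn u * (a + 1)) * (1 - (cmod x)\<^sup>2) powr (- (a + 2))"
      using deriv_fun_of_bound[OF a u x1] by (simp add: mult.assoc)
    also have "\<dots> \<le> (sqn u * (a + 1)) * (2 powr (real (n + 1) * (a + 2) / 2))\<^sup>2"
      by (intro mult_left_mono p su)
    also have "\<dots> = (sqrt (sqn u * (a + 1)) * 2 powr (real (n + 1) * (a + 2) / 2))\<^sup>2"
      using su by (simp add: power_mult_distrib)
    finally show "norm (deriv (fun_of a u) x) \<le> sqrt (sqn u * (a + 1)) * 2 powr (real (n + 1) * (a + 2) / 2)"
      by (rule power2_le_imp_le) (use su in auto)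
  qed
  then show ?thesis by (simp add: n_def)
qed

text \<open>In generation \<open>n\<close> one has \<open>1 - (cmod z)^2 <= 2 * (1 / 2 ^ n)\<close>;
  the factor 2 is the shift to \<open>n - 1\<close> in the exponent.\<close>

lemma sqrt_sqn_ev_ge:
  assumes a: "0 < a" "a < 1" and z: "z \<in> dbox b"
  shows "2 powr ((real (fst b) - 1) * a / 2) \<le> sqrt (sqn (ev a z))"
proof -
  define n where "n = fst b"
  note zn = dyadic_box_norm[OF z[unfolded dbox_def], folded n_def]
  have "0 < 1 - (cmod z)\<^sup>2" using zn(3) by (simp add: abs_square_less_1)
  moreover have "1 - (cmod z)\<^sup>2 \<le> 2 powr (1 - real n)"
  proof -
    have "1 - (cmod z)\<^sup>2 = (1 - cmod z) * (1 + cmod z)" by (simp add: power2_eq_square algebra_simps)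
    also have "\<dots> \<le> (1 / 2 ^ n) * 2" using zn by (intro mult_mono) auto
    also have "\<dots> = 2 powr (1 - real n)" by (simp add: powr_diff powr_realpow)
    finally show ?thesis .
  qed
  ultimately have "(2 powr (1 - real n)) powr (- a) \<le> (1 - (cmod z)\<^sup>2) powr (- a)"
    using a by (intro powr_mono2') auto
  also have "\<dots> \<le> sqn (ev a z)" by (rule ev_ell2(3)[OF a zn(3)])
  also have "(2 powr (1 - real n)) powr (- a) = (2 powr ((real n - 1) * a / 2))\<^sup>2"
    by (simp add: powr_powr power2_eq_square powr_add[symmetric] algebra_simps add_divide_distrib diff_divide_distrib)
  finally show ?thesis unfolding n_def by (rule real_le_rsqrt)
qed

text \<open>Choosing along strictly increasing codes makes the choices distinct; applied to boxes,
  it keeps pairs chosen at different scales disjoint.\<close>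

lemma infinite_distinct_choice:
  fixes S :: "nat \<Rightarrow> 'a::countable set"
  assumes "\<And>p. infinite (S p)"
  shows "\<exists>f. inj f \<and> (\<forall>p. f p \<in> S p)"
proof -
  have ex: "\<exists>y. y \<in> S p \<and> N < to_nat y" for p N
  proof (rule ccontr)
    assume "\<not> ?thesis"
    then have "to_nat ` S p \<subseteq> {..N}" by (auto simp: not_less)
    then have "finite (to_nat ` S p)" by (rule finite_subset) simp
    then have "finite (S p)" by (rule finite_imageD) (simp add: inj_on_def)
    then show False using assms by blast
  qed
  have "\<exists>f. \<forall>p. f p \<in> S p \<and> to_nat (f p) < to_nat (f (Suc p))"
    by (rule dependent_nat_choice) (use ex in blast)+
  then obtain f where f: "\<And>p. f p \<in> S p" "\<And>p. to_nat (f p) < to_nat (f (Suc p))" by blast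
  have "strict_mono (\<lambda>p. to_nat (f p))" using f(2) by (simp add: strict_mono_Suc_iff)
  then have "inj (\<lambda>p. to_nat (f p))" by (rule strict_mono_imp_inj_on)
  then have "inj f" by (auto simp: inj_on_def)
  then show ?thesis using f(1) by blast
qed

text \<open>A function with the values \<open>1 / 2 ^ p\<close> and \<open>0\<close> (relative to the kernel norms) at points of a box
  with relative distance \<open>8 / 8 ^ p\<close> has norm at least a multiple of \<open>4 ^ p\<close>.\<close>

lemma not_interpolating_close_pairs:
  assumes a: "0 < a" "a < 1"
    and inf: "\<And>L. 0 < L \<Longrightarrow> infinite {b \<in> box_index. \<exists>i j. i \<noteq> j \<and> l i \<in> dbox b \<and> l j \<in> dbox b \<and>
       cmod (l i - l j) \<le> 8 / (real L * 2 ^ fst b)}"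
  shows "\<not> interpolating a l"
proof
  assume "interpolating a l"
  then have l1: "range l \<subseteq> unit_disk" and onto: "(\<lambda>u n. ip u (nev a (l n))) ` ell2 = ell2"
    unfolding interpolating_iff[OF a] by auto
  have l1': "cmod (l n) < 1" for n using subsetD[OF l1, of "l n"] by simp
  define S where "S p = {b \<in> box_index. \<exists>i j. i \<noteq> j \<and> l i \<in> dbox b \<and> l j \<in> dbox b \<and>
       cmod (l i - l j) \<le> 8 / (real (8 ^ p) * 2 ^ fst b)}" for p :: nat
  have "infinite (S p)" for p unfolding S_def by (rule inf) simp
  then obtain b where b: "inj b" "\<And>p. b p \<in> S p" using infinite_distinct_choice[of S] by blast
  have bI: "b p \<in> box_index" for p using b(2)[of p] by (simp add: S_def)
  have "\<forall>p. \<exists>ij. fst ij \<noteq> snd ij \<and> l (fst ij) \<in> dbox (b p) \<and> l (snd ij) \<in> dbox (b p) \<and>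
       cmod (l (fst ij) - l (snd ij)) \<le> 8 / (8 ^ p * 2 ^ fst (b p))"
    using b(2) unfolding S_def by fastforce
  then obtain ij where ij: "\<And>p. fst (ij p) \<noteq> snd (ij p)" "\<And>p. l (fst (ij p)) \<in> dbox (b p)"
    "\<And>p. l (snd (ij p)) \<in> dbox (b p)" "\<And>p. cmod (l (fst (ij p)) - l (snd (ij p))) \<le> 8 / (8 ^ p * 2 ^ fst (b p))"
    by metis
  define i where "i p = fst (ij p)" for p
  define j where "j p = snd (ij p)" for p
  \<comment> \<open>Pairs chosen for different \<open>p\<close> lie in different boxes and share no
    point, so the values prescribed below are consistent.\<close>
  have same: "p = q" if "l m \<in> dbox (b p)" "l m \<in> dbox (b q)" for m p q
    using dbox_unique[OF that bI bI] b(1) by (simp add: inj_eq)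
  have inj_i: "inj i"
  proof (rule injI)
    fix p q assume "i p = i q"
    then show "p = q" using same[of "i p" p q] ij(2)[of p] ij(2)[of q] by (simp add: i_def)
  qed
  have ji: "j p \<noteq> i q" for p q
  proof
    assume e: "j p = i q"
    have "p = q" by (rule same[of "j p"]) (use ij(2)[of q] ij(3)[of p] e in \<open>auto simp: i_def j_def\<close>)
    then show False using e ij(1)[of p] by (simp add: i_def j_def)
  qed
  \<comment> \<open>The value \<open>(1 / 2) ^ p\<close> is square summable over \<open>p\<close>,
    yet decays more slowly than the relative distance \<open>8 / 8 ^ p\<close>. All other indices
    get 0, among them the second points of the pairs.\<close>
  define t where "t n = (if n \<in> range i then (1 / 2) ^ (inv i n) else (0::complex))" for n
  have ti: "t (i p) = (1 / 2) ^ p" for p using inj_i by (simp add: t_def)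
  have tj: "t (j p) = 0" for p using ji by (auto simp: t_def)
  have "(\<Sum>n<N. (cmod (t n))\<^sup>2) \<le> (\<Sum>p. (1 / 4) ^ p)" for N
  proof -
    define P where "P = {p. i p < N}"
    have P: "finite P" using finite_vimageI[OF finite_lessThan[of N] inj_i] by (simp add: P_def vimage_def)
    have "(\<Sum>n<N. (cmod (t n))\<^sup>2) = (\<Sum>n\<in>i ` P. (cmod (t n))\<^sup>2)"
      by (rule sum.mono_neutral_right) (auto simp: P_def t_def)
    also have "\<dots> = (\<Sum>p\<in>P. (1 / 4) ^ p)"
    proof -
      have "(cmod (t (i p)))\<^sup>2 = (1 / 4) ^ p" for p
        by (simp add: ti norm_power norm_divide power_divide) (simp add: power2_eq_square power_mult_distrib[symmetric])
      moreover have "inj_on i P" using inj_i by (rule inj_on_subset) simp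
      ultimately show ?thesis by (simp add: sum.reindex)
    qed
    also have "\<dots> \<le> (\<Sum>p. (1 / 4) ^ p)" using P by (intro sum_le_suminf summable_geometric) auto
    finally show ?thesis .
  qed
  then have "t \<in> ell2" by (rule ell2_bounded_sums)
  then have "t \<in> (\<lambda>u n. ip u (nev a (l n))) ` ell2" using onto by simp
  then obtain u where u: "u \<in> ell2" "t = (\<lambda>n. ip u (nev a (l n)))" by blast
  have val: "fun_of a u (l n) = t n * of_real (sqrt (sqn (ev a (l n))))" for n
    using nev_props(2)[OF a l1' u(1), of n] ev_ell2(4)[OF a l1', of n] by (simp add: u(2))
  define D where "D = sqrt (sqn u * (a + 1))"
  have D0: "0 \<le> D" using sqn_nonneg[OF u(1)] a by (simp add: D_def)
  have key: "4 ^ p \<le> D * 8 * 2 powr (1 + a)" for p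
  proof -
    define n where "n = real (fst (b p))"
    define V where "V = 2 powr ((n - 1) * a / 2)"
    have V: "0 < V" by (simp add: V_def)
    have "(1 / 2) ^ p * V \<le> (1 / 2) ^ p * sqrt (sqn (ev a (l (i p))))"
      unfolding V_def n_def using sqrt_sqn_ev_ge[OF a ij(2)[of p]] by (intro mult_left_mono) (auto simp: i_def)
    also have "\<dots> = cmod (fun_of a u (l (i p)) - fun_of a u (l (j p)))"
      using ev_ell2(4)[OF a l1', of "i p"] by (simp add: val ti tj norm_mult norm_power norm_divide)
    also have "\<dots> \<le> D * 2 powr ((n + 1) * (a + 2) / 2) * cmod (l (i p) - l (j p))"
      using fun_of_diff_le[OF a u(1) ij(2)[of p] ij(3)[of p]] by (simp add: D_def n_def i_def j_def add.commute)
    also have "\<dots> \<le> D * 2 powr ((n + 1) * (a + 2) / 2) * (8 / (8 ^ p * 2 ^ fst (b p)))"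
      using ij(4)[of p] D0 by (intro mult_left_mono) (auto simp: i_def j_def)
    also have "\<dots> = D * 8 * (2 powr ((n + 1) * (a + 2) / 2) * 2 powr (- n)) / 8 ^ p"
    proof -
      have "2 powr (- n) = 1 / 2 ^ fst (b p)" by (simp add: n_def powr_minus_divide powr_realpow)
      then show ?thesis by (simp only:) (simp add: mult_ac)
    qed
    \<comment> \<open>The generation cancels: growth of the derivative times the size of the box
      equals the kernel norm scale \<open>V\<close> up to the constant
      \<open>2 powr (1 + a)\<close>.\<close>
    also have "2 powr ((n + 1) * (a + 2) / 2) * 2 powr (- n) = 2 powr (1 + a) * V"
      unfolding V_def powr_add[symmetric] by (simp add: field_simps)
    finally have "(1 / 2) ^ p * V \<le> (D * 8 * 2 powr (1 + a) / 8 ^ p) * V" by (simp add: mult_ac)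
    then have "(1 / 2) ^ p \<le> D * 8 * 2 powr (1 + a) / 8 ^ p" using V by (simp only: mult_le_cancel_right_pos)
    then have "(1 / 2) ^ p * 8 ^ p \<le> D * 8 * 2 powr (1 + a)" by (simp add: pos_le_divide_eq)
    moreover have "(1 / 2) ^ p * 8 ^ p = (4::real) ^ p" by (simp flip: power_mult_distrib)
    ultimately show ?thesis by simp
  qed
  obtain p where "D * 8 * 2 powr (1 + a) < 4 ^ p" using real_arch_pow[of 4 "D * 8 * 2 powr (1 + a)"] by auto
  then show False using key[of p] by simp
qed

text \<open>The exceptional null sets for the countably many \<open>L\<close> are united, so almost
  every path has close pairs at every scale.\<close>

lemma (in disk_poisson_process) AE_not_interpolating:
  assumes a: "0 < a" "a < 1" and div: "(\<Sum>n. \<Sum>k<2 ^ n. (emeasure \<mu> (dyadic_box n k))\<^sup>2) = \<infinity>"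
  shows "AE \<omega> in M. \<not> interpolating a (\<lambda>n. X n \<omega>)"
proof -
  have "AE \<omega> in M. \<forall>L. 0 < L \<longrightarrow> infinite {b \<in> box_index. \<exists>i j. i \<noteq> j \<and> X i \<omega> \<in> dbox b \<and> X j \<omega> \<in> dbox b \<and>
       cmod (X i \<omega> - X j \<omega>) \<le> 8 / (real L * 2 ^ fst b)}"
    unfolding AE_all_countable using AE_close_pairs[OF _ div] by auto
  then show ?thesis
    by eventually_elim (intro not_interpolating_close_pairs a, blast)
qed

theorem theorem3p5:
  fixes M :: "'w measure" and \<mu> :: "complex measure"
    and \<Lambda> :: "nat \<Rightarrow> 'w \<Rightarrow> complex" and \<alpha> :: real
  assumes "sets \<mu> = sets (restrict_space borel unit_disk)"
    and "sigma_finite_measure \<mu>"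
    and "locally_finite_on_disk \<mu>"
    and "emeasure \<mu> unit_disk = \<infinity>"
    and "poisson_process M \<mu> \<Lambda>"
  shows
    "(1 / 2 < \<alpha> \<and> \<alpha> < 1 \<longrightarrow>
        ((\<Sum>n. \<Sum>k<2 ^ n. (emeasure \<mu> (dyadic_box n k))\<^sup>2) < \<infinity> \<longrightarrow>
           (AE \<omega> in M. interpolating \<alpha> (\<lambda>n. \<Lambda> n \<omega>))) \<and>
        ((\<Sum>n. \<Sum>k<2 ^ n. (emeasure \<mu> (dyadic_box n k))\<^sup>2) = \<infinity> \<longrightarrow>
           (AE \<omega> in M. \<not> interpolating \<alpha> (\<lambda>n. \<Lambda> n \<omega>)))) \<and>
     (0 \<le> \<alpha> \<and> \<alpha> < 1 / 2 \<and>
        (\<exists>\<gamma>. 1 < \<gamma> \<and> \<gamma> < 1 / (1 - \<alpha>) \<and>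
           (\<Sum>n. \<Sum>k<2 ^ n. ennreal (measure \<mu> (dyadic_box n k) powr \<gamma>)) < \<infinity>) \<longrightarrow>
        (AE \<omega> in M. interpolating \<alpha> (\<lambda>n. \<Lambda> n \<omega>)))"
proof -
  interpret disk_poisson_process M \<mu> \<Lambda>
    using assms by unfold_locales
  \<comment> \<open>Boxes have finite mass, so the squares in the first part are the powers with
    exponent 2 in \<open>AE_interpolating\<close>.\<close>
  have sq: "(emeasure \<mu> (dyadic_box n k))\<^sup>2 = ennreal (measure \<mu> (dyadic_box n k) powr 2)" for n k
    using box_finite[OF dbox_borel order_refl, of "(n, k)"] by (simp add: dbox_def ennreal_power)
  show ?thesis
  proof (intro conjI impI)
    assume a: "1 / 2 < \<alpha> \<and> \<alpha> < 1"
      and "(\<Sum>n. \<Sum>k<2 ^ n. (emeasure \<mu> (dyadic_box n k))\<^sup>2) < \<infinity>"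
    then show "AE \<omega> in M. interpolating \<alpha> (\<lambda>n. \<Lambda> n \<omega>)"
      by (intro AE_interpolating[of 2]) (auto simp: sq)
  next
    assume a: "1 / 2 < \<alpha> \<and> \<alpha> < 1"
      and "(\<Sum>n. \<Sum>k<2 ^ n. (emeasure \<mu> (dyadic_box n k))\<^sup>2) = \<infinity>"
    then show "AE \<omega> in M. \<not> interpolating \<alpha> (\<lambda>n. \<Lambda> n \<omega>)"
      by (intro AE_not_interpolating) auto
  next
    assume a: "0 \<le> \<alpha> \<and> \<alpha> < 1 / 2 \<and> (\<exists>\<gamma>. 1 < \<gamma> \<and> \<gamma> < 1 / (1 - \<alpha>) \<and>
           (\<Sum>n. \<Sum>k<2 ^ n. ennreal (measure \<mu> (dyadic_box n k) powr \<gamma>)) < \<infinity>)"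
    then obtain \<gamma> where g: "1 < \<gamma>" "\<gamma> < 1 / (1 - \<alpha>)"
      "(\<Sum>n. \<Sum>k<2 ^ n. ennreal (measure \<mu> (dyadic_box n k) powr \<gamma>)) < \<infinity>" by blast
    have g1: "\<gamma> * (1 - \<alpha>) < 1" using g(2) a by (simp add: pos_less_divide_eq)
    \<comment> \<open>At 0 the admissible range for the exponent is empty, so the positivity
      required of the weight holds.\<close>
    have "\<alpha> \<noteq> 0" using g1 g(1) by auto
    then have a0: "0 < \<alpha>" using a by simp
    \<comment> \<open>Below \<open>1 / 2\<close> the admissible exponents stay below 2, as the
      interpolation weight requires.\<close>
    have "1 / (1 - \<alpha>) \<le> 1 / (1 / 2)" using a by (intro divide_left_mono) auto
    then have "\<gamma> \<le> 2" using g(2) by simp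
    then show "AE \<omega> in M. interpolating \<alpha> (\<lambda>n. \<Lambda> n \<omega>)"
      using a a0 g g1 by (intro AE_interpolating[of \<gamma>]) auto
  qed
qed

end
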